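(* Let $a\in\mathbb{C}\setminus\{0,-1,1,-2,-\tfrac12\}$ and put $s_1=-1-a$, $s_2=1$, $s_3=a$ (so the $s_i$ are pairwise distinct). Let $\mathfrak{m}=\mathfrak{g}_{-1}\oplus\mathfrak{g}_{-2}$ be the graded nilpotent Lie superalgebra with $\mathfrak{g}_{-1}=\langle e_1,e_2\,|\,e_3,e_4\rangle$, $\mathfrak{g}_{-2}=\langle e_5\,|\,e_6\rangle$ ($e_1,e_2,e_5$ even; $e_3,e_4,e_6$ odd) and only nontrivial brackets $[e_1,e_3]=e_6$, $[e_2,e_4]=e_6$, $[e_3,e_4]=s_1e_5$. Let $M=M^{3|3}=\exp(\mathfrak{m})$, with the left-invariant superdistribution $\mathcal{D}$ of rank $(2|2)$ generated by $\mathfrak{g}_{-1}$, and let $\mathcal{W}_M=M\times\mathcal{W}\subset\mathbb{P}(\mathrm{End}\,\mathcal{D})$ be the cone structure obtained by left translation of the projective supervariety $\mathcal{W}\subset\mathbb{P}(W)\subset\mathbb{P}(\mathrm{End}\,\mathfrak{g}_{-1})$ defined in the context. Then the Lie superalgebra of infinitesimal symmetries of the cone structure $\mathcal{W}_M$ is $D(2,1;a)$.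
   Context: Let $\omega^i$ be the basis of $\mathfrak{g}_{-1}^*$ dual to $e_1,\dots,e_4$, $V_1=\langle e_1,e_4\rangle$, $V_2=\langle e_2,e_3\rangle$, and $W=(V_1\otimes V_1^* )\oplus(V_2\otimes V_2^* )\subset\mathrm{End}(\mathfrak{g}_{-1})$. In the basis $e_1\otimes\omega^1,\ e_4\otimes\omega^4,\ e_2\otimes\omega^2,\ e_3\otimes\omega^3\ |\ e_1\otimes\omega^4,\ e_4\otimes\omega^1,\ e_2\otimes\omega^3,\ e_3\otimes\omega^2$ of $W$ with right coordinates $(x_1,x_2,x_3,x_4|\xi_1,\xi_2,\xi_3,\xi_4)$, $\mathcal{W}$ is the image of $\mathbb{P}^{0|2}$ (homogeneous coordinates $z$ even and invertible, $\nu,\theta$ odd): $$\mathcal{W}=\{[\,z^2:\nu\theta:z^2+(a-1)\nu\theta:a\nu\theta:z\nu:z\theta:az\nu:z\theta\,]\}\subset\mathbb{P}(W),$$ which satisfies $x_3-x_4=x_1-x_2$, $x_4=ax_2$, $\xi_3=a\xi_1$, $\xi_4=\xi_2$, $x_1x_2=\xi_1\xi_2$. Equivalently, $\mathcal{W}$ is the orbit of the point $[e_1\otimes\omega^1+e_2\otimes\omega^2]$ under $G_0=\exp\mathfrak{g}_0$, where $\mathfrak{g}_0\subset\mathfrak{gl}(\mathfrak{g}_{-1})$ is spanned by the diagonal maps $\mathrm{diag}(a_1,a_2,a_1+a_3,a_2-a_3)$ in the basis $e_1,e_2,e_3,e_4$ and the odd maps $\psi^+:e_1\mapsto-e_4,\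 e_2\mapsto-e_3,\ e_3,e_4\mapsto0$ and $\psi^-:e_4\mapsto s_2e_1,\ e_3\mapsto s_3e_2,\ e_1,e_2\mapsto0$. An infinitesimal symmetry of $\mathcal{W}_M$ is a supervector field on $M$ preserving $\mathcal{D}$ and whose natural lift to $\mathbb{P}(\mathrm{End}\,\mathcal{D})$ is tangent to $\mathcal{W}_M$. ($M$ is locally equivalent to the generalized flag supermanifold $G/P_{23}^{\rm I}$ of $D(2,1;a)$.) $D(2,1;a)=\Gamma(-1-a,1,a)$, where for $s_1+s_2+s_3=0$, $\Gamma(s_1,s_2,s_3)$ is the Lie superalgebra with even part $\mathfrak{sl}_2^{\oplus3}$ ($i$-th copy with standard basis $X_i,H_i,Y_i$), odd part $\mathbb{C}^2\boxtimes\mathbb{C}^2\boxtimes\mathbb{C}^2$ (each $\mathbb{C}^2=\langle x,y\rangle$ standard: $X=x\partial_y$, $H=x\partial_x-y\partial_y$, $Y=y\partial_x$), and odd-odd bracket $[v_1v_2v_3,w_1w_2w_3]=s_1\varphi_1(v_1w_1)\eta_2(v_2,w_2)\eta_3(v_3,w_3)+s_2\eta_1(v_1,w_1)\varphi_2(v_2w_2)\eta_3(v_3,w_3)+s_3\eta_1(v_1,w_1)\eta_2(v_2,w_2)\varphi_3(v_3w_3)$, with $\eta_i$ skew, $\eta_i(x,y)=1$, $\varphi_i:x^2\mapsto X_i,\ -2xy\mapsto H_i,\ -y^2\mapsto Y_i$. In this realization $e_1=Y_2,\ e_2=Y_3,\ e_3=yxy,\ e_4=yyx,\ e_5=Y_1,\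 e_6=yyy$. *)

theory Defs
  imports "HOL-Analysis.Analysis" "HOL-Library.Function_Algebras"
begin

section \<open>Superfunctions\<close>

text \<open>
  A superfunction on a superdomain with three even coordinates is
  \<open>f = \<Sum>\<^sub>S f S \<theta>\<^sub>S\<close>, where \<open>\<theta>\<^sub>S = \<theta>\<^sub>i \<theta>\<^sub>j \<dots>\<close> for \<open>S = {i < j < \<dots>}\<close> and the odd generators
  are numbered by natural numbers.  \<open>superfunctions q\<close> is the algebra of holomorphic
  superfunctions of \<open>\<complex>\<^sup>3\<^sup>|\<^sup>q\<close>; since it uses the generators \<open>0, \<dots>, q - 1\<close>, pull-back along the
  projection forgetting odd coordinates is the inclusion \<open>superfunctions q \<subseteq> superfunctions (q + r)\<close>.
  Sums are pointwise; the product of superfunctions is \<open>\<odot>\<close> (and not the pointwise \<open>*\<close>).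
\<close>

type_synonym sfun = "nat set \<Rightarrow> complex^3 \<Rightarrow> complex"

definition holomorphic3 :: "(complex^3 \<Rightarrow> complex) \<Rightarrow> bool" where
  "holomorphic3 f \<longleftrightarrow>
     (\<forall>x. \<exists>f'. (f has_derivative f') (at x) \<and> (\<forall>c v. f' (c *s v) = c * f' v))"

definition superfunctions :: "nat \<Rightarrow> sfun set" where
  "superfunctions q = {f. (\<forall>S. holomorphic3 (f S)) \<and> (\<forall>S. \<not> S \<subseteq> {..<q} \<longrightarrow> f S = 0)}"

definition koszul_sign :: "nat set \<Rightarrow> nat set \<Rightarrow> complex" where
  "koszul_sign S T = (-1) ^ card {(i, j). i \<in> S \<and> j \<in> T \<and> j < i}"

definition smult :: "sfun \<Rightarrow> sfun \<Rightarrow> sfun" (infixl "\<odot>" 70) where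
  "f \<odot> g = (\<lambda>S x. \<Sum>T\<in>Pow S. koszul_sign T (S - T) * f T x * g (S - T) x)"

definition sconst :: "complex \<Rightarrow> sfun" where
  "sconst c = (\<lambda>S x. if S = {} then c else 0)"

definition even_coord :: "3 \<Rightarrow> sfun" where
  "even_coord i = (\<lambda>S x. if S = {} then x $ i else 0)"

definition odd_coord :: "nat \<Rightarrow> sfun" where
  "odd_coord n = (\<lambda>S x. if S = {n} then 1 else 0)"

definition even_partial :: "3 \<Rightarrow> sfun \<Rightarrow> sfun" where
  "even_partial i f = (\<lambda>S x. deriv (\<lambda>t. f S (x + t *s axis i 1)) 0)"

text \<open>Left derivative with respect to the \<open>n\<close>-th odd generator.\<close>

definition odd_partial :: "nat \<Rightarrow> sfun \<Rightarrow> sfun" where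
  "odd_partial n f =
     (\<lambda>S x. if n \<in> S then 0 else (-1) ^ card {i \<in> S. i < n} * f (insert n S) x)"


section \<open>The Lie superalgebra \<open>\<mm>\<close> and supervector fields on \<open>M = exp \<mm>\<close>\<close>

text \<open>
  The same index type serves for the basis \<open>e\<^sub>1, \<dots>, e\<^sub>6\<close> of \<open>\<mm>\<close> and for the corresponding
  exponential coordinates \<open>u\<^sup>1, \<dots>, u\<^sup>6\<close> of \<open>M\<close>, which identify \<open>M\<close> with \<open>\<complex>\<^sup>3\<^sup>|\<^sup>3\<close>.
\<close>

datatype mix = E1 | E2 | E3 | E4 | E5 | E6

instance mix :: finite
proof
  have "(UNIV :: mix set) = {E1, E2, E3, E4, E5, E6}"
    using mix.exhaust by blast
  then show "finite (UNIV :: mix set)"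
    by (metis finite.emptyI finite.insertI)
qed

fun par :: "mix \<Rightarrow> nat" where
  "par E1 = 0" | "par E2 = 0" | "par E5 = 0" | "par E3 = 1" | "par E4 = 1" | "par E6 = 1"

text \<open>\<open>m_const s\<^sub>1 i j k\<close> is the coefficient of \<open>e\<^sub>k\<close> in \<open>[e\<^sub>i, e\<^sub>j]\<close>.\<close>

definition m_const :: "complex \<Rightarrow> mix \<Rightarrow> mix \<Rightarrow> mix \<Rightarrow> complex" where
  "m_const s1 i j k =
     (if (i, j, k) \<in> {(E1, E3, E6), (E2, E4, E6)} then 1
      else if (i, j, k) \<in> {(E3, E1, E6), (E4, E2, E6)} then - 1
      else if (i, j, k) \<in> {(E3, E4, E5), (E4, E3, E5)} then s1
      else 0)"

fun coord :: "mix \<Rightarrow> sfun" where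
  "coord E1 = even_coord 1" | "coord E2 = even_coord 2" | "coord E5 = even_coord 3"
| "coord E3 = odd_coord 0" | "coord E4 = odd_coord 1" | "coord E6 = odd_coord 2"

fun partial :: "mix \<Rightarrow> sfun \<Rightarrow> sfun" where
  "partial E1 = even_partial 1" | "partial E2 = even_partial 2" | "partial E5 = even_partial 3"
| "partial E3 = odd_partial 0" | "partial E4 = odd_partial 1" | "partial E6 = odd_partial 2"

text \<open>
  \<open>X :: vfield\<close> stands for the derivation \<open>\<Sum>\<^sub>k X k \<partial>\<^sub>k\<close>.  \<open>vfields q\<close> consists of the fields with
  coefficients in \<open>superfunctions q\<close>: for \<open>q = 3\<close> these are the supervector fields on \<open>M\<close>, for
  \<open>q = 5\<close> the fields on \<open>M \<times> \<complex>\<^sup>0\<^sup>|\<^sup>2\<close> which annihilate the two additional odd coordinates.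
\<close>

type_synonym vfield = "mix \<Rightarrow> sfun"

definition vfields :: "nat \<Rightarrow> vfield set" where
  "vfields q = {X. \<forall>k. X k \<in> superfunctions q}"

definition fmult :: "sfun \<Rightarrow> vfield \<Rightarrow> vfield" (infixr "\<cdot>\<^sub>v" 72) where
  "f \<cdot>\<^sub>v X = (\<lambda>k. f \<odot> X k)"

definition vapply :: "vfield \<Rightarrow> sfun \<Rightarrow> sfun" where
  "vapply X f = (\<Sum>k\<in>UNIV. X k \<odot> partial k f)"

text \<open>The component of parity \<open>p\<close> of a vector field; parities are natural numbers modulo 2.\<close>

definition vpart :: "nat \<Rightarrow> vfield \<Rightarrow> vfield" where
  "vpart p X = (\<lambda>k S. if even (card S + par k + p) then X k S else 0)"

definition vbracket :: "vfield \<Rightarrow> vfield \<Rightarrow> vfield" where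
  "vbracket X Y = (\<lambda>k. \<Sum>p\<in>{0, 1}. \<Sum>q\<in>{0, 1}.
     vapply (vpart p X) (vpart q Y k) - sconst ((-1) ^ (p * q)) \<odot> vapply (vpart q Y) (vpart p X k))"

text \<open>
  As \<open>\<mm>\<close> is nilpotent of step two, the group law of \<open>exp \<mm>\<close> is \<open>u * v = u + v + [u, v] / 2\<close>, where
  \<open>u = \<Sum>\<^sub>j u\<^sup>j e\<^sub>j\<close> is even.  For a parameter \<open>\<epsilon>\<close> of the parity of \<open>e\<^sub>i\<close> one has
  \<open>[u, \<epsilon> e\<^sub>i] = \<epsilon> \<Sum>\<^sub>j u\<^sup>j [e\<^sub>j, e\<^sub>i]\<close>, so differentiation of \<open>f (u * \<epsilon> e\<^sub>i)\<close> by \<open>\<epsilon>\<close> gives the left-invariant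
  field \<open>L\<^sub>i = \<partial>\<^sub>i + 1/2 \<Sum>\<^sub>j\<^sub>k u\<^sup>j c\<^sub>j\<^sub>i\<^sup>k \<partial>\<^sub>k\<close> with value \<open>e\<^sub>i\<close> at the identity.
\<close>

definition left_inv :: "complex \<Rightarrow> mix \<Rightarrow> vfield" where
  "left_inv s1 i = (\<lambda>k. sconst (if k = i then 1 else 0)
     + (\<Sum>j\<in>UNIV. sconst (m_const s1 j i k / 2) \<odot> coord j))"


section \<open>The superdistribution and the cone structure\<close>

definition neg1 :: "mix set" where
  "neg1 = {E1, E2, E3, E4}"

definition D_sections :: "complex \<Rightarrow> nat \<Rightarrow> vfield set" where
  "D_sections s1 q = {Y. \<exists>c. (\<forall>i. c i \<in> superfunctions q) \<and>
     Y = (\<Sum>i\<in>neg1. c i \<cdot>\<^sub>v left_inv s1 i)}"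

definition preserves_D :: "complex \<Rightarrow> vfield \<Rightarrow> bool" where
  "preserves_D s1 X \<longleftrightarrow> (\<forall>Y \<in> D_sections s1 3. vbracket X Y \<in> D_sections s1 3)"

text \<open>
  An even matrix \<open>y\<close> of superfunctions stands for the section \<open>\<Sum>\<^sub>i\<^sub>j y i j L\<^sub>i \<otimes> \<omega>\<^sup>j\<close> of \<open>End \<D>\<close>.
  It acts linearly over superfunctions on sections \<open>Y = \<Sum>\<^sub>i Y i \<cdot>\<^sub>v L\<^sub>i\<close> of \<open>\<D>\<close>; the coefficients are
  \<open>Y i\<close> for \<open>i \<in> neg1\<close> because \<open>L\<^sub>i \<equiv> \<partial>\<^sub>i\<close> modulo \<open>\<partial>\<^sub>5, \<partial>\<^sub>6\<close>.
\<close>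

definition end_apply :: "complex \<Rightarrow> (mix \<Rightarrow> mix \<Rightarrow> sfun) \<Rightarrow> vfield \<Rightarrow> vfield" where
  "end_apply s1 y Y = (\<Sum>j\<in>neg1. Y j \<cdot>\<^sub>v (\<Sum>i\<in>neg1. y i j \<cdot>\<^sub>v left_inv s1 i))"

text \<open>
  A field \<open>X\<close> preserving \<open>\<D>\<close> acts on sections of \<open>End \<D>\<close> by the Lie derivative
  \<open>(\<L>\<^sub>X A) Y = [X, A Y] - A [X, Y]\<close> (\<open>A\<close> even).  Its natural lift is the linear field on the total
  space of \<open>End \<D>\<close> projecting to \<open>X\<close> whose vertical part at the point with fibre coordinates
  \<open>y i j\<close> with respect to the frame \<open>L\<^sub>i \<otimes> \<omega>\<^sup>j\<close> is \<open>- \<L>\<^sub>X (\<Sum>\<^sub>i\<^sub>j y i j L\<^sub>i \<otimes> \<omega>\<^sup>j)\<close>, the \<open>y i j\<close> being treated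
  as constants with respect to \<open>X\<close>.
\<close>

definition lift_vertical ::
    "complex \<Rightarrow> vfield \<Rightarrow> (mix \<Rightarrow> mix \<Rightarrow> sfun) \<Rightarrow> mix \<Rightarrow> mix \<Rightarrow> sfun" where
  "lift_vertical s1 X y i j =
     - (vbracket X (end_apply s1 y (left_inv s1 j))
        - end_apply s1 y (vbracket X (left_inv s1 j))) i"

text \<open>
  The point of \<open>\<W>\<close> with homogeneous coordinates \<open>z, \<nu>, \<theta>\<close>; the entry \<open>i j\<close> is the coordinate along
  \<open>e\<^sub>i \<otimes> \<omega>\<^sup>j\<close>.  Passing from right to left coordinates changes the sign of the odd ones, which is
  the reparametrization \<open>(\<nu>, \<theta>) \<mapsto> (-\<nu>, -\<theta>)\<close> of \<open>\<W>\<close>.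
\<close>

fun W_point :: "complex \<Rightarrow> sfun \<Rightarrow> sfun \<Rightarrow> sfun \<Rightarrow> mix \<Rightarrow> mix \<Rightarrow> sfun" where
  "W_point a z \<nu> \<theta> E1 E1 = z \<odot> z"
| "W_point a z \<nu> \<theta> E4 E4 = \<nu> \<odot> \<theta>"
| "W_point a z \<nu> \<theta> E2 E2 = z \<odot> z + sconst (a - 1) \<odot> \<nu> \<odot> \<theta>"
| "W_point a z \<nu> \<theta> E3 E3 = sconst a \<odot> \<nu> \<odot> \<theta>"
| "W_point a z \<nu> \<theta> E1 E4 = z \<odot> \<nu>"
| "W_point a z \<nu> \<theta> E4 E1 = z \<odot> \<theta>"
| "W_point a z \<nu> \<theta> E2 E3 = sconst a \<odot> z \<odot> \<nu>"
| "W_point a z \<nu> \<theta> E3 E2 = z \<odot> \<theta>"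
| "W_point a z \<nu> \<theta> _ _ = 0"

text \<open>
  As \<open>z\<close> is invertible, \<open>\<P>\<^sup>0\<^sup>|\<^sup>2\<close> is covered by the chart \<open>z = 1\<close>, and \<open>\<W>\<^sub>M\<close> is the image of
  \<open>M \<times> \<complex>\<^sup>0\<^sup>|\<^sup>2\<close>, where \<open>\<nu>\<close> and \<open>\<theta>\<close> are the odd generators number 3 and 4.
\<close>

definition W_param :: "complex \<Rightarrow> mix \<Rightarrow> mix \<Rightarrow> sfun" where
  "W_param a = W_point a (sconst 1) (odd_coord 3) (odd_coord 4)"

text \<open>
  Tangency of the lift to \<open>\<W>\<^sub>M = M \<times> \<W>\<close>: along the parametrization, the vertical part of the lift
  is a combination of the derivatives of the parametrization by \<open>\<nu>\<close> and \<open>\<theta>\<close>.  Tangent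
  vectors of \<open>\<P>(End \<D>)\<close> at \<open>[y]\<close> are given by elements of \<open>End \<D>\<close> modulo \<open>y\<close>, whence the term with
  \<open>f\<close>.
\<close>

definition lift_tangent_to_W :: "complex \<Rightarrow> complex \<Rightarrow> vfield \<Rightarrow> bool" where
  "lift_tangent_to_W a s1 X \<longleftrightarrow>
     (\<exists>f \<in> superfunctions 5. \<exists>g \<in> superfunctions 5. \<exists>h \<in> superfunctions 5.
        \<forall>i \<in> neg1. \<forall>j \<in> neg1.
          lift_vertical s1 X (W_param a) i j =
            f \<odot> W_param a i j
            + g \<odot> odd_partial 3 (W_param a i j)
            + h \<odot> odd_partial 4 (W_param a i j))"

definition symmetries :: "complex \<Rightarrow> complex \<Rightarrow> vfield set" where
  "symmetries a s1 = {X \<in> vfields 3. \<forall>p \<in> {0, 1}.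
     preserves_D s1 (vpart p X) \<and> lift_tangent_to_W a s1 (vpart p X)}"


section \<open>Lie superalgebras and their isomorphisms\<close>

text \<open>
  The addition is that of the ambient type; \<open>component p\<close> is the projection to the part of
  parity \<open>p\<close> modulo 2.
\<close>

record 'v lie_super =
  lcarrier :: "'v set"
  lscale :: "complex \<Rightarrow> 'v \<Rightarrow> 'v"
  lcomponent :: "nat \<Rightarrow> 'v \<Rightarrow> 'v"
  lbracket :: "'v \<Rightarrow> 'v \<Rightarrow> 'v"

definition lie_super_closed :: "('v::ab_group_add) lie_super \<Rightarrow> bool" where
  "lie_super_closed G \<longleftrightarrow> 0 \<in> lcarrier G \<and>
     (\<forall>u \<in> lcarrier G. \<forall>v \<in> lcarrier G. u + v \<in> lcarrier G \<and> lbracket G u v \<in> lcarrier G) \<and>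
     (\<forall>u \<in> lcarrier G. (\<forall>c. lscale G c u \<in> lcarrier G) \<and> (\<forall>p. lcomponent G p u \<in> lcarrier G))"

definition lie_super_isomorphic ::
    "('v::ab_group_add) lie_super \<Rightarrow> ('w::ab_group_add) lie_super \<Rightarrow> bool" where
  "lie_super_isomorphic G H \<longleftrightarrow> lie_super_closed G \<and> lie_super_closed H \<and>
     (\<exists>F. bij_betw F (lcarrier G) (lcarrier H) \<and>
       (\<forall>u \<in> lcarrier G. \<forall>v \<in> lcarrier G.
          F (u + v) = F u + F v \<and> F (lbracket G u v) = lbracket H (F u) (F v)) \<and>
       (\<forall>u \<in> lcarrier G. (\<forall>c. F (lscale G c u) = lscale H c (F u)) \<and>
          (\<forall>p. F (lcomponent G p u) = lcomponent H p (F u))))"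

definition symmetry_superalgebra :: "complex \<Rightarrow> complex \<Rightarrow> vfield lie_super" where
  "symmetry_superalgebra a s1 =
     \<lparr> lcarrier = symmetries a s1,
       lscale = (\<lambda>c X k. sconst c \<odot> X k),
       lcomponent = vpart,
       lbracket = vbracket \<rparr>"


section \<open>The Lie superalgebras \<open>\<Gamma>(s\<^sub>1, s\<^sub>2, s\<^sub>3)\<close> and \<open>D(2,1;a)\<close>\<close>

datatype sl2b = BX | BH | BY

datatype vb = Vx | Vy

instance sl2b :: finite
proof
  have "(UNIV :: sl2b set) = {BX, BH, BY}"
    using sl2b.exhaust by blast
  then show "finite (UNIV :: sl2b set)"
    by (metis finite.emptyI finite.insertI)
qed

instance vb :: finite
proof
  have "(UNIV :: vb set) = {Vx, Vy}"
    using vb.exhaust by blast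
  then show "finite (UNIV :: vb set)"
    by (metis finite.emptyI finite.insertI)
qed

text \<open>In the following tables the last argument selects the coefficient.\<close>

fun sl2_const :: "sl2b \<Rightarrow> sl2b \<Rightarrow> sl2b \<Rightarrow> complex" where
  "sl2_const BH BX BX = 2"
| "sl2_const BX BH BX = - 2"
| "sl2_const BH BY BY = - 2"
| "sl2_const BY BH BY = 2"
| "sl2_const BX BY BH = 1"
| "sl2_const BY BX BH = - 1"
| "sl2_const _ _ _ = 0"

fun sl2_act :: "sl2b \<Rightarrow> vb \<Rightarrow> vb \<Rightarrow> complex" where
  "sl2_act BX Vy Vx = 1"
| "sl2_act BH Vx Vx = 1"
| "sl2_act BH Vy Vy = - 1"
| "sl2_act BY Vx Vy = 1"
| "sl2_act _ _ _ = 0"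

fun eta :: "vb \<Rightarrow> vb \<Rightarrow> complex" where
  "eta Vx Vy = 1"
| "eta Vy Vx = - 1"
| "eta _ _ = 0"

fun phi :: "vb \<Rightarrow> vb \<Rightarrow> sl2b \<Rightarrow> complex" where
  "phi Vx Vx BX = 1"
| "phi Vx Vy BH = - 1 / 2"
| "phi Vy Vx BH = - 1 / 2"
| "phi Vy Vy BY = - 1"
| "phi _ _ _ = 0"

text \<open>
  The basis of \<open>\<Gamma>(s\<^sub>1, s\<^sub>2, s\<^sub>3)\<close>: \<open>Inl (i, b)\<close> is the element \<open>b\<close> of the \<open>i\<close>-th copy of \<open>sl\<^sub>2\<close>, and
  \<open>Inr (v\<^sub>1, v\<^sub>2, v\<^sub>3)\<close> is the odd element \<open>v\<^sub>1 v\<^sub>2 v\<^sub>3\<close>.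
\<close>

type_synonym gix = "(3 \<times> sl2b) + (vb \<times> vb \<times> vb)"

fun gact :: "3 \<Rightarrow> sl2b \<Rightarrow> vb \<times> vb \<times> vb \<Rightarrow> vb \<times> vb \<times> vb \<Rightarrow> complex" where
  "gact i b (v1, v2, v3) (w1, w2, w3) =
     (if i = 1 then (if v2 = w2 \<and> v3 = w3 then sl2_act b v1 w1 else 0)
      else if i = 2 then (if v1 = w1 \<and> v3 = w3 then sl2_act b v2 w2 else 0)
      else (if v1 = w1 \<and> v2 = w2 then sl2_act b v3 w3 else 0))"

fun gamma_const :: "complex \<Rightarrow> complex \<Rightarrow> complex \<Rightarrow> gix \<Rightarrow> gix \<Rightarrow> gix \<Rightarrow> complex" where
  "gamma_const s1 s2 s3 (Inl (i, b)) (Inl (j, c)) (Inl (k, d)) =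
     (if i = j \<and> j = k then sl2_const b c d else 0)"
| "gamma_const s1 s2 s3 (Inl (i, b)) (Inr v) (Inr w) = gact i b v w"
| "gamma_const s1 s2 s3 (Inr v) (Inl (i, b)) (Inr w) = - gact i b v w"
| "gamma_const s1 s2 s3 (Inr (v1, v2, v3)) (Inr (w1, w2, w3)) (Inl (i, d)) =
     (if i = 1 then s1 * phi v1 w1 d * eta v2 w2 * eta v3 w3
      else if i = 2 then s2 * eta v1 w1 * phi v2 w2 d * eta v3 w3
      else s3 * eta v1 w1 * eta v2 w2 * phi v3 w3 d)"
| "gamma_const s1 s2 s3 _ _ _ = 0"

definition Gamma :: "complex \<Rightarrow> complex \<Rightarrow> complex \<Rightarrow> (gix \<Rightarrow> complex) lie_super" where
  "Gamma s1 s2 s3 =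
     \<lparr> lcarrier = UNIV,
       lscale = (\<lambda>c u k. c * u k),
       lcomponent = (\<lambda>p u k. if even (p + (case k of Inl _ \<Rightarrow> 0 | Inr _ \<Rightarrow> 1)) then u k else 0),
       lbracket = (\<lambda>u v k. \<Sum>i\<in>UNIV. \<Sum>j\<in>UNIV. u i * v j * gamma_const s1 s2 s3 i j k) \<rparr>"

definition D21 :: "complex \<Rightarrow> (gix \<Rightarrow> complex) lie_super" where
  "D21 a = Gamma (- 1 - a) 1 a"

end

theory Submission
  imports Defs "HOL-Complex_Analysis.Cauchy_Integral_Formula"
begin

text \<open>
  Let \<open>\<gg> = D(2,1;a)\<close>, graded with negative part \<open>\<mm>\<close>.  A flat section is a \<open>\<gg>\<close>-valued superfunction \<open>\<Phi>\<close> on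
  \<open>M\<close> with \<open>L\<^sub>i \<Phi> = - [e\<^sub>i, \<Phi>]\<close> for \<open>i = 1, \<dots>, 4\<close>.  The coefficients of a symmetry \<open>X\<close> in the frame \<open>L\<^sub>i\<close> are
  the \<open>\<mm>\<close>-part of a unique flat section: preservation of \<open>\<D>\<close> is flatness in degree \<open>-2\<close>, tangency to the
  cone says that the action of \<open>X\<close> on \<open>\<D>\<close> lies in \<open>\<gg>\<^sub>0\<close> at every point, which gives the components of
  degree \<open>0\<close>, and the commutation relations of the \<open>L\<^sub>i\<close> then produce those of degree \<open>1\<close> and \<open>2\<close>.
  A flat section is determined by its value \<open>u\<close> at the origin, where all values occur because
  \<open>exp (- ad U) u\<close> with \<open>U = \<Sum>\<^sub>j u\<^sup>j e\<^sub>j\<close> is flat.  Finally \<open>[X, Y]\<close> belongs to \<open>- [\<Phi>, \<Psi>]\<close> if \<open>X, Y\<close> belong to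
  \<open>\<Phi>, \<Psi>\<close>, so that sending \<open>u\<close> to the field with value \<open>- u\<close> is the isomorphism.
\<close>


section \<open>Partial derivatives of holomorphic functions\<close>

text \<open>A flat section with value u at the origin is Ad(g^-1) u for g = exp U, that is, the
  fundamental field of u written in the left-invariant frame. Both minus signs come from this:
  left-invariant derivatives of Ad(g^-1) u produce - ad, and generators of a left action bracket
  with the opposite sign. No general prolongation theory is invoked: the missing components are
  written as derivatives of the coefficients of X, and their equations are extracted from the
  commutators among L_1, ..., L_4, with L_6 eliminated between [L_1, L_3] and [L_2, L_4]. The
  parameter enters at three points: a \<noteq> 1 forces the entries mixing the two blocks of the
  cone to vanish; a \<noteq> 0 allows division by s_3 in the equations of the cone and of the
  prolongation; a \<noteq> -1 means s_1 \<noteq> 0, so that L_5 is recovered from [L_3, L_4]. The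
  analytic obstacle is that \<open>holomorphic3\<close> grants only one derivative, whereas
  commutators of vector fields need second ones.\<close>

definition pderiv3 :: "3 \<Rightarrow> (complex^3 \<Rightarrow> complex) \<Rightarrow> complex^3 \<Rightarrow> complex" where
  "pderiv3 i f = (\<lambda>x. deriv (\<lambda>t. f (x + t *s axis i 1)) 0)"

lemma even_partial_eq_pderiv3: "even_partial i f S = pderiv3 i (f S)"
  by (simp add: even_partial_def pderiv3_def)

lemma has_derivative_axis_line:
  "((\<lambda>t. (x::complex^3) + t *s axis i 1) has_derivative (\<lambda>t. t *s axis i 1)) (at (t::complex))"
proof -
  have "bounded_linear (\<lambda>t::complex. t *s (axis i 1 :: complex^3))"
    by (intro linear_conv_bounded_linear[THEN iffD1] linearI)
       (simp_all add: vec_eq_iff algebra_simps scaleR_vec_def vector_scalar_mult_def)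
  then show ?thesis
    using has_derivative_add[OF has_derivative_const bounded_linear_imp_has_derivative] by force
qed

lemma has_field_derivative_axis_slice:
  fixes f :: "complex^3 \<Rightarrow> complex"
  assumes f: "(f has_derivative f') (at (x + t *s axis i 1))"
    and lin: "\<And>c v. f' (c *s v) = c * f' v"
  shows "((\<lambda>t. f (x + t *s axis i 1)) has_field_derivative f' (axis i 1)) (at t)"
proof -
  have "((\<lambda>t. f (x + t *s axis i 1)) has_derivative (\<lambda>t. f' (t *s axis i 1))) (at t)"
    using has_derivative_compose[OF has_derivative_axis_line f] by simp
  moreover have "(\<lambda>t. f' (t *s axis i 1)) = (*) (f' (axis i 1))"
    by (auto simp: lin fun_eq_iff)
  ultimately show ?thesis
    by (simp add: has_field_derivative_def)
qed

lemma vec3_axis_sum: "v = (\<Sum>i\<in>UNIV. (v $ i) *s axis i (1::complex))"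
  by (simp add: vec_eq_iff axis_def if_distrib[of "\<lambda>z. _ * z"] sum.delta cong: if_cong)

text \<open>The derivative granted by \<open>holomorphic3\<close> is real-linear and commutes with
  complex scalars, so its values on the three axes determine it. This canonical form serves all
  later computations of derivatives.\<close>

lemma holomorphic3_has_derivative:
  assumes "holomorphic3 f"
  shows "(f has_derivative (\<lambda>v. \<Sum>i\<in>UNIV. v $ i * pderiv3 i f x)) (at x)"
proof -
  obtain f' where f': "(f has_derivative f') (at x)" and lin: "\<And>c v. f' (c *s v) = c * f' v"
    using assms unfolding holomorphic3_def by blast
  have pd: "pderiv3 i f x = f' (axis i 1)" for i
    unfolding pderiv3_def
    using has_field_derivative_axis_slice[of f f' x 0 i] f' lin by (simp add: DERIV_imp_deriv)
  have "linear f'"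
    using f' has_derivative_linear by blast
  have "f' v = (\<Sum>i\<in>UNIV. v $ i * f' (axis i 1))" for v
  proof -
    have "f' v = f' (\<Sum>i\<in>UNIV. (v $ i) *s axis i 1)"
      by (rule arg_cong[OF vec3_axis_sum])
    also have "\<dots> = (\<Sum>i\<in>UNIV. f' ((v $ i) *s axis i 1))"
      by (rule linear_sum[OF \<open>linear f'\<close>])
    finally show ?thesis
      by (simp only: lin)
  qed
  then have "f' = (\<lambda>v. \<Sum>i\<in>UNIV. v $ i * pderiv3 i f x)"
    unfolding pd by (rule ext)
  with f' show ?thesis by simp
qed

lemma holomorphic3_slice_DERIV:
  assumes "holomorphic3 f"
  shows "((\<lambda>t. f (x + t *s axis i 1)) has_field_derivative pderiv3 i f (x + t *s axis i 1)) (at t)"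
proof -
  have "(\<Sum>j\<in>UNIV. axis i 1 $ j * pderiv3 j f y) = pderiv3 i f y" for y
    by (simp add: axis_def if_distrib[of "\<lambda>z. z * _"] sum.delta' cong: if_cong)
  then show ?thesis
    using has_field_derivative_axis_slice[OF holomorphic3_has_derivative[OF assms], of x t i]
    by (simp add: sum_distrib_left mult.assoc)
qed

lemma holomorphic3_slice_DERIV_0:
  "holomorphic3 f \<Longrightarrow> ((\<lambda>t. f (x + t *s axis i 1)) has_field_derivative pderiv3 i f x) (at 0)"
  using holomorphic3_slice_DERIV[of f x i 0] by simp

lemma holomorphic3_continuous: "holomorphic3 f \<Longrightarrow> continuous_on S f"
  by (meson continuous_at_imp_continuous_on has_derivative_continuous holomorphic3_has_derivative)

text \<open>Partial derivatives are handled through Cauchy's formula, as integrals over a translated unit circle: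
  this first makes them continuous, and then allows differentiation under the integral sign.\<close>

definition circ :: "real \<Rightarrow> complex" where
  "circ t = exp (2 * of_real pi * \<i> * of_real t)"

lemma circ_nz [simp]: "circ t \<noteq> 0"
  by (simp add: circ_def)

lemma continuous_on_circ [continuous_intros]:
  "continuous_on S g \<Longrightarrow> continuous_on S (\<lambda>x. circ (g x))"
  unfolding circ_def by (intro continuous_intros)

text \<open>The functions are entire on every complex line, so the unit circle can be used around
  each point and no radius has to be chosen.\<close>

lemma deriv_eq_circ_integral:
  assumes "g holomorphic_on UNIV"
  shows "deriv g 0 = integral {0..1} (\<lambda>t. g (circ t) / circ t)"
proof -
  have cont: "continuous_on (cball 0 1) g" and hol: "g holomorphic_on ball 0 1"
    using assms holomorphic_on_imp_continuous_on holomorphic_on_subset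
    by (blast, blast)
  have "deriv g 0 = 1 / (2 * of_real pi * \<i>) * contour_integral (circlepath 0 1) (\<lambda>u. g u / (u - 0)^2)"
    by (rule DERIV_imp_deriv, rule Cauchy_derivative_integral_circlepath[OF cont hol]) simp
  also have "\<dots> = 1 / (2 * of_real pi * \<i>) * integral {0..1} (\<lambda>t. 2 * of_real pi * \<i> * (g (circ t) / circ t))"
    unfolding contour_integral_integral vector_derivative_circlepath
    by (simp add: circlepath circ_def power2_eq_square divide_simps mult_ac)
  also have "\<dots> = integral {0..1} (\<lambda>t. g (circ t) / circ t)"
    by (simp only: integral_mult_right) simp
  finally show ?thesis .
qed

lemma pderiv3_eq_integral:
  assumes "holomorphic3 f"
  shows "pderiv3 i f x = integral (cbox 0 1) (\<lambda>t. f (x + circ t *s axis i 1) / circ t)"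
proof -
  have "(\<lambda>t. f (x + t *s axis i 1)) holomorphic_on UNIV"
    using holomorphic3_slice_DERIV[OF assms] by (auto simp: holomorphic_on_open)
  from deriv_eq_circ_integral[OF this] show ?thesis
    by (simp add: pderiv3_def)
qed

lemma continuous_on_axis_shift [continuous_intros]:
  assumes "continuous_on S g" "continuous_on S h"
  shows "continuous_on S (\<lambda>z. (g z :: complex^3) + h z *s axis i 1)"
  using assms unfolding vector_scalar_mult_def by (intro continuous_intros)

lemma continuous_on_shifted:
  assumes "continuous_on UNIV (g :: complex^3 \<Rightarrow> complex)"
  shows "continuous_on S (\<lambda>(x, t). g (x + circ t *s axis i 1))"
  unfolding split_beta
  by (rule continuous_on_compose2[OF assms]) (auto intro!: continuous_intros)

lemma continuous_pderiv3:
  assumes "holomorphic3 f"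
  shows "continuous_on UNIV (pderiv3 i f)"
proof -
  have "continuous_on (UNIV \<times> cbox 0 1) (\<lambda>(x, t). f (x + circ t *s axis i 1) / circ t)"
    using continuous_on_shifted[OF holomorphic3_continuous[OF assms]]
    unfolding split_beta by (intro continuous_intros) auto
  from integral_continuous_on_param[OF this]
  show ?thesis
    using pderiv3_eq_integral[OF assms] by (simp add: fun_eq_iff[symmetric])
qed

text \<open>Both claims come from one formula: differentiating the Cauchy integral of
  \<open>pderiv3 i f\<close> in direction \<open>j\<close> under the integral sign gives the Cauchy
  integral, in direction \<open>i\<close>, of \<open>pderiv3 j f\<close>. The premise of the second
  claim allows that integral to be read back as a derivative; \<open>pderiv3_commute\<close>
  discharges it by the first claim.\<close>

lemma holomorphic3_pderiv3:
  assumes f: "holomorphic3 f"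
  shows "holomorphic3 (pderiv3 i f)"
    and "holomorphic3 (pderiv3 j f) \<Longrightarrow> pderiv3 j (pderiv3 i f) x = pderiv3 i (pderiv3 j f) x"
proof -
  define F where "F = (\<lambda>z t. f (z + circ t *s axis i 1) / circ t)"
  \<comment> \<open>The derivative of the integrand is assembled as a bounded linear function, the
    form that \<open>leibniz_rule\<close> takes. Here \<open>coord\<close> denotes the coordinate
    forms on \<complex>^3 and not the coordinates of M.\<close>
  define coord where "coord j = Blinfun (\<lambda>v. (v :: complex^3) $ j)" for j
  have coord: "blinfun_apply (coord j) v = v $ j" for j v
    unfolding coord_def by (simp add: bounded_linear_Blinfun_apply bounded_linear_vec_nth)
  define F' where "F' = (\<lambda>z t. \<Sum>j\<in>UNIV.
    blinfun_mult_left (pderiv3 j f (z + circ t *s axis i 1) / circ t) o\<^sub>L coord j)"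
  have F'_apply: "blinfun_apply (F' z t) v =
      (\<Sum>j\<in>UNIV. v $ j * (pderiv3 j f (z + circ t *s axis i 1) / circ t))" for z t v
    by (simp add: F'_def blinfun.sum_left coord)
  have cont_shift: "continuous_on (UNIV \<times> cbox 0 1) (\<lambda>(z, t). pderiv3 j f (z + circ t *s axis i 1))" for j
    by (rule continuous_on_shifted[OF continuous_pderiv3[OF f]])
  have contF': "continuous_on (UNIV \<times> cbox 0 1) (\<lambda>(z, t). F' z t)"
    unfolding F'_def split_beta
    by (intro continuous_intros bounded_linear.continuous_on[OF bounded_linear_blinfun_mult_left]
        cont_shift[unfolded split_beta]) auto
  have intF: "F z integrable_on cbox 0 1" for z
    unfolding F_def
    by (intro integrable_continuous continuous_intros
        continuous_on_compose2[OF holomorphic3_continuous[OF f, of UNIV]]) auto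
  have derF: "((\<lambda>z. F z t) has_derivative blinfun_apply (F' z t)) (at z)" for z t
  proof -
    have "((\<lambda>z. f (z + circ t *s axis i 1)) has_derivative
        (\<lambda>v. \<Sum>j\<in>UNIV. v $ j * pderiv3 j f (z + circ t *s axis i 1))) (at z)"
      by (rule has_derivative_compose[of "\<lambda>z. z + circ t *s axis i 1" "\<lambda>v. v",
            OF _ holomorphic3_has_derivative[OF f]])
        (rule derivative_eq_intros refl | simp)+
    then have "((\<lambda>z. F z t) has_derivative
        (\<lambda>v. (\<Sum>j\<in>UNIV. v $ j * pderiv3 j f (z + circ t *s axis i 1)) / circ t)) (at z)"
      unfolding F_def by (rule bounded_linear.has_derivative[OF bounded_linear_divide])
    then show ?thesis
      by (simp add: F'_apply[abs_def] sum_divide_distrib)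
  qed
  have int_pd: "(\<lambda>t. pderiv3 j f (z + circ t *s axis i 1) / circ t) integrable_on cbox 0 1" for j z
    by (intro integrable_continuous continuous_intros
        continuous_on_compose2[OF continuous_pderiv3[OF f]]) auto
  have F'_int: "F' z integrable_on cbox 0 1" for z
    by (rule integrable_continuous, rule continuous_on_compose2[OF contF', of _ "\<lambda>t. (z, t)", simplified])
      (auto intro!: continuous_intros)
  have int_apply: "blinfun_apply (integral (cbox 0 1) (F' z)) v
      = (\<Sum>j\<in>UNIV. v $ j * integral (cbox 0 1) (\<lambda>t. pderiv3 j f (z + circ t *s axis i 1) / circ t))" for z v
    unfolding blinfun_apply_integral[OF F'_int] F'_apply
    by (subst integral_sum)
      (rule finite | rule integrable_on_mult_right[OF int_pd] | simp only: integral_mult_right)+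
  have der: "(pderiv3 i f has_derivative (\<lambda>v. \<Sum>j\<in>UNIV. v $ j *
      integral (cbox 0 1) (\<lambda>t. pderiv3 j f (z + circ t *s axis i 1) / circ t))) (at z)" for z
  proof -
    have "((\<lambda>z. integral (cbox 0 1) (F z)) has_derivative integral (cbox 0 1) (F' z)) (at z within UNIV)"
      by (rule leibniz_rule[OF derF intF contF' UNIV_I convex_UNIV])
    moreover have "(\<lambda>z. integral (cbox 0 1) (F z)) = pderiv3 i f"
      by (simp add: F_def pderiv3_eq_integral[OF f] fun_eq_iff)
    ultimately show ?thesis
      by (simp only: ext[OF int_apply])
  qed
  have hol: "holomorphic3 (pderiv3 i f)"
    unfolding holomorphic3_def
    by (intro allI exI conjI, rule der) (simp add: sum_distrib_left mult.assoc)
  then show "holomorphic3 (pderiv3 i f)" .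
  have "(\<Sum>k\<in>UNIV. axis j 1 $ k * g k) = g j" for g :: "3 \<Rightarrow> complex"
    by (simp add: axis_def if_distrib[of "\<lambda>z. z * _"] sum.delta' cong: if_cong)
  then have deq: "pderiv3 j (pderiv3 i f) x
      = integral (cbox 0 1) (\<lambda>t. pderiv3 j f (x + circ t *s axis i 1) / circ t)" for x
    using fun_cong[OF has_derivative_unique[OF der[of x] holomorphic3_has_derivative[OF hol, of x]],
        of "axis j 1"]
    by simp
  show "pderiv3 j (pderiv3 i f) x = pderiv3 i (pderiv3 j f) x" if "holomorphic3 (pderiv3 j f)"
    using deq pderiv3_eq_integral[OF that] by simp
qed

lemma pderiv3_commute:
  "holomorphic3 f \<Longrightarrow> pderiv3 j (pderiv3 i f) = pderiv3 i (pderiv3 j f)"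
  by (intro ext holomorphic3_pderiv3(2) holomorphic3_pderiv3(1))


section \<open>The algebra of superfunctions\<close>

lemma holomorphic3I:
  assumes "\<And>x. (f has_derivative f' x) (at x)" "\<And>x c v. f' x (c *s v) = c * f' x v"
  shows "holomorphic3 f"
  using assms unfolding holomorphic3_def by blast

lemma holomorphic3_const [simp]: "holomorphic3 (\<lambda>x. c)"
  by (rule holomorphic3I[where f' = "\<lambda>x v. 0"]) auto

lemma holomorphic3_zero [simp]: "holomorphic3 0"
  unfolding zero_fun_def by simp

lemma holomorphic3_nth [simp]: "holomorphic3 (\<lambda>x. x $ i)"
  by (rule holomorphic3I[where f' = "\<lambda>x v. v $ i"])
    (auto intro: bounded_linear_imp_has_derivative bounded_linear_vec_nth)

lemma holomorphic3_add:
  assumes "holomorphic3 f" "holomorphic3 g"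
  shows "holomorphic3 (\<lambda>x. f x + g x)"
  by (rule holomorphic3I, rule has_derivative_add[OF assms[THEN holomorphic3_has_derivative]])
    (simp add: sum_distrib_left distrib_left mult.assoc)

lemma holomorphic3_mult:
  assumes "holomorphic3 f" "holomorphic3 g"
  shows "holomorphic3 (\<lambda>x. f x * g x)"
  by (rule holomorphic3I, rule has_derivative_mult[OF assms[THEN holomorphic3_has_derivative]])
    (simp add: sum_distrib_left algebra_simps)

lemma holomorphic3_cmult: "holomorphic3 f \<Longrightarrow> holomorphic3 (\<lambda>x. c * f x)"
  by (rule holomorphic3_mult) auto

lemma holomorphic3_sum:
  "(\<And>a. a \<in> A \<Longrightarrow> holomorphic3 (f a)) \<Longrightarrow> holomorphic3 (\<lambda>x. \<Sum>a\<in>A. f a x)"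
  by (induct A rule: infinite_finite_induct) (auto intro: holomorphic3_add)

lemma pderiv3_eqI:
  "((\<lambda>t. f (x + t *s axis i 1)) has_field_derivative D) (at 0) \<Longrightarrow> pderiv3 i f x = D"
  unfolding pderiv3_def by (rule DERIV_imp_deriv)

lemma pderiv3_const [simp]: "pderiv3 i (\<lambda>x. c) x = 0"
  by (rule pderiv3_eqI) simp

lemma pderiv3_nth [simp]: "pderiv3 i (\<lambda>x. x $ j) x = (if i = j then 1 else 0)"
  by (rule pderiv3_eqI) (auto simp: axis_def intro!: derivative_eq_intros)

lemma pderiv3_add:
  "holomorphic3 f \<Longrightarrow> holomorphic3 g \<Longrightarrow>
    pderiv3 i (\<lambda>x. f x + g x) x = pderiv3 i f x + pderiv3 i g x"
  by (intro pderiv3_eqI DERIV_add holomorphic3_slice_DERIV_0)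

lemma pderiv3_mult:
  assumes "holomorphic3 f" "holomorphic3 g"
  shows "pderiv3 i (\<lambda>x. f x * g x) x = pderiv3 i f x * g x + f x * pderiv3 i g x"
proof (rule pderiv3_eqI)
  show "((\<lambda>t. f (x + t *s axis i 1) * g (x + t *s axis i 1)) has_field_derivative
      pderiv3 i f x * g x + f x * pderiv3 i g x) (at 0)"
    using DERIV_mult[OF assms[THEN holomorphic3_slice_DERIV_0], of x i] by (simp add: mult.commute)
qed

lemma pderiv3_cmult:
  assumes "holomorphic3 f" shows "pderiv3 i (\<lambda>x. c * f x) x = c * pderiv3 i f x"
  using pderiv3_mult[OF holomorphic3_const assms, of i c x] by simp

lemma pderiv3_sum:
  "(\<And>a. a \<in> A \<Longrightarrow> holomorphic3 (f a)) \<Longrightarrow>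
    pderiv3 i (\<lambda>x. \<Sum>a\<in>A. f a x) x = (\<Sum>a\<in>A. pderiv3 i (f a) x)"
  by (induct A rule: infinite_finite_induct) (auto simp: pderiv3_add holomorphic3_sum)

lemma sum_apply: "(sum f A) x = (\<Sum>a\<in>A. f a x)"
  by (induct A rule: infinite_finite_induct) auto

section \<open>Koszul signs as products over pairs\<close>

lemma koszul_sign_eq_prod:
  assumes "finite S" "finite T"
  shows "koszul_sign S T = (\<Prod>i\<in>S. \<Prod>j\<in>T. if j < i then -1 else 1)"
proof -
  have "(\<Prod>i\<in>S. \<Prod>j\<in>T. if j < i then -1 else 1 :: complex)
      = (\<Prod>p\<in>S \<times> T. if snd p < fst p then -1 else 1)"
    by (simp add: prod.cartesian_product split_beta)
  also have "\<dots> = (-1) ^ card {p \<in> S \<times> T. snd p < fst p}"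
    using assms by (simp add: prod.If_cases Int_def)
  also have "{p \<in> S \<times> T. snd p < fst p} = {(i, j). i \<in> S \<and> j \<in> T \<and> j < i}"
    by auto
  finally show ?thesis
    by (simp add: koszul_sign_def)
qed

lemma koszul_sign_empty [simp]: "koszul_sign {} T = 1" "koszul_sign S {} = 1"
  by (simp_all add: koszul_sign_def)

lemma koszul_sign_union_left:
  "finite S \<Longrightarrow> finite S' \<Longrightarrow> finite T \<Longrightarrow> S \<inter> S' = {} \<Longrightarrow>
    koszul_sign (S \<union> S') T = koszul_sign S T * koszul_sign S' T"
  by (simp add: koszul_sign_eq_prod prod.union_disjoint)

lemma koszul_sign_union_right:
  "finite S \<Longrightarrow> finite T \<Longrightarrow> finite T' \<Longrightarrow> T \<inter> T' = {} \<Longrightarrow>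
    koszul_sign S (T \<union> T') = koszul_sign S T * koszul_sign S T'"
  by (simp add: koszul_sign_eq_prod prod.union_disjoint prod.distrib)

text \<open>For disjoint sets every pair is an inversion of exactly one of the two orders, so the
  two products differ by one factor -1 per pair.\<close>

lemma koszul_sign_swap:
  assumes "finite S" "finite T" "S \<inter> T = {}"
  shows "koszul_sign S T = (-1) ^ (card S * card T) * koszul_sign T S"
proof -
  have "koszul_sign S T = (\<Prod>i\<in>S. \<Prod>j\<in>T. - (if i < j then -1 else 1))"
    unfolding koszul_sign_eq_prod[OF assms(1,2)] using assms(3)
    by (intro prod.cong refl) (auto simp: not_less le_less)
  also have "\<dots> = (\<Prod>i\<in>S. (-1) ^ card T * (\<Prod>j\<in>T. if i < j then -1 else 1))"
    by (simp only: prod_uminus)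
  also have "\<dots> = (-1) ^ (card S * card T) * (\<Prod>j\<in>T. \<Prod>i\<in>S. if i < j then -1 else 1)"
    by (simp add: prod.distrib prod.swap[of _ S T] mult.commute flip: power_mult)
  finally show ?thesis
    using assms by (simp add: koszul_sign_eq_prod)
qed

lemma koszul_sign_sq [simp]: "koszul_sign S T * koszul_sign S T = 1"
  by (simp add: koszul_sign_def flip: power_mult_distrib)

lemma koszul_sign_sq' [simp]: "koszul_sign S T * (koszul_sign S T * c) = c"
  by (simp add: mult.assoc[symmetric])

lemma koszul_sign_singleton: "koszul_sign {n} S = (-1) ^ card {i \<in> S. i < n}"
proof -
  have "{(i, j). i \<in> {n} \<and> j \<in> S \<and> j < i} = Pair n ` {i \<in> S. i < n}" by auto
  then show ?thesis
    by (simp add: koszul_sign_def card_image inj_on_def)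
qed

lemma koszul_sign_1: "(\<And>i j. i \<in> S \<Longrightarrow> j \<in> T \<Longrightarrow> i \<le> j) \<Longrightarrow> koszul_sign S T = 1"
proof -
  assume "\<And>i j. i \<in> S \<Longrightarrow> j \<in> T \<Longrightarrow> i \<le> j"
  then have "{(i, j). i \<in> S \<and> j \<in> T \<and> j < i} = {}" by force
  then show ?thesis by (simp only: koszul_sign_def) simp
qed

section \<open>The product of superfunctions: associativity, parity, supercommutativity\<close>

lemma smult_apply:
  "(f \<odot> g) S x = (\<Sum>T\<in>Pow S. koszul_sign T (S - T) * f T x * g (S - T) x)"
  by (simp add: smult_def)

text \<open>A sum over the infinite set \<open>Pow S\<close> defaults to 0. Infinite index sets
  carry no mathematical content, but they are the reason for the case distinctions on
  \<open>finite S\<close> below.\<close>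

lemma smult_infinite: "infinite S \<Longrightarrow> (f \<odot> g) S = 0"
  by (rule ext) (simp add: smult_apply)

text \<open>Both sides sum over ordered splittings of \<open>S\<close> into three parts, recorded
  once as a chain \<open>R \<subseteq> T\<close> and once as the first two parts \<open>R\<close>
  and \<open>Q = T - R\<close>. The signs agree because the Koszul sign is multiplicative in
  disjoint unions.\<close>

lemma smult_assoc: "(f \<odot> g) \<odot> h = f \<odot> (g \<odot> h)"
proof (intro ext)
  fix S x
  show "((f \<odot> g) \<odot> h) S x = (f \<odot> (g \<odot> h)) S x"
  proof (cases "finite S")
    case True
    have fin: "finite R" if "R \<subseteq> S" for R using that True finite_subset by auto
    define A where "A T R = koszul_sign R (T - R) * koszul_sign T (S - T) * f R x * g (T - R) x * h (S - T) x" for T R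
    define B where "B R Q = koszul_sign R (S - R) * koszul_sign Q (S - R - Q) * f R x * g Q x * h (S - R - Q) x" for R Q
    have "((f \<odot> g) \<odot> h) S x = (\<Sum>T\<in>Pow S. \<Sum>R\<in>Pow T. A T R)"
      by (simp add: smult_apply A_def sum_distrib_left sum_distrib_right mult_ac)
    also have "\<dots> = (\<Sum>(T, R)\<in>Sigma (Pow S) Pow. A T R)"
      by (rule sum.Sigma) (auto simp: True fin)
    also have "\<dots> = (\<Sum>(R, Q)\<in>Sigma (Pow S) (\<lambda>R. Pow (S - R)). B R Q)"
    proof (rule sum.reindex_bij_witness[where i = "\<lambda>(R, Q). (R \<union> Q, R)" and j = "\<lambda>(T, R). (R, T - R)"])
      fix p assume "p \<in> Sigma (Pow S) Pow"
      then obtain T R where p: "p = (T, R)" "T \<subseteq> S" "R \<subseteq> T" by auto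
      have "koszul_sign T (S - T) = koszul_sign R (S - T) * koszul_sign (T - R) (S - T)"
        using koszul_sign_union_left[of R "T - R" "S - T"] p fin by (simp add: Un_absorb1 finite_subset fin)
      moreover have "koszul_sign R (S - R) = koszul_sign R (T - R) * koszul_sign R (S - T)"
      proof -
        have "S - R = (T - R) \<union> (S - T)" "(T - R) \<inter> (S - T) = {}"
          using p by auto
        then show ?thesis
          using koszul_sign_union_right[of R "T - R" "S - T"] p fin True
          by (simp add: finite_subset[OF p(3)])
      qed
      moreover have "S - R - (T - R) = S - T" using p by auto
      ultimately show "(case (case p of (T, R) \<Rightarrow> (R, T - R)) of (R, Q) \<Rightarrow> B R Q) = (case p of (T, R) \<Rightarrow> A T R)"
        by (simp add: p A_def B_def)
    qed auto
    also have "\<dots> = (\<Sum>R\<in>Pow S. \<Sum>Q\<in>Pow (S - R). B R Q)"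
      by (rule sum.Sigma[symmetric]) (auto simp: True fin)
    also have "\<dots> = (f \<odot> (g \<odot> h)) S x"
      by (simp add: smult_apply B_def sum_distrib_left mult_ac)
    finally show ?thesis .
  qed (simp add: smult_infinite)
qed

text \<open>Scalar multiplication without the convolution: on superfunctions it agrees with
  \<open>sconst c \<odot> f\<close> (\<open>sconst_smult\<close>), while for arbitrary
  \<open>f\<close> that product is 0 on infinite index sets.\<close>

definition scl :: "complex \<Rightarrow> sfun \<Rightarrow> sfun" where
  "scl c f = (\<lambda>S x. c * f S x)"

text \<open>The \<open>n\<close>-th power of the parity involution, that is, the sign of moving
  something of parity \<open>n\<close> past \<open>f\<close>, also when \<open>f\<close> is not
  homogeneous. Taking \<open>n = par i\<close> treats even and odd cases uniformly.\<close>

definition tau :: "nat \<Rightarrow> sfun \<Rightarrow> sfun" where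
  "tau n f = (\<lambda>S x. (-1) ^ (n * card S) * f S x)"

definition homog :: "nat \<Rightarrow> sfun \<Rightarrow> bool" where
  "homog p f \<longleftrightarrow> (\<forall>S. odd (card S + p) \<longrightarrow> f S = 0)"

lemma scl_apply: "scl c f S x = c * f S x"
  by (simp add: scl_def)

lemma tau_apply: "tau n f S x = (-1) ^ (n * card S) * f S x"
  by (simp add: tau_def)

lemma scl_simps [simp]:
  "scl 0 f = 0" "scl 1 f = f" "scl c 0 = 0" "scl c (scl d f) = scl (c * d) f"
  "scl (- c) f = - scl c f" "scl c (- f) = - scl c f"
  by (auto simp: scl_def fun_eq_iff)

lemma scl_add_right: "scl c (f + g) = scl c f + scl c g"
  and scl_diff_right: "scl c (f - g) = scl c f - scl c g"
  and scl_add_left: "scl (c + d) f = scl c f + scl d f"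
  and scl_diff_left: "scl (c - d) f = scl c f - scl d f"
  by (auto simp: scl_def fun_eq_iff algebra_simps)

lemma scl_sum_right: "scl c (sum f A) = (\<Sum>a\<in>A. scl c (f a))"
  by (auto simp: scl_def fun_eq_iff sum_apply sum_distrib_left)

lemma scl_sum_left: "scl (sum c A) f = (\<Sum>a\<in>A. scl (c a) f)"
  by (auto simp: scl_def fun_eq_iff sum_apply sum_distrib_right)

lemma tau_add: "tau n (f + g) = tau n f + tau n g"
  and tau_diff: "tau n (f - g) = tau n f - tau n g"
  and tau_uminus [simp]: "tau n (- f) = - tau n f"
  and tau_scl [simp]: "tau n (scl c f) = scl c (tau n f)"
  and tau_zero [simp]: "tau n 0 = 0" "tau 0 f = f"
  by (auto simp: tau_def scl_def fun_eq_iff algebra_simps)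

lemma tau_sum: "tau n (sum f A) = (\<Sum>a\<in>A. tau n (f a))"
  by (auto simp: tau_def fun_eq_iff sum_apply sum_distrib_left)

lemma tau_tau: "tau m (tau n f) = tau (m + n) f"
  by (auto simp: tau_def fun_eq_iff algebra_simps power_add)

lemma tau_cong: "even (m + n) \<Longrightarrow> tau m f = tau n f"
  by (auto simp: tau_def fun_eq_iff minus_one_power_iff)

lemma tau_inj: "tau n f = tau n g \<longleftrightarrow> f = g"
  by (auto simp: tau_def fun_eq_iff)

lemma tau_smult: "tau n (f \<odot> g) = tau n f \<odot> tau n g"
proof (intro ext)
  fix S x
  have "(-1) ^ (n * card S) = (-1 :: complex) ^ (n * card T) * (-1) ^ (n * card (S - T))"
    if "T \<in> Pow S" "finite S" for T S :: "nat set"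
    using that card_Un_disjoint[of T "S - T"]
    by (simp add: Un_absorb1 finite_subset distrib_left flip: power_add)
  then show "tau n (f \<odot> g) S x = (tau n f \<odot> tau n g) S x"
    by (cases "finite S") (auto simp: tau_apply smult_infinite smult_apply sum_distrib_left intro!: sum.cong)
qed

lemma tau_homog:
  assumes "homog p f"
  shows "tau n f = scl ((-1) ^ (n * p)) f"
proof (intro ext)
  fix S x
  show "tau n f S x = scl ((-1) ^ (n * p)) f S x"
    using assms by (cases "odd (card S + p)") (auto simp: homog_def tau_apply scl_apply minus_one_power_iff)
qed

lemma smult_add_left: "(f + g) \<odot> h = f \<odot> h + g \<odot> h"
  and smult_add_right: "h \<odot> (f + g) = h \<odot> f + h \<odot> g"
  and smult_diff_left: "(f - g) \<odot> h = f \<odot> h - g \<odot> h"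
  and smult_diff_right: "h \<odot> (f - g) = h \<odot> f - h \<odot> g"
  by (auto simp: smult_def fun_eq_iff algebra_simps sum.distrib sum_subtractf)

lemma smult_uminus [simp]: "(- f) \<odot> h = - (f \<odot> h)" "f \<odot> (- h) = - (f \<odot> h)"
  by (auto simp: smult_def fun_eq_iff sum_negf)

lemma smult_zero [simp]: "0 \<odot> h = 0" "h \<odot> 0 = 0"
  by (auto simp: smult_def fun_eq_iff)

lemma smult_scl [simp]: "scl c f \<odot> h = scl c (f \<odot> h)" "f \<odot> scl c h = scl c (f \<odot> h)"
  by (auto simp: smult_def scl_def fun_eq_iff sum_distrib_left mult_ac)

lemma smult_sum_left: "sum f A \<odot> h = (\<Sum>a\<in>A. f a \<odot> h)"
  by (induct A rule: infinite_finite_induct)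
    (simp_all only: sum.infinite sum.empty sum.insert smult_zero smult_add_left not_False_eq_True)

lemma smult_sum_right: "h \<odot> sum f A = (\<Sum>a\<in>A. h \<odot> f a)"
  by (induct A rule: infinite_finite_induct)
    (simp_all only: sum.infinite sum.empty sum.insert smult_zero smult_add_right not_False_eq_True)

text \<open>Supercommutativity with only one factor homogeneous: the sign depending on the other
  factor is carried by \<open>tau\<close>. Complementation in \<open>S\<close> exchanges the
  factors, and \<open>koszul_sign_swap\<close> compares the signs.\<close>

lemma smult_homog_commute:
  assumes "homog p f"
  shows "f \<odot> g = tau p g \<odot> f"
proof (intro ext)
  fix S x
  show "(f \<odot> g) S x = (tau p g \<odot> f) S x"
  proof (cases "finite S")
    case True
    have "(f \<odot> g) S x = (\<Sum>T\<in>Pow S. koszul_sign (S - T) T * f (S - T) x * g T x)"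
      unfolding smult_apply
      by (rule sum.reindex_bij_witness[where i = "\<lambda>T. S - T" and j = "\<lambda>T. S - T"])
        (auto simp: double_diff)
    also have "\<dots> = (\<Sum>T\<in>Pow S. koszul_sign T (S - T) * tau p g T x * f (S - T) x)"
    proof (rule sum.cong)
      fix T assume T: "T \<in> Pow S"
      have "koszul_sign (S - T) T = (-1) ^ (card (S - T) * card T) * koszul_sign T (S - T)"
        using T True by (intro koszul_sign_swap) (auto intro: finite_subset)
      moreover have "(-1) ^ (card (S - T) * card T) = (-1 :: complex) ^ (p * card T) \<or> f (S - T) = 0"
        using assms by (cases "odd (card (S - T) + p)") (auto simp: homog_def minus_one_power_iff)
      ultimately show "koszul_sign (S - T) T * f (S - T) x * g T x =
          koszul_sign T (S - T) * tau p g T x * f (S - T) x"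
        by (auto simp: tau_apply)
    qed simp
    finally show ?thesis by (simp add: smult_apply)
  qed (simp add: smult_infinite)
qed

section \<open>The graded Leibniz rule for odd derivatives\<close>

lemma odd_partial_koszul:
  "odd_partial n f S x = (if n \<in> S then 0 else koszul_sign {n} S * f (insert n S) x)"
  by (simp add: odd_partial_def koszul_sign_singleton)

text \<open>For \<open>n \<notin> S\<close> the subsets of \<open>insert n S\<close> split according
  to whether they contain \<open>n\<close>, which gives the two terms. For \<open>n \<in> S\<close>
  the left side is 0, and the two terms on the right cancel summand by summand over the subsets of
  \<open>S - {n}\<close>, owing to the sign in \<open>tau 1\<close>.\<close>

lemma odd_partial_smult:
  "odd_partial n (f \<odot> g) = odd_partial n f \<odot> g + tau 1 f \<odot> odd_partial n g"
proof (intro ext)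
  fix S x
  show "odd_partial n (f \<odot> g) S x = (odd_partial n f \<odot> g + tau 1 f \<odot> odd_partial n g) S x"
  proof (cases "finite S \<and> n \<notin> S")
    case True
    then have fin: "finite T" if "T \<subseteq> S" for T using that finite_subset by auto
    let ?k = "koszul_sign {n} S"
    have dis: "Pow S \<inter> insert n ` Pow S = {}" and inj: "inj_on (insert n) (Pow S)"
      using True by (auto simp: inj_on_def)
    have "odd_partial n (f \<odot> g) S x = ?k *
        ((\<Sum>T\<in>Pow S. koszul_sign T (insert n S - T) * f T x * g (insert n S - T) x)
        + (\<Sum>T\<in>Pow S. koszul_sign (insert n T) (insert n S - insert n T) * f (insert n T) x * g (insert n S - insert n T) x))"
      using True by (simp add: odd_partial_koszul smult_apply Pow_insert sum.union_disjoint dis sum.reindex[OF inj])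
    also have "\<dots> = (\<Sum>T\<in>Pow S. koszul_sign T (S - T) * (-1) ^ card T * f T x * odd_partial n g (S - T) x)
        + (\<Sum>T\<in>Pow S. koszul_sign T (S - T) * odd_partial n f T x * g (S - T) x)"
      unfolding distrib_left sum_distrib_left
    proof (rule arg_cong2[where f = "(+)"]; rule sum.cong)
      fix T assume T: "T \<in> Pow S"
      then have n: "n \<notin> T" and ST: "insert n S - T = {n} \<union> (S - T)" "insert n S - insert n T = S - T"
        and iT: "insert n T = {n} \<union> T"
        using True by auto
      have k: "?k = koszul_sign {n} T * koszul_sign {n} (S - T)"
        using koszul_sign_union_right[of "{n}" T "S - T"] T True fin by (simp add: Un_absorb1)
      have k1: "koszul_sign T (insert n S - T) = (-1) ^ card T * koszul_sign {n} T * koszul_sign T (S - T)"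
        using True n T fin koszul_sign_swap[of T "{n}"]
        unfolding ST by (subst koszul_sign_union_right) auto
      have k2: "koszul_sign (insert n T) (insert n S - insert n T) = koszul_sign {n} (S - T) * koszul_sign T (S - T)"
        using True n T fin unfolding ST iT by (subst koszul_sign_union_left) auto
      show "?k * (koszul_sign T (insert n S - T) * f T x * g (insert n S - T) x) =
          koszul_sign T (S - T) * (-1) ^ card T * f T x * odd_partial n g (S - T) x"
        using True unfolding k1 unfolding k ST by (simp add: odd_partial_koszul mult_ac)
      show "?k * (koszul_sign (insert n T) (insert n S - insert n T) * f (insert n T) x * g (insert n S - insert n T) x) =
          koszul_sign T (S - T) * odd_partial n f T x * g (S - T) x"
        using n unfolding k2 unfolding k ST by (simp add: odd_partial_koszul mult_ac)
    qed simp_all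
    finally show ?thesis
      by (simp add: smult_apply tau_apply mult_ac)
  next
    case False
    show ?thesis
    proof (cases "finite S")
      case True
      define R where "R = S - {n}"
      with True False have S: "S = insert n R" "n \<notin> R" "finite R" by auto
      then have fin: "finite T" if "T \<subseteq> R" for T using that finite_subset by auto
      have dis: "Pow R \<inter> insert n ` Pow R = {}" and inj: "inj_on (insert n) (Pow R)"
        using S by (auto simp: inj_on_def)
      have split: "(f' \<odot> g') S x =
        (\<Sum>T\<in>Pow R. koszul_sign T (insert n R - T) * f' T x * g' (insert n R - T) x)
        + (\<Sum>T\<in>Pow R. koszul_sign (insert n T) (insert n R - insert n T) * f' (insert n T) x * g' (insert n R - insert n T) x)" for f' g'
        using S by (simp add: smult_apply Pow_insert sum.union_disjoint dis sum.reindex[OF inj])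
      have "(odd_partial n f \<odot> g) S x + (tau 1 f \<odot> odd_partial n g) S x =
        (\<Sum>T\<in>Pow R. koszul_sign T (insert n R - T) * odd_partial n f T x * g (insert n R - T) x)
        + (\<Sum>T\<in>Pow R. koszul_sign (insert n T) (insert n R - insert n T) * tau 1 f (insert n T) x * odd_partial n g (insert n R - insert n T) x)"
      proof -
        have "odd_partial n f (insert n T) = 0" for T
          by (simp add: odd_partial_koszul fun_eq_iff)
        moreover have "odd_partial n g (insert n R - T) = 0" if "T \<in> Pow R" for T
          using that S by (auto simp: odd_partial_koszul fun_eq_iff)
        ultimately show ?thesis
          unfolding split by simp
      qed
      also have "\<dots> = 0"
        unfolding sum.distrib[symmetric]
      proof (rule sum.neutral, intro ballI)
        fix T assume T: "T \<in> Pow R"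
        then have n: "n \<notin> T" and RT: "insert n R - T = {n} \<union> (R - T)" "insert n R - insert n T = R - T"
          and iT: "insert n T = {n} \<union> T"
          using S by auto
        have k1: "koszul_sign T (insert n R - T) = (-1) ^ card T * koszul_sign {n} T * koszul_sign T (R - T)"
          using S n T fin koszul_sign_swap[of T "{n}"]
          unfolding RT by (subst koszul_sign_union_right) auto
        have k2: "koszul_sign (insert n T) (insert n R - insert n T) = koszul_sign {n} (R - T) * koszul_sign T (R - T)"
          using S n T fin unfolding RT iT by (subst koszul_sign_union_left) auto
        show "koszul_sign T (insert n R - T) * odd_partial n f T x * g (insert n R - T) x +
          koszul_sign (insert n T) (insert n R - insert n T) * tau 1 f (insert n T) x * odd_partial n g (insert n R - insert n T) x = 0"
          using S n T fin unfolding k1 k2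
          by (simp add: RT odd_partial_koszul tau_apply mult_ac)
      qed
      finally show ?thesis
        using S by (simp add: odd_partial_koszul)
    qed (simp add: odd_partial_koszul smult_infinite)
  qed
qed

section \<open>Closure properties of the algebras of superfunctions\<close>

lemma superfunctionsD:
  assumes "f \<in> superfunctions q"
  shows "holomorphic3 (f S)" "\<not> S \<subseteq> {..<q} \<Longrightarrow> f S = 0" "infinite S \<Longrightarrow> f S = 0"
proof -
  show "holomorphic3 (f S)" and *: "\<not> S \<subseteq> {..<q} \<Longrightarrow> f S = 0" for S
    using assms by (auto simp: superfunctions_def)
  show "infinite S \<Longrightarrow> f S = 0"
    by (rule *) (use finite_subset in blast)
qed

lemma superfunctionsI:
  "(\<And>S. holomorphic3 (f S)) \<Longrightarrow> (\<And>S. \<not> S \<subseteq> {..<q} \<Longrightarrow> f S = 0) \<Longrightarrow> f \<in> superfunctions q"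
  by (auto simp: superfunctions_def)

lemma superfunctions_mono: "f \<in> superfunctions q \<Longrightarrow> q \<le> r \<Longrightarrow> f \<in> superfunctions r"
  by (rule superfunctionsI, erule superfunctionsD, erule superfunctionsD)
    (metis lessThan_subset_iff order_trans)

lemma superfunctions_zero [simp]: "0 \<in> superfunctions q"
  by (rule superfunctionsI) auto

lemma superfunctions_scl [simp]:
  assumes "f \<in> superfunctions q" shows "scl c f \<in> superfunctions q"
  using superfunctionsD[OF assms]
  by (intro superfunctionsI) (auto simp: scl_def zero_fun_def intro: holomorphic3_cmult)

lemma superfunctions_uminus [simp]: "f \<in> superfunctions q \<Longrightarrow> - f \<in> superfunctions q"
  using superfunctions_scl[of f q "-1"] by simp

lemma superfunctions_add [simp]:
  assumes "f \<in> superfunctions q" "g \<in> superfunctions q"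
  shows "f + g \<in> superfunctions q"
  using assms[THEN superfunctionsD(1)] assms[THEN superfunctionsD(2)]
  by (intro superfunctionsI) (auto simp: plus_fun_def intro!: holomorphic3_add)

lemma superfunctions_diff [simp]:
  "f \<in> superfunctions q \<Longrightarrow> g \<in> superfunctions q \<Longrightarrow> f - g \<in> superfunctions q"
  using superfunctions_add[of f q "- g"] by simp

lemma superfunctions_sum [simp]:
  "(\<And>a. a \<in> A \<Longrightarrow> f a \<in> superfunctions q) \<Longrightarrow> sum f A \<in> superfunctions q"
  by (induct A rule: infinite_finite_induct) simp_all

lemma superfunctions_tau [simp]:
  assumes "f \<in> superfunctions q" shows "tau n f \<in> superfunctions q"
  using superfunctionsD[OF assms]
  by (intro superfunctionsI) (auto simp: tau_def zero_fun_def intro: holomorphic3_cmult)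

lemma superfunctions_smult [simp]:
  assumes f: "f \<in> superfunctions q" and g: "g \<in> superfunctions q"
  shows "f \<odot> g \<in> superfunctions q"
proof (rule superfunctionsI)
  show "holomorphic3 ((f \<odot> g) S)" for S
    unfolding smult_def
    by (intro holomorphic3_sum holomorphic3_mult holomorphic3_cmult superfunctionsD(1)[OF f]
        superfunctionsD(1)[OF g])
  fix S assume S: "\<not> S \<subseteq> {..<q}"
  have "f T = 0 \<or> g (S - T) = 0" for T
    using superfunctionsD(2)[OF f, of T] superfunctionsD(2)[OF g, of "S - T"] S by blast
  then have "koszul_sign T (S - T) * f T x * g (S - T) x = 0" for T x
    by (metis mult_zero_left mult_zero_right zero_fun_apply)
  then show "(f \<odot> g) S = 0"
    by (intro ext) (simp only: smult_apply zero_fun_apply sum.neutral_const)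
qed

lemma superfunctions_even_partial [simp]:
  assumes "f \<in> superfunctions q" shows "even_partial i f \<in> superfunctions q"
proof (rule superfunctionsI)
  show "holomorphic3 (even_partial i f S)" for S
    unfolding even_partial_eq_pderiv3 by (intro holomorphic3_pderiv3(1) superfunctionsD(1)[OF assms])
  show "even_partial i f S = 0" if "\<not> S \<subseteq> {..<q}" for S
    using superfunctionsD(2)[OF assms that]
    by (simp add: even_partial_def zero_fun_def)
qed

lemma superfunctions_odd_partial [simp]:
  assumes "f \<in> superfunctions q" shows "odd_partial n f \<in> superfunctions q"
proof (rule superfunctionsI)
  show "holomorphic3 (odd_partial n f S)" for S
    unfolding odd_partial_def
    by (cases "n \<in> S") (auto intro!: holomorphic3_cmult superfunctionsD(1)[OF assms])
  show "odd_partial n f S = 0" if "\<not> S \<subseteq> {..<q}" for S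
    using superfunctionsD(2)[OF assms, of "insert n S"] that
    by (auto simp: odd_partial_def fun_eq_iff)
qed

lemma superfunctions_partial [simp]: "f \<in> superfunctions q \<Longrightarrow> partial k f \<in> superfunctions q"
  by (cases k) simp_all

lemma superfunctions_sconst [simp]: "sconst c \<in> superfunctions q"
  by (rule superfunctionsI) (auto simp: sconst_def zero_fun_def)

lemma superfunctions_odd_coord [simp]: "n < q \<Longrightarrow> odd_coord n \<in> superfunctions q"
  by (rule superfunctionsI) (auto simp: odd_coord_def zero_fun_def)

lemma superfunctions_even_coord [simp]: "even_coord i \<in> superfunctions q"
proof (rule superfunctionsI)
  show "holomorphic3 (even_coord i S)" for S
    by (cases "S = {}") (simp_all add: even_coord_def)
qed (auto simp: even_coord_def)

lemma superfunctions_coord [simp]: "3 \<le> q \<Longrightarrow> coord k \<in> superfunctions q"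
  by (cases k) simp_all

lemma sconst_smult [simp]: "f \<in> superfunctions q \<Longrightarrow> sconst c \<odot> f = scl c f"
proof (intro ext)
  fix S x assume f: "f \<in> superfunctions q"
  show "(sconst c \<odot> f) S x = scl c f S x"
  proof (cases "finite S")
    case True
    have "(sconst c \<odot> f) S x = (\<Sum>T\<in>Pow S. if T = {} then c * f S x else 0)"
      unfolding smult_apply by (rule sum.cong) (auto simp: sconst_def)
    with True show ?thesis by (simp add: scl_apply)
  qed (simp add: smult_infinite scl_apply superfunctionsD(3)[OF f])
qed

lemma smult_sconst [simp]: "f \<in> superfunctions q \<Longrightarrow> f \<odot> sconst c = scl c f"
proof -
  assume f: "f \<in> superfunctions q"
  have "homog 0 (sconst c)" by (auto simp: homog_def sconst_def)
  from smult_homog_commute[OF this, of f] f show ?thesis by simp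
qed

lemma sconst_0 [simp]: "sconst 0 = 0"
  by (simp add: sconst_def fun_eq_iff)

lemma scl_sconst [simp]: "scl c (sconst d) = sconst (c * d)"
  by (simp add: sconst_def scl_def fun_eq_iff)

lemma tau_sconst [simp]: "tau n (sconst c) = sconst c"
  by (simp add: sconst_def tau_def fun_eq_iff)

section \<open>Rules for the coordinate derivations\<close>

lemma odd_partial_add: "odd_partial n (f + g) = odd_partial n f + odd_partial n g"
  by (simp add: odd_partial_def fun_eq_iff algebra_simps)

lemma odd_partial_scl: "odd_partial n (scl c f) = scl c (odd_partial n f)"
  by (simp add: odd_partial_def scl_def fun_eq_iff algebra_simps)

lemma partial_add:
  assumes "f \<in> superfunctions q" "g \<in> superfunctions q"
  shows "partial k (f + g) = partial k f + partial k g"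
proof -
  have "even_partial i (f + g) = even_partial i f + even_partial i g" for i
    using assms[THEN superfunctionsD(1)]
    by (simp add: fun_eq_iff even_partial_eq_pderiv3) (simp add: plus_fun_def pderiv3_add)
  then show ?thesis
    by (cases k) (simp_all add: odd_partial_add)
qed

lemma partial_scl:
  assumes "f \<in> superfunctions q"
  shows "partial k (scl c f) = scl c (partial k f)"
proof -
  have "even_partial i (scl c f) = scl c (even_partial i f)" for i
    using assms[THEN superfunctionsD(1)]
    by (simp add: fun_eq_iff even_partial_eq_pderiv3 scl_def pderiv3_cmult)
  then show ?thesis
    by (cases k) (simp_all add: odd_partial_scl)
qed

lemma partial_zero [simp]: "partial k 0 = 0"
  using partial_scl[OF superfunctions_zero, of k 0] by simp

lemma partial_sconst [simp]: "partial k (sconst c) = 0"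
  by (cases k) (simp_all add: fun_eq_iff even_partial_eq_pderiv3 odd_partial_def sconst_def)

lemma partial_coord: "partial k (coord m) = sconst (if k = m then 1 else 0)"
proof -
  have "even_partial i (even_coord j) S = sconst (if i = j then 1 else 0) S" for i j S
    by (cases "S = {}") (simp_all add: fun_eq_iff even_partial_eq_pderiv3 even_coord_def sconst_def)
  then have "even_partial i (even_coord j) = sconst (if i = j then 1 else 0)" for i j
    by (rule ext)
  moreover have "odd_partial i (odd_coord j) = sconst (if i = j then 1 else 0)" for i j
    by (auto simp: fun_eq_iff odd_partial_def odd_coord_def sconst_def)
  moreover have "even_partial i (odd_coord j) = 0" "odd_partial j (even_coord i) = 0" for i j
    by (simp_all add: fun_eq_iff even_partial_eq_pderiv3 even_coord_def odd_partial_def odd_coord_def)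
  ultimately show ?thesis
    by (cases k; cases m) simp_all
qed

lemma partial_tau:
  assumes "f \<in> superfunctions q"
  shows "partial k (tau n f) = scl ((-1) ^ (n * par k)) (tau n (partial k f))"
proof -
  have "even_partial i (tau n f) = tau n (even_partial i f)" for i
    using assms[THEN superfunctionsD(1)]
    by (simp add: fun_eq_iff even_partial_eq_pderiv3 tau_def pderiv3_cmult)
  moreover have "odd_partial i (tau n f) = scl ((-1) ^ n) (tau n (odd_partial i f))" for i
    using superfunctionsD(3)[OF assms]
    by (simp add: fun_eq_iff odd_partial_def tau_def scl_def)
      (metis (no_types, lifting) card_insert_disjoint finite_insert mult.assoc mult.left_commute mult_Suc_right mult_zero_right power_add zero_fun_apply)
  ultimately show ?thesis
    by (cases k) simp_all
qed

lemma partial_smult: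
  assumes "f \<in> superfunctions q" "g \<in> superfunctions q"
  shows "partial k (f \<odot> g) = partial k f \<odot> g + tau (par k) f \<odot> partial k g"
proof -
  have "even_partial i (f \<odot> g) = even_partial i f \<odot> g + f \<odot> even_partial i g" for i
  proof (intro ext)
    fix S x
    have [simp]: "holomorphic3 (f T)" "holomorphic3 (g T)" for T
      using assms[THEN superfunctionsD(1)] by auto
    have "even_partial i (f \<odot> g) S x = (\<Sum>T\<in>Pow S.
        koszul_sign T (S - T) * (pderiv3 i (f T) x * g (S - T) x + f T x * pderiv3 i (g (S - T)) x))"
      unfolding even_partial_eq_pderiv3 smult_def mult.assoc
      by (subst pderiv3_sum) (auto intro!: sum.cong holomorphic3_cmult holomorphic3_mult simp: pderiv3_cmult holomorphic3_mult pderiv3_mult)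
    then show "even_partial i (f \<odot> g) S x = (even_partial i f \<odot> g + f \<odot> even_partial i g) S x"
      by (simp add: smult_apply even_partial_eq_pderiv3 distrib_left sum.distrib mult.assoc)
  qed
  then show ?thesis
    by (cases k) (simp_all add: odd_partial_smult)
qed

text \<open>Even partials commute by Cauchy's formula. For two odd ones, inserting the smaller index
  raises by one the count of indices below the larger, while the converse insertion changes nothing;
  hence the sign.\<close>

lemma partial_commute:
  assumes "f \<in> superfunctions q"
  shows "partial k (partial l f) = scl ((-1) ^ (par k * par l)) (partial l (partial k f))"
proof -
  have ee: "even_partial i (even_partial j f) = even_partial j (even_partial i f)" for i j
    using superfunctionsD(1)[OF assms]
    by (intro ext) (simp add: even_partial_eq_pderiv3[abs_def] even_partial_eq_pderiv3 pderiv3_commute)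
  have oe: "odd_partial m (even_partial i f) = even_partial i (odd_partial m f)" for i m
    using superfunctionsD(1)[OF assms]
    by (simp add: fun_eq_iff even_partial_eq_pderiv3 odd_partial_def[abs_def] pderiv3_cmult)
  have lt: "odd_partial m (odd_partial n f) = - odd_partial n (odd_partial m f)" if "m < n" for m n
  proof (intro ext)
    fix S x
    have "{i \<in> insert m S. i < n} = insert m {i \<in> S. i < n}" "{i \<in> insert n S. i < m} = {i \<in> S. i < m}"
      using that by auto
    then show "odd_partial m (odd_partial n f) S x = (- odd_partial n (odd_partial m f)) S x"
      using that superfunctionsD(3)[OF assms]
      by (cases "finite S") (auto simp: odd_partial_def insert_commute)
  qed
  have "odd_partial m (odd_partial m f) = 0" for m
    by (auto simp: fun_eq_iff odd_partial_def)
  then have oo: "odd_partial m (odd_partial n f) = - odd_partial n (odd_partial m f)" for m n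
    using lt[of m n] lt[of n m] by (metis linorder_neqE_nat minus_minus minus_zero)
  show ?thesis
    by (cases k; cases l; simp only: par.simps partial.simps mult_0 mult_0_right power_0
      scl_simps mult_1 power_one_right; rule oe ee oo oe[symmetric])
qed

section \<open>Homogeneous superfunctions\<close>

lemma homog_zero [simp]: "homog p 0"
  by (simp add: homog_def)

lemma homog_sconst [simp]: "even p \<Longrightarrow> homog p (sconst c)"
  by (auto simp: homog_def sconst_def fun_eq_iff)

lemma homog_add: "homog p f \<Longrightarrow> homog p g \<Longrightarrow> homog p (f + g)"
  by (simp add: homog_def)

lemma homog_scl: "homog p f \<Longrightarrow> homog p (scl c f)"
  by (simp add: homog_def scl_def fun_eq_iff)

lemma homog_sum: "(\<And>a. a \<in> A \<Longrightarrow> homog p (f a)) \<Longrightarrow> homog p (sum f A)"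
  by (induct A rule: infinite_finite_induct) (simp_all add: homog_add)

lemma homog_cong: "even (p + q) \<Longrightarrow> homog p f \<longleftrightarrow> homog q f"
  by (simp add: homog_def)

lemma homog_coord: "homog (par k) (coord k)"
  by (cases k) (auto simp: homog_def even_coord_def odd_coord_def fun_eq_iff)

lemma homog_smult:
  assumes "homog p f" "homog q g"
  shows "homog (p + q) (f \<odot> g)"
  unfolding homog_def
proof (intro allI impI)
  fix S :: "nat set" assume odd: "odd (card S + (p + q))"
  show "(f \<odot> g) S = 0"
  proof (cases "finite S")
    case True
    have "f T = 0 \<or> g (S - T) = 0" if "T \<subseteq> S" for T
    proof -
      have "card S = card T + card (S - T)"
        using that True by (metis card_Diff_subset card_mono finite_subset le_add_diff_inverse)
      then have "odd (card T + p) \<or> odd (card (S - T) + q)"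
        using odd by presburger
      then show ?thesis
        using assms by (auto simp: homog_def)
    qed
    then have "koszul_sign T (S - T) * f T x * g (S - T) x = 0" if "T \<subseteq> S" for T x
      using that by (metis mult_zero_left mult_zero_right zero_fun_apply)
    then have "(\<Sum>T\<in>Pow S. koszul_sign T (S - T) * f T x * g (S - T) x) = 0" for x
      by (intro sum.neutral ballI) blast
    then show ?thesis
      by (intro ext) (simp only: smult_apply zero_fun_apply)
  qed (rule smult_infinite)
qed

lemma homog_partial:
  assumes "homog p f" "f \<in> superfunctions q"
  shows "homog (p + par k) (partial k f)"
proof -
  have "homog p (even_partial i f)" for i
    using assms(1) by (simp add: homog_def even_partial_def fun_eq_iff)
  moreover have "homog (p + 1) (odd_partial n f)" for n
  proof -
    have "f (insert n S) = 0" if "odd (card S + (p + 1))" "n \<notin> S" for S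
      using assms(1) superfunctionsD(3)[OF assms(2), of "insert n S"] that
      by (cases "finite S") (simp_all add: homog_def)
    then show ?thesis
      by (auto simp: homog_def odd_partial_def)
  qed
  ultimately show ?thesis
    by (cases k) simp_all
qed


section \<open>Vector fields in the left-invariant frame\<close>

lemma UNIV_mix: "(UNIV :: mix set) = {E1, E2, E3, E4, E5, E6}"
  using mix.exhaust by blast

lemma minus_one_power_cong: "even (m + n) \<Longrightarrow> (-1 :: complex) ^ m = (-1) ^ n"
  by (auto simp: minus_one_power_iff)

lemma m_const_parity: "m_const s1 i j k \<noteq> 0 \<Longrightarrow> even (par i + par j + par k)"
  by (auto simp: m_const_def split: if_splits)

lemma m_const_swap: "m_const s1 j i k = - ((-1) ^ (par i * par j) * m_const s1 i j k)"
  by (cases i; cases j) (simp_all add: m_const_def)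

lemma scl_half: "scl (c / 2) f + scl (c / 2) f = scl c f"
  by (simp flip: scl_add_left)

lemma superfunctions_left_inv [simp]: "3 \<le> q \<Longrightarrow> left_inv s1 i k \<in> superfunctions q"
  by (simp add: left_inv_def del: sconst_smult)

lemma left_inv_eq:
  "left_inv s1 i k = sconst (if k = i then 1 else 0) + (\<Sum>j\<in>UNIV. scl (m_const s1 j i k / 2) (coord j))"
  by (simp add: left_inv_def sconst_smult[where q = 3])

lemma left_inv_neg1: "k \<in> neg1 \<Longrightarrow> left_inv s1 i k = sconst (if k = i then 1 else 0)"
  by (auto simp: left_inv_eq neg1_def m_const_def)

lemma left_inv_center: "i \<notin> neg1 \<Longrightarrow> left_inv s1 i k = sconst (if k = i then 1 else 0)"
  by (auto simp: left_inv_eq neg1_def m_const_def)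

lemma homog_left_inv: "homog (par i + par k) (left_inv s1 i k)"
  unfolding left_inv_eq
proof (intro homog_add homog_sum)
  show "homog (par i + par k) (sconst (if k = i then 1 else 0))"
    by (cases "k = i") simp_all
  fix j
  show "homog (par i + par k) (scl (m_const s1 j i k / 2) (coord j))"
  proof (cases "m_const s1 j i k = 0")
    case False
    then have "even (par i + par k + par j)"
      using m_const_parity[OF False] by (simp add: ac_simps)
    then show ?thesis
      using homog_cong[of "par i + par k" "par j"] homog_coord homog_scl by blast
  qed simp
qed

section \<open>The left-invariant derivations\<close>

definition Lop :: "complex \<Rightarrow> mix \<Rightarrow> sfun \<Rightarrow> sfun" where
  "Lop s1 i f = vapply (left_inv s1 i) f"

lemma vapply_superfunctions [simp]:
  "(\<And>k. X k \<in> superfunctions q) \<Longrightarrow> f \<in> superfunctions q \<Longrightarrow> vapply X f \<in> superfunctions q"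
  by (simp add: vapply_def)

lemma Lop_superfunctions [simp]: "3 \<le> q \<Longrightarrow> f \<in> superfunctions q \<Longrightarrow> Lop s1 i f \<in> superfunctions q"
  by (simp add: Lop_def)

lemma vapply_add:
  "f \<in> superfunctions q \<Longrightarrow> g \<in> superfunctions q \<Longrightarrow> vapply X (f + g) = vapply X f + vapply X g"
  by (simp add: vapply_def partial_add[where q = q] smult_add_right sum.distrib)

lemma vapply_scl: "f \<in> superfunctions q \<Longrightarrow> vapply X (scl c f) = scl c (vapply X f)"
  by (simp add: vapply_def partial_scl[where q = q] scl_sum_right)

lemma vapply_zero [simp]: "vapply X 0 = 0" "vapply 0 f = 0"
  by (simp_all add: vapply_def)

lemma vapply_sconst [simp]: "vapply X (sconst c) = 0"
  by (simp add: vapply_def)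

lemma vapply_sum:
  "(\<And>a. a \<in> A \<Longrightarrow> f a \<in> superfunctions q) \<Longrightarrow> vapply X (sum f A) = (\<Sum>a\<in>A. vapply X (f a))"
  by (induct A rule: infinite_finite_induct) (simp_all add: vapply_add[where q = q])

lemma Lop_add: "f \<in> superfunctions q \<Longrightarrow> g \<in> superfunctions q \<Longrightarrow> Lop s1 i (f + g) = Lop s1 i f + Lop s1 i g"
  unfolding Lop_def by (rule vapply_add)

lemma Lop_scl: "f \<in> superfunctions q \<Longrightarrow> Lop s1 i (scl c f) = scl c (Lop s1 i f)"
  unfolding Lop_def by (rule vapply_scl)

lemma Lop_uminus: "f \<in> superfunctions q \<Longrightarrow> Lop s1 i (- f) = - Lop s1 i f"
  using Lop_scl[of f q s1 i "-1"] by simp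

lemma Lop_diff: "f \<in> superfunctions q \<Longrightarrow> g \<in> superfunctions q \<Longrightarrow> Lop s1 i (f - g) = Lop s1 i f - Lop s1 i g"
  using Lop_add[of f q "- g" s1 i] by (simp add: Lop_uminus[where q = q])

lemma Lop_zero [simp]: "Lop s1 i 0 = 0" "Lop s1 i (sconst c) = 0"
  by (simp_all add: Lop_def)

lemma Lop_sum:
  "(\<And>a. a \<in> A \<Longrightarrow> f a \<in> superfunctions q) \<Longrightarrow> Lop s1 i (sum f A) = (\<Sum>a\<in>A. Lop s1 i (f a))"
  unfolding Lop_def by (rule vapply_sum)

lemma tau_left_inv: "tau n (left_inv s1 i k) = scl ((-1) ^ (n * (par i + par k))) (left_inv s1 i k)"
  by (rule tau_homog[OF homog_left_inv])

lemma left_inv_commute: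
  "left_inv s1 i k \<odot> f = tau (par i + par k) f \<odot> left_inv s1 i k"
  by (rule smult_homog_commute[OF homog_left_inv])

lemma Lop_tau:
  assumes "f \<in> superfunctions q"
  shows "Lop s1 i (tau n f) = scl ((-1) ^ (n * par i)) (tau n (Lop s1 i f))"
proof -
  have "(-1::complex) ^ (n * (par i + par k)) * (-1) ^ (n * par i) = (-1) ^ (n * par k)" for k
    by (simp flip: power_add) (rule minus_one_power_cong, auto)
  then show ?thesis
    by (simp add: Lop_def vapply_def partial_tau[OF assms] tau_sum tau_smult tau_left_inv scl_sum_right mult.commute)
qed

text \<open>The coefficient of the \<open>k\<close>-th partial in L_i has parity
  \<open>par i + par k\<close>. Moving it past \<open>tau (par k) f\<close> leaves
  \<open>tau (par i) f\<close>, so L_i is a derivation of parity \<open>par i\<close>.\<close>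

lemma Lop_smult:
  assumes "f \<in> superfunctions q" "g \<in> superfunctions q"
  shows "Lop s1 i (f \<odot> g) = Lop s1 i f \<odot> g + tau (par i) f \<odot> Lop s1 i g"
proof -
  have "left_inv s1 i k \<odot> (tau (par k) f \<odot> h) = tau (par i) f \<odot> (left_inv s1 i k \<odot> h)" for k h
  proof -
    have "left_inv s1 i k \<odot> tau (par k) f = tau (par i) f \<odot> left_inv s1 i k"
      unfolding left_inv_commute[of s1 i k "tau (par k) f"] tau_tau
      by (subst tau_cong[of _ "par i"]) auto
    then show ?thesis
      by (simp flip: smult_assoc)
  qed
  then show ?thesis
    by (simp add: Lop_def vapply_def partial_smult[OF assms] smult_add_right sum.distrib
        smult_sum_left smult_sum_right smult_assoc)
qed

lemma Lop_coord: "Lop s1 i (coord m) = left_inv s1 i m"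
proof -
  have "left_inv s1 i k \<odot> partial k (coord m) = (if k = m then left_inv s1 i k else 0)" for k
    by (simp add: partial_coord smult_sconst[where q = 3])
  then show ?thesis
    by (simp add: Lop_def vapply_def)
qed

text \<open>The coefficients of the frame are affine in the coordinates. Of the fields
  \<open>left_inv s1 i m\<close> only the constant part contributes, since the remaining part lies
  along the centre of \<mm>, where the structure constants vanish. The factor 1/2 is that of the
  group law.\<close>

lemma Lop_left_inv: "Lop s1 i (left_inv s1 j k) = sconst (m_const s1 i j k / 2)"
proof -
  have "Lop s1 i (left_inv s1 j k) = (\<Sum>m\<in>UNIV. scl (m_const s1 m j k / 2) (left_inv s1 i m))"
    unfolding left_inv_eq[of s1 j k]
    by (simp add: Lop_add[where q = 3] Lop_sum[where q = 3] Lop_scl[where q = 3] Lop_coord)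
  also have "\<dots> = (\<Sum>m\<in>UNIV. if m = i then sconst (m_const s1 m j k / 2) else 0)"
  proof (rule sum.cong)
    fix m
    show "scl (m_const s1 m j k / 2) (left_inv s1 i m) = (if m = i then sconst (m_const s1 m j k / 2) else 0)"
    proof (cases "m \<in> neg1")
      case True then show ?thesis by (simp add: left_inv_neg1)
    next
      case False
      then have "m_const s1 m j k = 0"
        by (auto simp: m_const_def neg1_def)
      then show ?thesis by auto
    qed
  qed simp
  finally show ?thesis by simp
qed

lemma Lop_center: "i \<notin> neg1 \<Longrightarrow> f \<in> superfunctions q \<Longrightarrow> Lop s1 i f = partial i f"
proof -
  assume i: "i \<notin> neg1" and f: "f \<in> superfunctions q"
  have "left_inv s1 i k \<odot> partial k f = (if k = i then partial k f else 0)" for k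
    using f by (simp add: left_inv_center[OF i] sconst_smult[where q = q])
  then show ?thesis
    by (simp add: Lop_def vapply_def)
qed

text \<open>The second-order terms \<open>A i j\<close> and \<open>A j i\<close> agree up to the
  sign, because coefficients and partials both supercommute. The first-order terms give one half of
  the structure constant for each order. As the bracket is central, L_k may replace the
  \<open>k\<close>-th partial at the end.\<close>

lemma Lop_commutator:
  assumes f: "f \<in> superfunctions q" and q: "3 \<le> q"
  shows "Lop s1 i (Lop s1 j f) - scl ((-1) ^ (par i * par j)) (Lop s1 j (Lop s1 i f))
    = (\<Sum>k\<in>UNIV. scl (m_const s1 i j k) (Lop s1 k f))"
proof -
  define A where "A i j = (\<Sum>k\<in>UNIV. \<Sum>l\<in>UNIV. scl ((-1) ^ (par i * (par j + par k)))
    (left_inv s1 j k \<odot> (left_inv s1 i l \<odot> partial l (partial k f))))" for i j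
  have expand: "Lop s1 i (Lop s1 j f) = (\<Sum>k\<in>UNIV. scl (m_const s1 i j k / 2) (partial k f)) + A i j" for i j
  proof -
    have "Lop s1 i (Lop s1 j f) = (\<Sum>k\<in>UNIV. Lop s1 i (left_inv s1 j k \<odot> partial k f))"
      unfolding Lop_def[of s1 j] vapply_def using f q by (intro Lop_sum[where q = q]) simp
    also have "\<dots> = (\<Sum>k\<in>UNIV. scl (m_const s1 i j k / 2) (partial k f)
        + tau (par i) (left_inv s1 j k) \<odot> Lop s1 i (partial k f))"
      using f q by (intro sum.cong) (simp_all add: Lop_smult[where q = q] Lop_left_inv sconst_smult[where q = q])
    finally show ?thesis
      by (simp add: sum.distrib A_def tau_left_inv Lop_def vapply_def smult_sum_right scl_sum_right)
  qed
  have "scl ((-1) ^ (par i * (par j + par k))) (left_inv s1 j k \<odot> (left_inv s1 i l \<odot> partial l (partial k f)))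
      = scl ((-1) ^ (par i * par j)) (scl ((-1) ^ (par j * (par i + par l)))
        (left_inv s1 i l \<odot> (left_inv s1 j k \<odot> partial k (partial l f))))" for k l
  proof -
    have 1: "left_inv s1 i l \<odot> (left_inv s1 j k \<odot> h)
        = scl ((-1) ^ ((par i + par l) * (par j + par k))) (left_inv s1 j k \<odot> (left_inv s1 i l \<odot> h))" for h
      using left_inv_commute[of s1 i l "left_inv s1 j k"]
      by (simp add: tau_left_inv smult_assoc[symmetric])
    show ?thesis
      unfolding 1 partial_commute[OF f, of k l]
      by (simp flip: power_add) (rule arg_cong[where f = "\<lambda>c. scl c _"], rule minus_one_power_cong, simp add: algebra_simps)
  qed
  then have "A i j = scl ((-1) ^ (par i * par j)) (A j i)"
    unfolding A_def scl_sum_right by (subst (2) sum.swap) simp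
  then have "Lop s1 i (Lop s1 j f) - scl ((-1) ^ (par i * par j)) (Lop s1 j (Lop s1 i f))
    = (\<Sum>k\<in>UNIV. scl (m_const s1 i j k / 2) (partial k f))
      - scl ((-1) ^ (par i * par j)) (\<Sum>k\<in>UNIV. scl (m_const s1 j i k / 2) (partial k f))"
    unfolding expand by (simp add: scl_add_right)
  also have "\<dots> = (\<Sum>k\<in>UNIV. scl (m_const s1 i j k) (partial k f))"
  proof -
    have "scl ((-1) ^ (par i * par j)) (scl (m_const s1 j i k / 2) f) = - scl (m_const s1 i j k / 2) f" for k f
      unfolding m_const_swap[of s1 j i] by (simp add: mult.assoc[symmetric])
    then show ?thesis
      by (simp add: scl_sum_right scl_half sum_negf flip: sum.distrib)
  qed
  also have "\<dots> = (\<Sum>k\<in>UNIV. scl (m_const s1 i j k) (Lop s1 k f))"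
  proof (rule sum.cong)
    fix k
    show "scl (m_const s1 i j k) (partial k f) = scl (m_const s1 i j k) (Lop s1 k f)"
    proof (cases "k \<in> neg1")
      case True
      then have "m_const s1 i j k = 0" by (auto simp: m_const_def neg1_def)
      then show ?thesis by simp
    qed (simp add: Lop_center[OF _ f])
  qed simp
  finally show ?thesis .
qed

lemma homog_Lop:
  assumes "homog p f" "f \<in> superfunctions q"
  shows "homog (p + par i) (Lop s1 i f)"
  unfolding Lop_def vapply_def
proof (rule homog_sum)
  fix k
  have "homog (par i + par k + (p + par k)) (left_inv s1 i k \<odot> partial k f)"
    by (intro homog_smult homog_left_inv homog_partial[OF assms])
  then show "homog (p + par i) (left_inv s1 i k \<odot> partial k f)"
    by (subst homog_cong[where q = "par i + par k + (p + par k)"]) auto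
qed


section \<open>Coefficients with respect to the left-invariant frame\<close>

definition frame :: "complex \<Rightarrow> vfield \<Rightarrow> vfield" where
  "frame s1 \<Phi> = (\<Sum>i\<in>UNIV. \<Phi> i \<cdot>\<^sub>v left_inv s1 i)"

lemma frame_apply: "frame s1 \<Phi> k = (\<Sum>i\<in>UNIV. \<Phi> i \<odot> left_inv s1 i k)"
  by (simp add: frame_def sum_apply fmult_def)

lemma vapply_frame: "vapply (frame s1 \<Phi>) f = (\<Sum>i\<in>UNIV. \<Phi> i \<odot> Lop s1 i f)"
  unfolding vapply_def frame_apply Lop_def smult_sum_left smult_sum_right
  by (subst sum.swap) (simp add: smult_assoc)

lemma vfieldsD: "X \<in> vfields q \<Longrightarrow> X k \<in> superfunctions q"
  by (simp add: vfields_def)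

lemma vfieldsI: "(\<And>k. X k \<in> superfunctions q) \<Longrightarrow> X \<in> vfields q"
  by (simp add: vfields_def)

lemma frame_vfields: "3 \<le> q \<Longrightarrow> \<Phi> \<in> vfields q \<Longrightarrow> frame s1 \<Phi> \<in> vfields q"
  by (simp add: vfields_def frame_apply)

lemma frame_neg1:
  assumes "\<Phi> \<in> vfields q" "k \<in> neg1"
  shows "frame s1 \<Phi> k = \<Phi> k"
proof -
  have "\<Phi> i \<odot> left_inv s1 i k = (if i = k then \<Phi> k else 0)" for i
    using assms by (auto simp: left_inv_neg1 smult_sconst[where q = q] vfieldsD)
  then show ?thesis by (simp add: frame_apply)
qed

lemma frame_center:
  assumes "\<Phi> \<in> vfields q" "k \<notin> neg1"
  shows "frame s1 \<Phi> k = \<Phi> k + (\<Sum>i\<in>neg1. \<Phi> i \<odot> left_inv s1 i k)"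
proof -
  have "\<Phi> i \<odot> left_inv s1 i k = (if i = k then \<Phi> k else 0)" if "i \<notin> neg1" for i
    using assms that by (auto simp: left_inv_center smult_sconst[where q = q] vfieldsD)
  then have "(\<Sum>i\<in>- neg1. \<Phi> i \<odot> left_inv s1 i k) = \<Phi> k"
    using assms(2) by (subst sum.cong[OF refl]) auto
  then show ?thesis
    by (simp add: frame_apply sum.subset_diff[of neg1 UNIV] Compl_eq_Diff_UNIV)
qed

lemma frame_inj:
  assumes "\<Phi> \<in> vfields q" "\<Psi> \<in> vfields q" "frame s1 \<Phi> = frame s1 \<Psi>"
  shows "\<Phi> = \<Psi>"
proof
  fix k
  have neg1: "\<Phi> k = \<Psi> k" if "k \<in> neg1" for k
    using frame_neg1[of _ q k s1] assms that by metis
  show "\<Phi> k = \<Psi> k"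
  proof (cases "k \<in> neg1")
    case False
    with frame_center[OF assms(1) False, of s1] frame_center[OF assms(2) False, of s1] assms(3) neg1
    show ?thesis by simp
  qed (rule neg1)
qed

lemma homog_diff: "homog p f \<Longrightarrow> homog p g \<Longrightarrow> homog p (f - g)"
  by (simp add: homog_def)

text \<open>The change of frame is unipotent: only the coefficients along the centre are corrected,
  by those of degree -1, so its inverse can be written down.\<close>

definition unframe :: "complex \<Rightarrow> vfield \<Rightarrow> vfield" where
  "unframe s1 X k = (if k \<in> neg1 then X k else X k - (\<Sum>i\<in>neg1. X i \<odot> left_inv s1 i k))"

lemma unframe_vfields: "3 \<le> q \<Longrightarrow> X \<in> vfields q \<Longrightarrow> unframe s1 X \<in> vfields q"
  by (simp add: vfields_def unframe_def)

lemma frame_unframe: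
  assumes "3 \<le> q" "X \<in> vfields q" shows "frame s1 (unframe s1 X) = X"
proof
  fix k
  note U = unframe_vfields[OF assms]
  show "frame s1 (unframe s1 X) k = X k"
  proof (cases "k \<in> neg1")
    case True then show ?thesis by (simp add: frame_neg1[OF U] unframe_def)
  next
    case False
    have "(\<Sum>i\<in>neg1. unframe s1 X i \<odot> left_inv s1 i k) = (\<Sum>i\<in>neg1. X i \<odot> left_inv s1 i k)"
      by (intro sum.cong) (auto simp: unframe_def)
    with False show ?thesis by (simp add: frame_center[OF U] unframe_def)
  qed
qed

definition vhomog :: "nat \<Rightarrow> vfield \<Rightarrow> bool" where
  "vhomog p X \<longleftrightarrow> (\<forall>k. homog (p + par k) (X k))"

lemma vhomogD: "vhomog p X \<Longrightarrow> homog (p + par k) (X k)"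
  by (simp add: vhomog_def)

lemma homog_smult_left_inv:
  assumes "homog (p + par i) f" shows "homog (p + par k) (f \<odot> left_inv s1 i k)"
  using homog_smult[OF assms homog_left_inv[of i k s1]]
  by (subst homog_cong[where q = "p + par i + (par i + par k)"]) auto

lemma vhomog_frame: "vhomog p \<Phi> \<Longrightarrow> vhomog p (frame s1 \<Phi>)"
  unfolding vhomog_def frame_apply by (intro allI homog_sum homog_smult_left_inv) blast

lemma vhomog_unframe: "vhomog p X \<Longrightarrow> vhomog p (unframe s1 X)"
  unfolding vhomog_def unframe_def by (auto intro!: homog_diff homog_sum homog_smult_left_inv)

section \<open>Parity components and the bracket of vector fields\<close>

lemma vpart_superfunctions [simp]:
  assumes "X k \<in> superfunctions q" shows "vpart p X k \<in> superfunctions q"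
  using superfunctionsD[OF assms] by (intro superfunctionsI) (auto simp: vpart_def)

lemma vpart_vfields: "X \<in> vfields q \<Longrightarrow> vpart p X \<in> vfields q"
  by (simp add: vfields_def)

lemma vhomog_vpart: "vhomog p (vpart p X)"
  by (auto simp: vhomog_def homog_def vpart_def ac_simps)

lemma vpart_vhomog: "vhomog p X \<Longrightarrow> vpart q X = (if even (p + q) then X else 0)"
  by (auto simp: vhomog_def homog_def vpart_def fun_eq_iff)

lemma vpart_add: "vpart p (X + Y) = vpart p X + vpart p Y"
  by (auto simp: vpart_def fun_eq_iff)

lemma vpart_sum: "vpart 0 X + vpart 1 X = X"
  by (auto simp: vpart_def fun_eq_iff)

lemma vpart_cong: "even (p + q) \<Longrightarrow> vpart p X = vpart q X"
  by (auto simp: vpart_def fun_eq_iff)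

lemma vbracket_vhomog:
  assumes "X \<in> vfields r" "Y \<in> vfields r" "3 \<le> r" "vhomog p X" "vhomog q Y" "p \<in> {0, 1}" "q \<in> {0, 1}"
  shows "vbracket X Y k = vapply X (Y k) - scl ((-1) ^ (p * q)) (vapply Y (X k))"
  using assms(1-3,6,7)
  by (auto simp: vbracket_def vpart_vhomog[OF assms(4)] vpart_vhomog[OF assms(5)] vfieldsD
      sconst_smult[where q = r])

lemma vbracket_vpart_expand:
  assumes "X \<in> vfields r" "Y \<in> vfields r" "3 \<le> r"
  shows "vbracket X Y = (\<Sum>p\<in>{0, 1}. \<Sum>q\<in>{0, 1}. vbracket (vpart p X) (vpart q Y))"
proof
  fix k
  have "vbracket (vpart p X) (vpart q Y) k = vapply (vpart p X) (vpart q Y k) -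
      sconst ((-1) ^ (p * q)) \<odot> vapply (vpart q Y) (vpart p X k)" if "p \<in> {0, 1}" "q \<in> {0, 1}" for p q
    using vbracket_vhomog[OF vpart_vfields[OF assms(1)] vpart_vfields[OF assms(2)] assms(3)
        vhomog_vpart vhomog_vpart that] assms
    by (simp add: sconst_smult[where q = r] vfieldsD)
  then show "vbracket X Y k = (\<Sum>p\<in>{0, 1}. \<Sum>q\<in>{0, 1}. vbracket (vpart p X) (vpart q Y)) k"
    unfolding vbracket_def[of X Y] sum_apply[of _ _ k] by (intro sum.cong refl) simp
qed

text \<open>The term with the structure constants arises in two halves: each field differentiates
  the frame in which the other is expanded (\<open>Lop_left_inv\<close>), and \<open>swap\<close>
  shows that the halves are equal.\<close>

lemma vbracket_frame:
  assumes \<Phi>: "\<Phi> \<in> vfields r" and \<Psi>: "\<Psi> \<in> vfields r" and r: "3 \<le> r"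
    and p: "vhomog p \<Phi>" "p \<in> {0, 1}" and q: "vhomog q \<Psi>" "q \<in> {0, 1}"
  shows "vbracket (frame s1 \<Phi>) (frame s1 \<Psi>) = frame s1 (\<lambda>k.
    (\<Sum>i\<in>UNIV. \<Phi> i \<odot> Lop s1 i (\<Psi> k)) - scl ((-1) ^ (p * q)) (\<Sum>i\<in>UNIV. \<Psi> i \<odot> Lop s1 i (\<Phi> k))
    + (\<Sum>i\<in>UNIV. \<Sum>j\<in>UNIV. scl (m_const s1 i j k) (\<Phi> i \<odot> tau (par i) (\<Psi> j))))"
proof
  fix k
  note S [simp] = vfieldsD[OF \<Phi>] vfieldsD[OF \<Psi>]
  have expand: "vapply (frame s1 \<Phi>) (frame s1 \<Psi> k) =
      (\<Sum>j\<in>UNIV. (\<Sum>i\<in>UNIV. \<Phi> i \<odot> Lop s1 i (\<Psi> j)) \<odot> left_inv s1 j k)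
      + (\<Sum>i\<in>UNIV. \<Sum>j\<in>UNIV. scl (m_const s1 i j k / 2) (\<Phi> i \<odot> tau (par i) (\<Psi> j)))"
    if [simp]: "\<And>i. \<Phi> i \<in> superfunctions r" "\<And>i. \<Psi> i \<in> superfunctions r" for \<Phi> \<Psi>
  proof -
    have "vapply (frame s1 \<Phi>) (frame s1 \<Psi> k) = (\<Sum>i\<in>UNIV. \<Sum>j\<in>UNIV.
        \<Phi> i \<odot> (Lop s1 i (\<Psi> j) \<odot> left_inv s1 j k + tau (par i) (\<Psi> j) \<odot> sconst (m_const s1 i j k / 2)))"
      using r unfolding vapply_frame unfolding frame_apply
      by (simp add: Lop_sum[where q = r] Lop_smult[where q = r] Lop_left_inv smult_sum_right del: smult_sconst)
    also have "\<dots> = (\<Sum>i\<in>UNIV. \<Sum>j\<in>UNIV. (\<Phi> i \<odot> Lop s1 i (\<Psi> j)) \<odot> left_inv s1 j k)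
       + (\<Sum>i\<in>UNIV. \<Sum>j\<in>UNIV. scl (m_const s1 i j k / 2) (\<Phi> i \<odot> tau (par i) (\<Psi> j)))"
      by (simp add: smult_sconst[where q = r] smult_add_right smult_assoc sum.distrib)
    also have "(\<Sum>i\<in>UNIV. \<Sum>j\<in>UNIV. (\<Phi> i \<odot> Lop s1 i (\<Psi> j)) \<odot> left_inv s1 j k)
      = (\<Sum>j\<in>UNIV. (\<Sum>i\<in>UNIV. \<Phi> i \<odot> Lop s1 i (\<Psi> j)) \<odot> left_inv s1 j k)"
      by (subst sum.swap) (simp add: smult_sum_left)
    finally show ?thesis .
  qed
  have swap: "scl ((-1) ^ (p * q)) (scl (m_const s1 j i k / 2) (\<Psi> j \<odot> tau (par j) (\<Phi> i))) =
      - scl (m_const s1 i j k / 2) (\<Phi> i \<odot> tau (par i) (\<Psi> j))" for i j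
  proof -
    have 1: "\<Psi> j \<odot> tau (par j) (\<Phi> i) = scl ((-1) ^ (par j * (p + par i) + (p + par i) * (q + par j))) (\<Phi> i \<odot> \<Psi> j)"
      using smult_homog_commute[OF vhomogD[OF q(1), of j], of "tau (par j) (\<Phi> i)"]
      by (simp add: tau_homog[OF vhomogD[OF p(1)]] mult.commute flip: power_add)
    have 2: "\<Phi> i \<odot> tau (par i) (\<Psi> j) = scl ((-1) ^ (par i * (q + par j))) (\<Phi> i \<odot> \<Psi> j)"
      by (simp add: tau_homog[OF vhomogD[OF q(1)]])
    have "(-1) ^ (p * q) * (m_const s1 j i k / 2 * (-1) ^ (par j * (p + par i) + (p + par i) * (q + par j)))
      = - (m_const s1 i j k / 2 * (-1) ^ (par i * (q + par j)))"
      unfolding m_const_swap[of s1 j i k] by (auto simp: minus_one_power_iff)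
    then show ?thesis
      unfolding 1 2 by simp
  qed
  have "vbracket (frame s1 \<Phi>) (frame s1 \<Psi>) k =
      vapply (frame s1 \<Phi>) (frame s1 \<Psi> k) - scl ((-1) ^ (p * q)) (vapply (frame s1 \<Psi>) (frame s1 \<Phi> k))"
    by (rule vbracket_vhomog[OF frame_vfields[OF r \<Phi>] frame_vfields[OF r \<Psi>] r
          vhomog_frame[OF p(1)] vhomog_frame[OF q(1)] p(2) q(2)])
  also have "\<dots> = (\<Sum>j\<in>UNIV. (\<Sum>i\<in>UNIV. \<Phi> i \<odot> Lop s1 i (\<Psi> j)) \<odot> left_inv s1 j k)
      + (\<Sum>i\<in>UNIV. \<Sum>j\<in>UNIV. scl (m_const s1 i j k / 2) (\<Phi> i \<odot> tau (par i) (\<Psi> j)))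
      - scl ((-1) ^ (p * q)) (\<Sum>j\<in>UNIV. (\<Sum>i\<in>UNIV. \<Psi> i \<odot> Lop s1 i (\<Phi> j)) \<odot> left_inv s1 j k)
      + (\<Sum>i\<in>UNIV. \<Sum>j\<in>UNIV. scl (m_const s1 i j k / 2) (\<Phi> i \<odot> tau (par i) (\<Psi> j)))"
  proof -
    have "scl ((-1) ^ (p * q)) (\<Sum>j\<in>UNIV. \<Sum>i\<in>UNIV. scl (m_const s1 j i k / 2) (\<Psi> j \<odot> tau (par j) (\<Phi> i)))
      = - (\<Sum>i\<in>UNIV. \<Sum>j\<in>UNIV. scl (m_const s1 i j k / 2) (\<Phi> i \<odot> tau (par i) (\<Psi> j)))"
      unfolding scl_sum_right swap by (subst sum.swap) (simp add: sum_negf)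
    then show ?thesis
      by (simp add: expand[of \<Phi> \<Psi>] expand[of \<Psi> \<Phi>] scl_add_right)
  qed
  also have "\<dots> = (\<Sum>j\<in>UNIV. ((\<Sum>i\<in>UNIV. \<Phi> i \<odot> Lop s1 i (\<Psi> j))
        - scl ((-1) ^ (p * q)) (\<Sum>i\<in>UNIV. \<Psi> i \<odot> Lop s1 i (\<Phi> j))) \<odot> left_inv s1 j k)
      + (\<Sum>i\<in>UNIV. \<Sum>j\<in>UNIV. scl (m_const s1 i j k) (\<Phi> i \<odot> tau (par i) (\<Psi> j)))"
  proof -
    have 1: "(\<Sum>i\<in>UNIV. \<Sum>j\<in>UNIV. scl (m_const s1 i j k) (\<Phi> i \<odot> tau (par i) (\<Psi> j)))
      = (\<Sum>i\<in>UNIV. \<Sum>j\<in>UNIV. scl (m_const s1 i j k / 2) (\<Phi> i \<odot> tau (par i) (\<Psi> j)))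
      + (\<Sum>i\<in>UNIV. \<Sum>j\<in>UNIV. scl (m_const s1 i j k / 2) (\<Phi> i \<odot> tau (par i) (\<Psi> j)))"
      by (simp only: scl_half flip: sum.distrib)
    have 2: "scl c (\<Sum>j\<in>UNIV. f j \<odot> left_inv s1 j k) = (\<Sum>j\<in>UNIV. scl c (f j) \<odot> left_inv s1 j k)" for c f
      by (simp add: scl_sum_right)
    show ?thesis
      unfolding 1 2 smult_diff_left sum_subtractf by (simp only: algebra_simps)
  qed
  \<comment> \<open>This term was obtained as a coefficient of the coordinate partial. It lives
    along the centre, where the frame and the partials coincide, so it is also a frame
    coefficient.\<close>
  also have "(\<Sum>i\<in>UNIV. \<Sum>j\<in>UNIV. scl (m_const s1 i j k) (\<Phi> i \<odot> tau (par i) (\<Psi> j)))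
      = (\<Sum>n\<in>UNIV. (\<Sum>i\<in>UNIV. \<Sum>j\<in>UNIV. scl (m_const s1 i j n) (\<Phi> i \<odot> tau (par i) (\<Psi> j))) \<odot> left_inv s1 n k)"
  proof -
    have "(\<Sum>i\<in>UNIV. \<Sum>j\<in>UNIV. scl (m_const s1 i j n) (\<Phi> i \<odot> tau (par i) (\<Psi> j))) \<odot> left_inv s1 n k =
        (if n = k then \<Sum>i\<in>UNIV. \<Sum>j\<in>UNIV. scl (m_const s1 i j k) (\<Phi> i \<odot> tau (par i) (\<Psi> j)) else 0)" for n
    proof (cases "n \<in> neg1")
      case True
      then have "m_const s1 i j n = 0" for i j by (auto simp: m_const_def neg1_def)
      then show ?thesis by auto
    qed (auto simp: left_inv_center smult_sconst[where q = r])
    then show ?thesis by simp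
  qed
  finally show "vbracket (frame s1 \<Phi>) (frame s1 \<Psi>) k = frame s1 (\<lambda>k.
      (\<Sum>i\<in>UNIV. \<Phi> i \<odot> Lop s1 i (\<Psi> k)) - scl ((-1) ^ (p * q)) (\<Sum>i\<in>UNIV. \<Psi> i \<odot> Lop s1 i (\<Phi> k))
      + (\<Sum>i\<in>UNIV. \<Sum>j\<in>UNIV. scl (m_const s1 i j k) (\<Phi> i \<odot> tau (par i) (\<Psi> j)))) k"
    unfolding frame_apply smult_add_left sum.distrib .
qed


section \<open>Structure constants and the Jacobi identity\<close>

lemma UNIV_sl2b: "(UNIV :: sl2b set) = {BX, BH, BY}"
  using sl2b.exhaust by blast

lemma UNIV_vb: "(UNIV :: vb set) = {Vx, Vy}"
  using vb.exhaust by blast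

lemma sum_gix: "(\<Sum>m\<in>UNIV. f (m :: gix)) =
  f (Inl (1, BX)) + (f (Inl (1, BH)) + (f (Inl (1, BY)) + (f (Inl (2, BX)) + (f (Inl (2, BH)) + (f (Inl (2, BY))
  + (f (Inl (3, BX)) + (f (Inl (3, BH)) + (f (Inl (3, BY))
  + (f (Inr (Vx, Vx, Vx)) + (f (Inr (Vx, Vx, Vy)) + (f (Inr (Vx, Vy, Vx)) + (f (Inr (Vx, Vy, Vy))
  + (f (Inr (Vy, Vx, Vx)) + (f (Inr (Vy, Vx, Vy)) + (f (Inr (Vy, Vy, Vx)) + f (Inr (Vy, Vy, Vy)))))))))))))))))"
proof -
  have "(\<Sum>m\<in>UNIV. f m) = (\<Sum>p\<in>UNIV. f (Inl p)) + (\<Sum>p\<in>UNIV. f (Inr p))"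
    unfolding UNIV_Plus_UNIV[symmetric] by (subst sum.Plus) simp_all
  also have "(\<Sum>p\<in>UNIV. f (Inl p)) = (\<Sum>i\<in>UNIV. \<Sum>b\<in>UNIV. f (Inl (i, b)))"
    by (simp add: sum.cartesian_product split_beta)
  also have "(\<Sum>p\<in>UNIV. f (Inr p)) = (\<Sum>u\<in>UNIV. \<Sum>v\<in>UNIV. \<Sum>w\<in>UNIV. f (Inr (u, v, w)))"
    by (simp add: sum.cartesian_product split_beta)
  also have "(\<Sum>i\<in>UNIV. \<Sum>b\<in>UNIV. f (Inl (i, b))) + (\<Sum>u\<in>UNIV. \<Sum>v\<in>UNIV. \<Sum>w\<in>UNIV. f (Inr (u, v, w)))
    = (\<Sum>i\<in>UNIV. f (Inl (i, BX)) + (f (Inl (i, BH)) + f (Inl (i, BY))))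
    + (\<Sum>u\<in>{Vx, Vy}. \<Sum>v\<in>{Vx, Vy}. \<Sum>w\<in>{Vx, Vy}. f (Inr (u, v, w)))"
    by (simp add: UNIV_sl2b UNIV_vb)
  finally show ?thesis
    unfolding sum_3 by (simp add: add.assoc)
qed

lemma gix_cases:
  obtains i b where "m = Inl (i :: 3, b :: sl2b)" | u v w where "m = Inr (u :: vb, v :: vb, w :: vb)"
  by (cases m) auto

fun idx :: "mix \<Rightarrow> gix" where
  "idx E1 = Inl (2, BY)" | "idx E2 = Inl (3, BY)" | "idx E5 = Inl (1, BY)"
| "idx E3 = Inr (Vy, Vx, Vy)" | "idx E4 = Inr (Vy, Vy, Vx)" | "idx E6 = Inr (Vy, Vy, Vy)"

definition gpar :: "gix \<Rightarrow> nat" where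
  "gpar k = (case k of Inl _ \<Rightarrow> 0 | Inr _ \<Rightarrow> 1)"

lemma all_gix: "(\<forall>m::gix. P m) \<longleftrightarrow>
  P (Inl (1, BX)) \<and> P (Inl (1, BH)) \<and> P (Inl (1, BY)) \<and> P (Inl (2, BX)) \<and> P (Inl (2, BH)) \<and> P (Inl (2, BY))
  \<and> P (Inl (3, BX)) \<and> P (Inl (3, BH)) \<and> P (Inl (3, BY))
  \<and> P (Inr (Vx, Vx, Vx)) \<and> P (Inr (Vx, Vx, Vy)) \<and> P (Inr (Vx, Vy, Vx)) \<and> P (Inr (Vx, Vy, Vy))
  \<and> P (Inr (Vy, Vx, Vx)) \<and> P (Inr (Vy, Vx, Vy)) \<and> P (Inr (Vy, Vy, Vx)) \<and> P (Inr (Vy, Vy, Vy))" (is "?l = ?r")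
proof
  assume r: ?r
  show ?l
  proof
    fix m show "P m"
    proof (cases m rule: gix_cases)
      case (1 i b) then show ?thesis using r exhaust_3[of i] by (cases b) auto
    next
      case (2 u v w) then show ?thesis using r by (cases u; cases v; cases w) auto
    qed
  qed
qed blast

text \<open>The matrices of ad e_1, ..., ad e_4 are sparse. Their contractions with an arbitrary
  \<open>G\<close>, over the output index (\<open>row\<close>) and over the input index
  (\<open>col\<close>), are tabulated once, so that the Jacobi identity for all triples
  \<open>k l r\<close> below involves only short sums.\<close>

lemma gamma_const_E1_row: "\<forall>k. (\<Sum>m\<in>UNIV. gamma_const s1 s2 s3 (Inl (2, BY)) k m * G m) =
  (if k = Inl (2, BX) then - G (Inl (2, BH))
    else if k = Inl (2, BH) then 2 * G (Inl (2, BY))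
    else if k = Inr (Vx, Vx, Vx) then G (Inr (Vx, Vy, Vx))
    else if k = Inr (Vx, Vx, Vy) then G (Inr (Vx, Vy, Vy))
    else if k = Inr (Vy, Vx, Vx) then G (Inr (Vy, Vy, Vx))
    else if k = Inr (Vy, Vx, Vy) then G (Inr (Vy, Vy, Vy))
    else 0)"
  unfolding all_gix by (simp add: sum_gix)

lemma gamma_const_E1_col: "\<forall>r. (\<Sum>m\<in>UNIV. gamma_const s1 s2 s3 (Inl (2, BY)) m r * G m) =
  (if r = Inl (2, BH) then - G (Inl (2, BX))
    else if r = Inl (2, BY) then 2 * G (Inl (2, BH))
    else if r = Inr (Vx, Vy, Vx) then G (Inr (Vx, Vx, Vx))
    else if r = Inr (Vx, Vy, Vy) then G (Inr (Vx, Vx, Vy))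
    else if r = Inr (Vy, Vy, Vx) then G (Inr (Vy, Vx, Vx))
    else if r = Inr (Vy, Vy, Vy) then G (Inr (Vy, Vx, Vy))
    else 0)"
  unfolding all_gix by (simp add: sum_gix)

lemma gamma_const_E2_row: "\<forall>k. (\<Sum>m\<in>UNIV. gamma_const s1 s2 s3 (Inl (3, BY)) k m * G m) =
  (if k = Inl (3, BX) then - G (Inl (3, BH))
    else if k = Inl (3, BH) then 2 * G (Inl (3, BY))
    else if k = Inr (Vx, Vx, Vx) then G (Inr (Vx, Vx, Vy))
    else if k = Inr (Vx, Vy, Vx) then G (Inr (Vx, Vy, Vy))
    else if k = Inr (Vy, Vx, Vx) then G (Inr (Vy, Vx, Vy))
    else if k = Inr (Vy, Vy, Vx) then G (Inr (Vy, Vy, Vy))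
    else 0)"
  unfolding all_gix by (simp add: sum_gix)

lemma gamma_const_E2_col: "\<forall>r. (\<Sum>m\<in>UNIV. gamma_const s1 s2 s3 (Inl (3, BY)) m r * G m) =
  (if r = Inl (3, BH) then - G (Inl (3, BX))
    else if r = Inl (3, BY) then 2 * G (Inl (3, BH))
    else if r = Inr (Vx, Vx, Vy) then G (Inr (Vx, Vx, Vx))
    else if r = Inr (Vx, Vy, Vy) then G (Inr (Vx, Vy, Vx))
    else if r = Inr (Vy, Vx, Vy) then G (Inr (Vy, Vx, Vx))
    else if r = Inr (Vy, Vy, Vy) then G (Inr (Vy, Vy, Vx))
    else 0)"
  unfolding all_gix by (simp add: sum_gix)

lemma gamma_const_E3_row: "\<forall>k. (\<Sum>m\<in>UNIV. gamma_const s1 s2 s3 (Inr (Vy, Vx, Vy)) k m * G m) =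
  (if k = Inl (1, BX) then - G (Inr (Vx, Vx, Vy))
    else if k = Inl (1, BH) then G (Inr (Vy, Vx, Vy))
    else if k = Inl (2, BH) then - G (Inr (Vy, Vx, Vy))
    else if k = Inl (2, BY) then - G (Inr (Vy, Vy, Vy))
    else if k = Inl (3, BX) then - G (Inr (Vy, Vx, Vx))
    else if k = Inl (3, BH) then G (Inr (Vy, Vx, Vy))
    else if k = Inr (Vx, Vx, Vx) then s2 * G (Inl (2, BX))
    else if k = Inr (Vx, Vy, Vx) then s1 / 2 * G (Inl (1, BH)) - s2 / 2 * G (Inl (2, BH)) + s3 / 2 * G (Inl (3, BH))
    else if k = Inr (Vx, Vy, Vy) then s3 * G (Inl (3, BY))
    else if k = Inr (Vy, Vy, Vx) then s1 * G (Inl (1, BY))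
    else 0)"
  unfolding all_gix by (simp add: sum_gix)

lemma gamma_const_E3_col: "\<forall>r. (\<Sum>m\<in>UNIV. gamma_const s1 s2 s3 (Inr (Vy, Vx, Vy)) m r * G m) =
  (if r = Inl (1, BH) then s1 / 2 * G (Inr (Vx, Vy, Vx))
    else if r = Inl (1, BY) then s1 * G (Inr (Vy, Vy, Vx))
    else if r = Inl (2, BX) then s2 * G (Inr (Vx, Vx, Vx))
    else if r = Inl (2, BH) then - (s2 / 2 * G (Inr (Vx, Vy, Vx)))
    else if r = Inl (3, BH) then s3 / 2 * G (Inr (Vx, Vy, Vx))
    else if r = Inl (3, BY) then s3 * G (Inr (Vx, Vy, Vy))
    else if r = Inr (Vx, Vx, Vy) then - G (Inl (1, BX))
    else if r = Inr (Vy, Vx, Vy) then G (Inl (1, BH)) - G (Inl (2, BH)) + G (Inl (3, BH))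
    else if r = Inr (Vy, Vy, Vy) then - G (Inl (2, BY))
    else if r = Inr (Vy, Vx, Vx) then - G (Inl (3, BX))
    else 0)"
  unfolding all_gix by (simp add: sum_gix)

lemma gamma_const_E4_row: "\<forall>k. (\<Sum>m\<in>UNIV. gamma_const s1 s2 s3 (Inr (Vy, Vy, Vx)) k m * G m) =
  (if k = Inl (1, BX) then - G (Inr (Vx, Vy, Vx))
    else if k = Inl (1, BH) then G (Inr (Vy, Vy, Vx))
    else if k = Inl (2, BX) then - G (Inr (Vy, Vx, Vx))
    else if k = Inl (2, BH) then G (Inr (Vy, Vy, Vx))
    else if k = Inl (3, BH) then - G (Inr (Vy, Vy, Vx))
    else if k = Inl (3, BY) then - G (Inr (Vy, Vy, Vy))
    else if k = Inr (Vx, Vx, Vx) then s3 * G (Inl (3, BX))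
    else if k = Inr (Vx, Vx, Vy) then s1 / 2 * G (Inl (1, BH)) + s2 / 2 * G (Inl (2, BH)) - s3 / 2 * G (Inl (3, BH))
    else if k = Inr (Vx, Vy, Vy) then s2 * G (Inl (2, BY))
    else if k = Inr (Vy, Vx, Vy) then s1 * G (Inl (1, BY))
    else 0)"
  unfolding all_gix by (simp add: sum_gix)

lemma gamma_const_E4_col: "\<forall>r. (\<Sum>m\<in>UNIV. gamma_const s1 s2 s3 (Inr (Vy, Vy, Vx)) m r * G m) =
  (if r = Inl (1, BH) then s1 / 2 * G (Inr (Vx, Vx, Vy))
    else if r = Inl (1, BY) then s1 * G (Inr (Vy, Vx, Vy))
    else if r = Inl (2, BH) then s2 / 2 * G (Inr (Vx, Vx, Vy))
    else if r = Inl (2, BY) then s2 * G (Inr (Vx, Vy, Vy))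
    else if r = Inl (3, BX) then s3 * G (Inr (Vx, Vx, Vx))
    else if r = Inl (3, BH) then - (s3 / 2 * G (Inr (Vx, Vx, Vy)))
    else if r = Inr (Vx, Vy, Vx) then - G (Inl (1, BX))
    else if r = Inr (Vy, Vy, Vx) then G (Inl (1, BH)) + G (Inl (2, BH)) - G (Inl (3, BH))
    else if r = Inr (Vy, Vx, Vx) then - G (Inl (2, BX))
    else if r = Inr (Vy, Vy, Vy) then - G (Inl (3, BY))
    else 0)"
  unfolding all_gix by (simp add: sum_gix)

text \<open>The flatness equations involve only brackets with e_1, ..., e_4, so the Jacobi identity
  is verified with one of these as an entry. It is used in the form that ad e_i is a derivation of
  the bracket.\<close>

lemma jacobi_E1: "\<forall>k l r. (\<Sum>m\<in>UNIV. gamma_const s1 s2 s3 (Inl (2, BY)) m r * gamma_const s1 s2 s3 k l m)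
    = (\<Sum>m\<in>UNIV. gamma_const s1 s2 s3 (Inl (2, BY)) k m * gamma_const s1 s2 s3 m l r)
    + (\<Sum>m\<in>UNIV. gamma_const s1 s2 s3 (Inl (2, BY)) l m * gamma_const s1 s2 s3 k m r)"
  unfolding gamma_const_E1_row[rule_format] gamma_const_E1_col[rule_format]
  unfolding all_gix by simp

lemma jacobi_E2: "\<forall>k l r. (\<Sum>m\<in>UNIV. gamma_const s1 s2 s3 (Inl (3, BY)) m r * gamma_const s1 s2 s3 k l m)
    = (\<Sum>m\<in>UNIV. gamma_const s1 s2 s3 (Inl (3, BY)) k m * gamma_const s1 s2 s3 m l r)
    + (\<Sum>m\<in>UNIV. gamma_const s1 s2 s3 (Inl (3, BY)) l m * gamma_const s1 s2 s3 k m r)"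
  unfolding gamma_const_E2_row[rule_format] gamma_const_E2_col[rule_format]
  unfolding all_gix by simp

text \<open>For an odd e_i the triples of odd elements occur, and their Jacobi identity is where the
  relation s_1 + s_2 + s_3 = 0 enters.\<close>

lemma jacobi_E3:
  assumes "s1 = - s2 - s3"
  shows "\<forall>k l r. (\<Sum>m\<in>UNIV. gamma_const s1 s2 s3 (Inr (Vy, Vx, Vy)) m r * gamma_const s1 s2 s3 k l m)
    = (\<Sum>m\<in>UNIV. gamma_const s1 s2 s3 (Inr (Vy, Vx, Vy)) k m * gamma_const s1 s2 s3 m l r)
    + (-1) ^ gpar k * (\<Sum>m\<in>UNIV. gamma_const s1 s2 s3 (Inr (Vy, Vx, Vy)) l m * gamma_const s1 s2 s3 k m r)"
  unfolding gamma_const_E3_row[rule_format] gamma_const_E3_col[rule_format]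
  unfolding all_gix by (simp add: gpar_def assms field_simps)

lemma jacobi_E4:
  assumes "s1 = - s2 - s3"
  shows "\<forall>k l r. (\<Sum>m\<in>UNIV. gamma_const s1 s2 s3 (Inr (Vy, Vy, Vx)) m r * gamma_const s1 s2 s3 k l m)
    = (\<Sum>m\<in>UNIV. gamma_const s1 s2 s3 (Inr (Vy, Vy, Vx)) k m * gamma_const s1 s2 s3 m l r)
    + (-1) ^ gpar k * (\<Sum>m\<in>UNIV. gamma_const s1 s2 s3 (Inr (Vy, Vy, Vx)) l m * gamma_const s1 s2 s3 k m r)"
  unfolding gamma_const_E4_row[rule_format] gamma_const_E4_col[rule_format]
  unfolding all_gix by (simp add: gpar_def assms field_simps)


section \<open>Flat sections\<close>

text \<open>The sign \<open>tau (par i)\<close> is due to moving \<open>e\<^sub>i\<close> past the coefficients of \<open>\<Phi> = \<Sum>\<^sub>k \<Phi>\<^sup>k g\<^sub>k\<close>.\<close>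

definition flat :: "complex \<Rightarrow> (gix \<Rightarrow> sfun) \<Rightarrow> bool" where
  "flat a \<Phi> \<longleftrightarrow> (\<forall>l. \<Phi> l \<in> superfunctions 3) \<and>
     (\<forall>i\<in>neg1. \<forall>l. Lop (- 1 - a) i (\<Phi> l)
        = - (\<Sum>k\<in>UNIV. scl (gamma_const (- 1 - a) 1 a (idx i) k l) (tau (par i) (\<Phi> k))))"

lemma flat_superfunctions: "flat a \<Phi> \<Longrightarrow> \<Phi> l \<in> superfunctions 3"
  by (simp add: flat_def)

lemma flat_Lop:
  "flat a \<Phi> \<Longrightarrow> i \<in> neg1 \<Longrightarrow> Lop (- 1 - a) i (\<Phi> l)
    = - (\<Sum>k\<in>UNIV. scl (gamma_const (- 1 - a) 1 a (idx i) k l) (tau (par i) (\<Phi> k)))"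
  by (simp add: flat_def)

lemma neg1_simps [simp]: "E1 \<in> neg1" "E2 \<in> neg1" "E3 \<in> neg1" "E4 \<in> neg1" "E5 \<notin> neg1" "E6 \<notin> neg1"
  by (simp_all add: neg1_def)

lemma sigma_sigma [simp]: "tau (Suc 0) (tau (Suc 0) f) = f"
  by (simp add: tau_def fun_eq_iff power2_eq_square flip: mult.assoc power_mult_distrib)

lemma Lop_relations:
  assumes "f \<in> superfunctions q" "3 \<le> q"
  shows "Lop s1 E1 (Lop s1 E2 f) = Lop s1 E2 (Lop s1 E1 f)"
    and "Lop s1 E1 (Lop s1 E4 f) = Lop s1 E4 (Lop s1 E1 f)"
    and "Lop s1 E2 (Lop s1 E3 f) = Lop s1 E3 (Lop s1 E2 f)"
    and "Lop s1 E1 (Lop s1 E3 f) = Lop s1 E3 (Lop s1 E1 f) + Lop s1 E6 f"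
    and "Lop s1 E2 (Lop s1 E4 f) = Lop s1 E4 (Lop s1 E2 f) + Lop s1 E6 f"
    and "Lop s1 E3 (Lop s1 E3 f) = 0"
    and "Lop s1 E4 (Lop s1 E4 f) = 0"
    and "Lop s1 E3 (Lop s1 E4 f) = - Lop s1 E4 (Lop s1 E3 f) + scl s1 (Lop s1 E5 f)"
proof -
  note c = Lop_commutator[OF assms, of s1]
  show "Lop s1 E1 (Lop s1 E2 f) = Lop s1 E2 (Lop s1 E1 f)"
    using c[of E1 E2] by (simp add: m_const_def UNIV_mix)
  show "Lop s1 E1 (Lop s1 E4 f) = Lop s1 E4 (Lop s1 E1 f)"
    using c[of E1 E4] by (simp add: m_const_def UNIV_mix)
  show "Lop s1 E2 (Lop s1 E3 f) = Lop s1 E3 (Lop s1 E2 f)"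
    using c[of E2 E3] by (simp add: m_const_def UNIV_mix)
  show "Lop s1 E1 (Lop s1 E3 f) = Lop s1 E3 (Lop s1 E1 f) + Lop s1 E6 f"
    using c[of E1 E3] by (simp add: m_const_def UNIV_mix diff_eq_eq add.commute)
  show "Lop s1 E2 (Lop s1 E4 f) = Lop s1 E4 (Lop s1 E2 f) + Lop s1 E6 f"
    using c[of E2 E4] by (simp add: m_const_def UNIV_mix diff_eq_eq add.commute)
  show "Lop s1 E3 (Lop s1 E4 f) = - Lop s1 E4 (Lop s1 E3 f) + scl s1 (Lop s1 E5 f)"
    using c[of E3 E4] by (simp add: m_const_def UNIV_mix eq_neg_iff_add_eq_0 add.commute algebra_simps)
  have "Lop s1 E3 (Lop s1 E3 f) + Lop s1 E3 (Lop s1 E3 f) = 0"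
    using c[of E3 E3] by (simp add: m_const_def UNIV_mix)
  then show "Lop s1 E3 (Lop s1 E3 f) = 0"
    by (simp add: fun_eq_iff)
  have "Lop s1 E4 (Lop s1 E4 f) + Lop s1 E4 (Lop s1 E4 f) = 0"
    using c[of E4 E4] by (simp add: m_const_def UNIV_mix)
  then show "Lop s1 E4 (Lop s1 E4 f) = 0"
    by (simp add: fun_eq_iff)
qed

lemma scl_eq_0_iff: "scl c f = 0 \<longleftrightarrow> c = 0 \<or> f = 0"
  by (auto simp: scl_def fun_eq_iff)

lemma tau_eq_0_iff [simp]: "tau n f = 0 \<longleftrightarrow> f = 0"
  using tau_inj[of n f 0] by simp

text \<open>The distribution is bracket-generating: L_6 = [L_1, L_3] and s_1 L_5 = [L_3, L_4] also
  annihilate \<open>f\<close>. Hence all partial derivatives of \<open>f\<close> vanish and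
  \<open>f\<close> is the constant given by its value at the origin.\<close>

lemma superfunction_eq_0:
  assumes f: "f \<in> superfunctions 3" and "\<And>i. i \<in> neg1 \<Longrightarrow> Lop s1 i f = 0" and s1: "s1 \<noteq> 0"
    and f0: "f {} 0 = 0"
  shows "f = 0"
proof -
  have L: "Lop s1 E1 f = 0" "Lop s1 E2 f = 0" "Lop s1 E3 f = 0" "Lop s1 E4 f = 0"
    using assms(2) by simp_all
  have "Lop s1 E6 f = 0"
    using Lop_relations(4)[OF f, of s1] by (simp add: L)
  moreover have "Lop s1 E5 f = 0"
    using Lop_relations(8)[OF f, of s1] s1 by (simp add: L scl_eq_0_iff)
  ultimately have p56: "partial k f = 0" if "k \<notin> neg1" for k
    using that Lop_center[OF that f, of s1] by (cases k) simp_all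
  \<comment> \<open>L_k and the \<open>k\<close>-th partial differ only by partials along the
    centre, which vanish by \<open>p56\<close>.\<close>
  have partial0: "partial k f = 0" for k
  proof (cases "k \<in> neg1")
    case True
    have "left_inv s1 k j \<odot> partial j f = (if j = k then partial k f else 0)" for j
      using f by (cases "j \<in> neg1") (auto simp: left_inv_neg1 p56 sconst_smult[where q = 3])
    then have "Lop s1 k f = partial k f"
      by (simp add: Lop_def vapply_def)
    then show ?thesis using assms(2)[OF True] by simp
  qed (rule p56)
  have body: "f {} = 0"
  proof -
    have "pderiv3 i (f {}) x = 0" for i x
    proof -
      have "even_partial i f = 0"
        using partial0[of E1] partial0[of E2] partial0[of E5] exhaust_3[of i] by auto
      then show ?thesis
        by (metis even_partial_eq_pderiv3 zero_fun_apply)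
    qed
    then have "(f {} has_derivative (\<lambda>h. 0)) (at x within UNIV)" for x
      using holomorphic3_has_derivative[OF superfunctionsD(1)[OF f], of "{}" x] by simp
    then obtain c where "f {} x = c" for x
      using has_derivative_zero_constant[OF convex_UNIV, of "f {}"] by auto
    then show ?thesis
      using f0 by (intro ext) simp
  qed
  have "f S = 0" for S
  proof (cases "S = {}")
    case False
    then obtain n where n: "n \<in> S" by auto
    show ?thesis
    proof (cases "S \<subseteq> {..<3}")
      case True
      then have "n = 0 \<or> n = 1 \<or> n = 2" using n by force
      then have "odd_partial n f = 0"
        using partial0[of E3] partial0[of E4] partial0[of E6] by auto
      \<comment> \<open>Up to sign this is the coefficient of \<open>f\<close> at
        \<open>S\<close>.\<close>
      then have "odd_partial n f (S - {n}) = 0" by simp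
      then show ?thesis
        using n by (auto simp: odd_partial_def fun_eq_iff insert_absorb)
    qed (rule superfunctionsD(2)[OF f])
  qed (simp add: body)
  then show ?thesis by (intro ext) simp
qed

text \<open>Since ad e_i lowers the degree by one, the equations for a component of degree d involve
  only components of degree d + 1. So the components vanish one degree after the other, from 2 down
  to -2, each being killed by L_1, ..., L_4 and zero at the origin.\<close>

lemma flat_eq_0:
  assumes flat: "flat a \<Phi>" and a: "a \<noteq> -1" and zero: "\<And>l. \<Phi> l {} 0 = 0"
  shows "\<Phi> = 0"
proof -
  have eq0: "\<Phi> l = 0" if "\<And>i. i \<in> neg1 \<Longrightarrow> Lop (- 1 - a) i (\<Phi> l) = 0" for l
    by (rule superfunction_eq_0[OF flat_superfunctions[OF flat] that _ zero]) (use a in \<open>auto simp: algebra_simps\<close>)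
  note F = flat_Lop[OF flat]
  have [simp]: "\<Phi> (Inl (1, BX)) = 0" "\<Phi> (Inr (Vx, Vx, Vx)) = 0"
    by (rule eq0, auto simp: F neg1_def sum_gix)+
  have [simp]: "\<Phi> (Inl (2, BX)) = 0" "\<Phi> (Inl (3, BX)) = 0" "\<Phi> (Inr (Vx, Vy, Vx)) = 0" "\<Phi> (Inr (Vx, Vx, Vy)) = 0"
    by (rule eq0, auto simp: F neg1_def sum_gix)+
  have [simp]: "\<Phi> (Inl (1, BH)) = 0" "\<Phi> (Inl (2, BH)) = 0" "\<Phi> (Inl (3, BH)) = 0"
      "\<Phi> (Inr (Vy, Vx, Vx)) = 0" "\<Phi> (Inr (Vx, Vy, Vy)) = 0"
    by (rule eq0, auto simp: F neg1_def sum_gix)+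
  have [simp]: "\<Phi> (Inl (2, BY)) = 0" "\<Phi> (Inl (3, BY)) = 0" "\<Phi> (Inr (Vy, Vx, Vy)) = 0" "\<Phi> (Inr (Vy, Vy, Vx)) = 0"
    by (rule eq0, auto simp: F neg1_def sum_gix)+
  have [simp]: "\<Phi> (Inl (1, BY)) = 0" "\<Phi> (Inr (Vy, Vy, Vy)) = 0"
    by (rule eq0, auto simp: F neg1_def sum_gix)+
  have "\<forall>l. \<Phi> l = 0"
    unfolding all_gix by simp
  then show ?thesis by (intro ext) simp
qed


section \<open>Prolongation\<close>

text \<open>\<open>D5\<close> and \<open>D6\<close> are what preservation of \<D> yields,
  \<open>T0\<close> to \<open>Tt\<close> what tangency to the cone yields. Every component of
  nonnegative degree is forced by one flatness equation; the other equations for it follow by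
  applying a relation between the L_i to a derivative already known.\<close>

lemma prolongation:
  assumes F: "\<And>i. F i \<in> superfunctions 3" and a: "a \<noteq> 0" and s1: "s1 = - 1 - a"
    and D5: "Lop s1 E1 (F E5) = 0" "Lop s1 E2 (F E5) = 0"
      "Lop s1 E3 (F E5) = - scl s1 (tau (Suc 0) (F E4))" "Lop s1 E4 (F E5) = - scl s1 (tau (Suc 0) (F E3))"
    and D6: "Lop s1 E1 (F E6) = - F E3" "Lop s1 E2 (F E6) = - F E4"
      "Lop s1 E3 (F E6) = tau (Suc 0) (F E1)" "Lop s1 E4 (F E6) = tau (Suc 0) (F E2)"
    and T0: "Lop s1 E1 (F E2) = 0" "Lop s1 E1 (F E3) = 0" "Lop s1 E2 (F E1) = 0" "Lop s1 E2 (F E4) = 0"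
      "Lop s1 E3 (F E1) = 0" "Lop s1 E3 (F E4) = 0" "Lop s1 E4 (F E2) = 0" "Lop s1 E4 (F E3) = 0"
    and Te: "Lop s1 E1 (F E4) = Lop s1 E2 (F E3)"
    and To: "Lop s1 E3 (F E2) = scl a (Lop s1 E4 (F E1))"
    and Tt: "Lop s1 E1 (F E1) + tau (Suc 0) (Lop s1 E3 (F E3))
      = Lop s1 E2 (F E2) + tau (Suc 0) (Lop s1 E4 (F E4))"
  obtains \<Phi> where "flat a \<Phi>" "\<And>i. \<Phi> (idx i) = F i"
proof -
  define L1 where "L1 = Lop s1 E1"
  define L2 where "L2 = Lop s1 E2"
  define L3 where "L3 = Lop s1 E3"
  define L4 where "L4 = Lop s1 E4"
  define L6 where "L6 = Lop s1 E6"
  define \<sigma> where "\<sigma> = tau (Suc 0)"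
  note F = F[simp]
  have S [simp]: "f \<in> superfunctions 3 \<Longrightarrow> L1 f \<in> superfunctions 3" "f \<in> superfunctions 3 \<Longrightarrow> L2 f \<in> superfunctions 3"
    "f \<in> superfunctions 3 \<Longrightarrow> L3 f \<in> superfunctions 3" "f \<in> superfunctions 3 \<Longrightarrow> L4 f \<in> superfunctions 3"
    "f \<in> superfunctions 3 \<Longrightarrow> \<sigma> f \<in> superfunctions 3" for f
    by (simp_all add: L1_def L2_def L3_def L4_def \<sigma>_def)
  have lin [simp]: "L1 (scl c f) = scl c (L1 f)" "L2 (scl c f) = scl c (L2 f)" "L3 (scl c f) = scl c (L3 f)"
      "L4 (scl c f) = scl c (L4 f)" "L1 (- f) = - L1 f" "L2 (- f) = - L2 f" "L3 (- f) = - L3 f" "L4 (- f) = - L4 f"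
      "L1 (\<sigma> f) = \<sigma> (L1 f)" "L2 (\<sigma> f) = \<sigma> (L2 f)" "L3 (\<sigma> f) = - \<sigma> (L3 f)" "L4 (\<sigma> f) = - \<sigma> (L4 f)"
    if "f \<in> superfunctions 3" for c f
    using that by (simp_all add: L1_def L2_def L3_def L4_def \<sigma>_def Lop_scl[where q = 3] Lop_uminus[where q = 3]
        Lop_tau[where q = 3])
  have add [simp]: "L1 (f + g) = L1 f + L1 g" "L2 (f + g) = L2 f + L2 g" "L3 (f + g) = L3 f + L3 g" "L4 (f + g) = L4 f + L4 g"
     "L1 (f - g) = L1 f - L1 g" "L2 (f - g) = L2 f - L2 g" "L3 (f - g) = L3 f - L3 g" "L4 (f - g) = L4 f - L4 g"
    if "f \<in> superfunctions 3" "g \<in> superfunctions 3" for f g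
    using that by (simp_all add: L1_def L2_def L3_def L4_def Lop_add[where q = 3] Lop_diff[where q = 3])
  have sig [simp]: "\<sigma> (\<sigma> f) = f" "\<sigma> (scl c f) = scl c (\<sigma> f)" "\<sigma> (- f) = - \<sigma> f" "\<sigma> 0 = 0"
     "\<sigma> (f + g) = \<sigma> f + \<sigma> g" "\<sigma> (f - g) = \<sigma> f - \<sigma> g" "\<sigma> f = 0 \<longleftrightarrow> f = 0" for c f g
    by (simp_all add: \<sigma>_def tau_add tau_diff)
  have zero [simp]: "L1 0 = 0" "L2 0 = 0" "L3 0 = 0" "L4 0 = 0"
    by (simp_all add: L1_def L2_def L3_def L4_def)
  have c12: "L1 (L2 f) = L2 (L1 f)" and c14: "L1 (L4 f) = L4 (L1 f)" and c23: "L2 (L3 f) = L3 (L2 f)"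
    and c13: "L1 (L3 f) = L3 (L1 f) + L6 f" and c24: "L2 (L4 f) = L4 (L2 f) + L6 f"
    and c33: "L3 (L3 f) = 0" and c44: "L4 (L4 f) = 0" if "f \<in> superfunctions 3" for f
    using Lop_relations[OF that order_refl, of s1] by (simp_all only: L1_def L2_def L3_def L4_def L6_def)
  note T0 = T0[folded L1_def L2_def L3_def L4_def]
  note Te = Te[folded L1_def L2_def]
  note To = To[folded L3_def L4_def]
  note Tt = Tt[folded L1_def L2_def L3_def L4_def \<sigma>_def]
  note D5 = D5[folded L1_def L2_def L3_def L4_def \<sigma>_def]
  note D6 = D6[folded L1_def L2_def L3_def L4_def \<sigma>_def]

  txt \<open>The components of degree \<open>0\<close> (\<open>h1, h2, h3, P, Q\<close>), degree \<open>1\<close> (\<open>X2, X3, A, C\<close>) and degree \<open>2\<close> (\<open>X1, W\<close>),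
    each read off from one of the flatness equations.\<close>
  define h2 where "h2 = scl (- 1 / 2) (L1 (F E1))"
  define h3 where "h3 = scl (- 1 / 2) (L2 (F E2))"
  define h1 where "h1 = h2 - h3 - \<sigma> (L3 (F E3))"
  define P where "P = - L1 (F E4)"
  define Q where "Q = - \<sigma> (L4 (F E1))"
  define X2 where "X2 = L1 h2"
  define X3 where "X3 = L2 h3"
  define A where "A = - L2 Q"
  define C where "C = - L1 Q"
  define W where "W = - L1 A"
  define X1 where "X1 = \<sigma> (L3 C)"
  have mem [simp]: "h2 \<in> superfunctions 3" "h3 \<in> superfunctions 3" "h1 \<in> superfunctions 3" "P \<in> superfunctions 3"
    "Q \<in> superfunctions 3"
    by (simp_all add: h2_def h3_def h1_def P_def Q_def)
  have mem' [simp]: "X2 \<in> superfunctions 3" "X3 \<in> superfunctions 3" "A \<in> superfunctions 3" "C \<in> superfunctions 3"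
    by (simp_all add: X2_def X3_def A_def C_def)
  have mem'' [simp]: "W \<in> superfunctions 3" "X1 \<in> superfunctions 3"
    by (simp_all add: W_def X1_def)

  have L1f1: "L1 (F E1) = - scl 2 h2" and L2f2: "L2 (F E2) = - scl 2 h3"
    by (simp_all add: h2_def h3_def)
  have L1f4: "L1 (F E4) = - P" and L2f3: "L2 (F E3) = - P"
    by (simp_all add: P_def Te)
  have L4f1: "L4 (F E1) = - \<sigma> Q" and L3f2: "L3 (F E2) = - scl a (\<sigma> Q)"
    by (simp_all add: Q_def To)
  have neg_sig: "x = - \<sigma> y" if "- \<sigma> x = y" for x y
    using that by (metis sig(1,3) minus_minus)
  \<comment> \<open>\<open>u\<close> and \<open>v\<close> are the combinations of Cartan components
    by which degree 0 acts on e_3 and e_4 (up to sign). The commutators give their derivatives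
    directly, and those of \<open>h1\<close>, \<open>h2\<close>, \<open>h3\<close> are recovered
    from them.\<close>
  define u where "u = h1 - h2 + h3"
  define v where "v = h1 + h2 - h3"
  have mem_uv [simp]: "u \<in> superfunctions 3" "v \<in> superfunctions 3"
    by (simp_all add: u_def v_def)
  have h1_uv: "h1 = scl (1 / 2) (u + v)" and h2_uv: "h2 = h3 + scl (1 / 2) (v - u)"
    by (simp_all add: u_def v_def fun_eq_iff scl_apply field_simps)
  have sL3f3: "\<sigma> (L3 (F E3)) = - u"
    by (simp add: u_def h1_def)
  then have L3f3: "L3 (F E3) = - \<sigma> u"
    by (metis sig(1,3))
  \<comment> \<open>\<open>h1\<close> was read off from L3 (F E3); that L4 (F E4) fits the same
    \<open>h1\<close> is the diagonal condition \<open>Tt\<close>.\<close>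
  have "\<sigma> (L4 (F E4)) = L1 (F E1) + \<sigma> (L3 (F E3)) - L2 (F E2)"
    unfolding Tt by simp
  also have "\<dots> = - v"
    unfolding L1f1 L2f2 sL3f3 by (simp add: fun_eq_iff scl_apply u_def v_def)
  finally have L4f4: "L4 (F E4) = - \<sigma> v"
    by (metis sig(1,3))

  have L1P: "L1 P = 0"
    using c12[of "F E3"] by (simp add: L2f3 T0)
  have L2P: "L2 P = 0"
    using c12[of "F E4"] by (simp add: L1f4 T0)
  have L3Q: "L3 Q = 0"
    using c33[of "F E2"] a by (simp add: L3f2 scl_eq_0_iff)
  have L4Q: "L4 Q = 0"
    using c44[of "F E1"] by (simp add: L4f1)
  have L1h3: "L1 h3 = 0"
    using c12[of "F E2"] by (simp add: L2f2 T0 scl_eq_0_iff)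
  have L2h2: "L2 h2 = 0"
    using c12[of "F E1"] by (simp add: L1f1 T0 scl_eq_0_iff)
  \<comment> \<open>L_6 equals both [L_1, L_3] and [L_2, L_4]. Here and below it is computed from
    one of these relations and substituted into the other.\<close>
  have L6f3: "L6 (F E3) = L4 P"
    using c24[of "F E3"] by (simp add: L2f3 T0)
  have L6f4: "L6 (F E4) = L3 P"
    using c13[of "F E4"] by (simp add: L1f4 T0)
  have L1u: "L1 u = - \<sigma> (L4 P)"
    by (rule neg_sig) (use c13[of "F E3"] in \<open>simp add: L3f3 T0 L6f3\<close>)
  have L1v: "L1 v = \<sigma> (L4 P)"
    using neg_sig[of "L1 v" "- L4 P"] c14[of "F E4"] by (simp add: L4f4 L1f4)
  have L2v: "L2 v = - \<sigma> (L3 P)"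
    by (rule neg_sig) (use c24[of "F E4"] in \<open>simp add: L4f4 T0 L6f4\<close>)
  have L2u: "L2 u = \<sigma> (L3 P)"
    using neg_sig[of "L2 u" "- L3 P"] c23[of "F E3"] by (simp add: L3f3 L2f3)
  have L1h1: "L1 h1 = 0" and L2h1: "L2 h1 = 0"
    by (simp_all add: h1_uv L1u L1v L2u L2v)
  have X2: "X2 = \<sigma> (L4 P)"
    by (simp add: X2_def h2_uv L1h3 L1u L1v fun_eq_iff scl_apply)
  have X3: "X3 = \<sigma> (L3 P)"
  proof -
    have "h3 = h2 - scl (1 / 2) (v - u)"
      by (simp add: h2_uv)
    then have "X3 = L2 (h2 - scl (1 / 2) (v - u))"
      by (simp only: X3_def)
    then show ?thesis
      by (simp add: L2h2 L2u L2v fun_eq_iff scl_apply)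
  qed
  have L1h2: "L1 h2 = X2" and L2h3: "L2 h3 = X3"
    by (simp_all add: X2_def X3_def)
  have L4P: "L4 P = \<sigma> X2" and L3P: "L3 P = \<sigma> X3"
    by (simp_all add: X2 X3)
  have L1Q: "L1 Q = - C" and L2Q: "L2 Q = - A"
    by (simp_all add: A_def C_def)
  have L6f1: "L6 (F E1) = \<sigma> A"
    using c24[of "F E1"] by (simp add: L4f1 T0 L2Q)
  have L3h2: "L3 h2 = scl (1 / 2) (\<sigma> A)"
  proof -
    have "L3 (L1 (F E1)) = - \<sigma> A"
      using c13[OF F, of E1, symmetric] by (simp only: T0 zero L6f1 eq_neg_iff_add_eq_0)
    then show ?thesis by (simp add: h2_def)
  qed
  have L3h3: "L3 h3 = - scl (a / 2) (\<sigma> A)"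
    unfolding h3_def by (simp add: c23[symmetric] L3f2 L2Q)
  have L3u: "L3 u = 0"
    using c33[of "F E3"] by (simp add: L3f3)
  have L3h1: "L3 h1 = - scl (s1 / 2) (\<sigma> A)"
  proof -
    have "h1 = u + h2 - h3" by (simp add: u_def)
    then have "L3 h1 = L3 (u + h2 - h3)" by (simp only:)
    then show ?thesis
      by (simp add: L3u L3h2 L3h3 s1 fun_eq_iff scl_apply field_simps)
  qed
  have L6f2: "L6 (F E2) = scl a (\<sigma> C)"
    using c13[of "F E2"] by (simp add: L3f2 T0 L1Q)
  have L4h3: "L4 h3 = scl (a / 2) (\<sigma> C)"
  proof -
    have "L4 (L2 (F E2)) = - scl a (\<sigma> C)"
      using c24[OF F, of E2, symmetric] by (simp only: T0 zero L6f2 eq_neg_iff_add_eq_0)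
    then show ?thesis by (simp add: h3_def)
  qed
  have L4h2: "L4 h2 = - scl (1 / 2) (\<sigma> C)"
    unfolding h2_def by (simp add: c14[symmetric] L4f1 L1Q)
  have L4v: "L4 v = 0"
    using c44[of "F E4"] by (simp add: L4f4)
  have L4h1: "L4 h1 = - scl (s1 / 2) (\<sigma> C)"
  proof -
    have "h1 = v - h2 + h3" by (simp add: v_def)
    then have "L4 h1 = L4 (v - h2 + h3)" by (simp only:)
    then show ?thesis
      by (simp add: L4v L4h2 L4h3 s1 fun_eq_iff scl_apply field_simps)
  qed

  have L1X3: "L1 X3 = 0"
    unfolding X3_def by (simp add: c12 L1h3)
  have L2X2: "L2 X2 = 0"
    unfolding X2_def by (simp add: c12[symmetric] L2h2)
  have L4X2: "L4 X2 = 0" and L1X2: "L1 X2 = 0"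
    by (simp_all add: X2 c44 c14 L1P)
  have L3X3: "L3 X3 = 0" and L2X3: "L2 X3 = 0"
    by (simp_all add: X3 c33 c23 L2P)
  have L1C: "L1 C = 0"
    using c14[of h2] by (simp add: L4h2 L1h2 L4X2 scl_eq_0_iff)
  have L2A: "L2 A = 0"
    using c23[of h3] a by (simp add: L3h3 L2h3 L3X3 scl_eq_0_iff)
  have L1A: "L1 A = - W"
    by (simp add: W_def)
  have L2C: "L2 C = - W"
    unfolding W_def A_def C_def by (simp add: c12)
  have L3A: "L3 A = 0"
    using c33[of h2] by (simp add: L3h2 scl_eq_0_iff)
  have L4C: "L4 C = 0"
    using c44[of h2] by (simp add: L4h2 scl_eq_0_iff)
  have L6h2: "L6 h2 = scl (1 / 2) (\<sigma> W)"
    using c24[of h2] by (simp add: L4h2 L2C L2h2)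
  have L3X2: "L3 X2 = - \<sigma> W"
  proof -
    have "L3 X2 = L1 (L3 h2) - L6 h2"
      using c13[of h2] unfolding X2_def by simp
    then show ?thesis
      unfolding L6h2 by (simp add: L3h2 L1A fun_eq_iff scl_apply)
  qed
  have L6h3: "L6 h3 = scl (a / 2) (\<sigma> W)"
    using c13[of h3] by (simp add: L3h3 L1A L1h3)
  have L4X3: "L4 X3 = - scl a (\<sigma> W)"
  proof -
    have "L4 X3 = L2 (L4 h3) - L6 h3"
      using c24[of h3] unfolding X3_def by simp
    then show ?thesis
      unfolding L6h3 by (simp add: L4h3 L2C fun_eq_iff scl_apply)
  qed
  \<comment> \<open>The two expressions for L6 Q show that the top component obtained from
    \<open>C\<close> is the one obtained from \<open>A\<close>.\<close>
  have "L6 Q = L4 A"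
    using c24[of Q] by (simp add: L4Q L2Q)
  moreover have "L6 Q = L3 C"
    using c13[of Q] by (simp add: L3Q L1Q)
  ultimately have X1_eq: "X1 = \<sigma> (L4 A)"
    by (simp add: X1_def)
  have L3C: "L3 C = \<sigma> X1" and L4A: "L4 A = \<sigma> X1"
    by (simp add: X1_def, simp add: X1_eq)
  have L3X1: "L3 X1 = 0"
    by (simp add: X1_def c33)
  have L4X1: "L4 X1 = 0"
    by (simp add: X1_eq c44)
  have double: "x = 0" if "x = - x" for x :: sfun
    using that by (simp add: fun_eq_iff)
  have L6C: "L6 C = L4 W"
    using c24[of C] by (simp add: L4C L2C)
  \<comment> \<open>The two descriptions of \<open>X1\<close> give opposite values for L1 X1, so it
    vanishes and L4 W with it; L2 X1 and L3 W are treated alike. These are equations saying that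
    nothing appears in degree 3.\<close>
  have "L1 X1 = \<sigma> (L4 W)"
    using c13[of C] by (simp add: X1_def L1C L6C)
  moreover have "L1 X1 = - \<sigma> (L4 W)"
    by (simp add: X1_eq c14 L1A)
  ultimately have L1X1: "L1 X1 = 0" and "\<sigma> (L4 W) = 0"
    using double[of "\<sigma> (L4 W)"] by (metis neg_0_equal_iff_equal)+
  then have L4W: "L4 W = 0"
    by simp
  have L6A: "L6 A = L3 W"
    using c13[of A] by (simp add: L3A L1A)
  have "L2 X1 = \<sigma> (L3 W)"
    using c24[of A] by (simp add: X1_eq L2A L6A)
  moreover have "L2 X1 = - \<sigma> (L3 W)"
    by (simp add: X1_def c23 L2C)
  ultimately have L2X1: "L2 X1 = 0" and "\<sigma> (L3 W) = 0"
    using double[of "\<sigma> (L3 W)"] by (metis neg_0_equal_iff_equal)+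
  then have L3W: "L3 W = 0"
    by simp
  have L2W: "L2 W = 0"
    unfolding W_def by (simp add: c12[symmetric] L2A)
  have L1W: "L1 W = 0"
    using c12[of C] by (simp add: L1C L2C)

  define \<Phi> where "\<Phi> = (\<lambda>k :: gix. case k of
      Inl (i, b) \<Rightarrow> if i = 1 then (case b of BX \<Rightarrow> X1 | BH \<Rightarrow> h1 | BY \<Rightarrow> F E5)
        else if i = 2 then (case b of BX \<Rightarrow> X2 | BH \<Rightarrow> h2 | BY \<Rightarrow> F E1)
        else (case b of BX \<Rightarrow> X3 | BH \<Rightarrow> h3 | BY \<Rightarrow> F E2)
    | Inr (Vx, Vx, Vx) \<Rightarrow> W | Inr (Vx, Vx, Vy) \<Rightarrow> C | Inr (Vx, Vy, Vx) \<Rightarrow> A | Inr (Vx, Vy, Vy) \<Rightarrow> Q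
    | Inr (Vy, Vx, Vx) \<Rightarrow> P | Inr (Vy, Vx, Vy) \<Rightarrow> F E3 | Inr (Vy, Vy, Vx) \<Rightarrow> F E4 | Inr (Vy, Vy, Vy) \<Rightarrow> F E6)"
  have [simp]: "\<Phi> (Inl (1, BX)) = X1" "\<Phi> (Inl (1, BH)) = h1" "\<Phi> (Inl (1, BY)) = F E5"
    "\<Phi> (Inl (2, BX)) = X2" "\<Phi> (Inl (2, BH)) = h2" "\<Phi> (Inl (2, BY)) = F E1"
    "\<Phi> (Inl (3, BX)) = X3" "\<Phi> (Inl (3, BH)) = h3" "\<Phi> (Inl (3, BY)) = F E2"
    "\<Phi> (Inr (Vx, Vx, Vx)) = W" "\<Phi> (Inr (Vx, Vx, Vy)) = C" "\<Phi> (Inr (Vx, Vy, Vx)) = A" "\<Phi> (Inr (Vx, Vy, Vy)) = Q"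
    "\<Phi> (Inr (Vy, Vx, Vx)) = P" "\<Phi> (Inr (Vy, Vx, Vy)) = F E3" "\<Phi> (Inr (Vy, Vy, Vx)) = F E4"
    "\<Phi> (Inr (Vy, Vy, Vy)) = F E6"
    by (simp_all add: \<Phi>_def)
  have u: "u = h1 - h2 + h3" and v: "v = h1 + h2 - h3"
    by (simp_all add: u_def v_def)
  have "flat a \<Phi>"
    unfolding flat_def neg1_def s1[symmetric]
  proof (intro conjI)
    show "\<forall>l. \<Phi> l \<in> superfunctions 3"
      unfolding all_gix by simp
    have "\<forall>l. L1 (\<Phi> l) = - (\<Sum>k\<in>UNIV. scl (gamma_const s1 1 a (idx E1) k l) (\<Phi> k))"
      unfolding all_gix
      by (simp add: sum_gix D5 D6 T0 L1f1 L1f4 L1h1 L1h2 L1h3 L1P L1Q L1X1 L1X2 L1X3 L1A L1C L1W)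
    moreover have "\<forall>l. L2 (\<Phi> l) = - (\<Sum>k\<in>UNIV. scl (gamma_const s1 1 a (idx E2) k l) (\<Phi> k))"
      unfolding all_gix
      by (simp add: sum_gix D5 D6 T0 L2f2 L2f3 L2h1 L2h2 L2h3 L2P L2Q L2X1 L2X2 L2X3 L2A L2C L2W)
    moreover have "\<forall>l. L3 (\<Phi> l) = - (\<Sum>k\<in>UNIV. scl (gamma_const s1 1 a (idx E3) k l) (\<sigma> (\<Phi> k)))"
      unfolding all_gix
      by (simp add: sum_gix D5 D6 T0 L3f2 L3f3 L3h1 L3h2 L3h3 L3P L3Q L3X1 L3X2 L3X3 L3A L3C L3W u algebra_simps)
    moreover have "\<forall>l. L4 (\<Phi> l) = - (\<Sum>k\<in>UNIV. scl (gamma_const s1 1 a (idx E4) k l) (\<sigma> (\<Phi> k)))"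
      unfolding all_gix
      by (simp add: sum_gix D5 D6 T0 L4f1 L4f4 L4h1 L4h2 L4h3 L4P L4Q L4X1 L4X2 L4X3 L4A L4C L4W v algebra_simps)
    ultimately show "\<forall>i\<in>{E1, E2, E3, E4}. \<forall>l. Lop s1 i (\<Phi> l)
        = - (\<Sum>k\<in>UNIV. scl (gamma_const s1 1 a (idx i) k l) (tau (par i) (\<Phi> k)))"
      by (simp add: L1_def L2_def L3_def L4_def \<sigma>_def del: idx.simps)
  qed
  moreover have "\<Phi> (idx i) = F i" for i
    by (cases i) simp_all
  ultimately show thesis
    by (rule that)
qed


section \<open>Tangency to the cone\<close>

text \<open>\<open>c0 + c3 \<nu> + c4 \<theta> + c34 \<nu> \<theta>\<close> in the fibre coordinates \<open>\<nu>, \<theta>\<close> of \<open>W_param\<close>.\<close>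

definition fibre_poly :: "complex \<Rightarrow> complex \<Rightarrow> complex \<Rightarrow> complex \<Rightarrow> sfun" where
  "fibre_poly c0 c3 c4 c34 = (\<lambda>S x. if S = {} then c0 else if S = {3} then c3 else if S = {4} then c4
     else if S = {3, 4} then c34 else 0)"

lemma fibre_poly_apply: "fibre_poly c0 c3 c4 c34 {} x = c0" "fibre_poly c0 c3 c4 c34 {3} x = c3" "fibre_poly c0 c3 c4 c34 {4} x = c4"
  "fibre_poly c0 c3 c4 c34 {3, 4} x = c34"
  by (auto simp: fibre_poly_def)

lemma subset_34: "S \<subseteq> {3, 4} \<longleftrightarrow> S = {} \<or> S = {3} \<or> S = {4} \<or> S = {3, 4 :: nat}"
  by blast

lemma fibre_poly_outside: "\<not> S \<subseteq> {3, 4} \<Longrightarrow> fibre_poly c0 c3 c4 c34 S = 0"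
  by (auto simp: fibre_poly_def fun_eq_iff)

lemma fibre_poly_superfunctions [simp]: "fibre_poly c0 c3 c4 c34 \<in> superfunctions 5"
proof (rule superfunctionsI)
  fix S
  show "holomorphic3 (fibre_poly c0 c3 c4 c34 S)"
    unfolding fibre_poly_def by simp
  show "fibre_poly c0 c3 c4 c34 S = 0" if "\<not> S \<subseteq> {..<5}"
    by (rule fibre_poly_outside) (use that in auto)
qed

lemma fibre_poly_eq: "sconst c = fibre_poly c 0 0 0" "odd_coord 3 = fibre_poly 0 1 0 0" "odd_coord 4 = fibre_poly 0 0 1 0" "(0 :: sfun) = fibre_poly 0 0 0 0"
  by (auto simp: fibre_poly_def sconst_def odd_coord_def fun_eq_iff)

lemma fibre_poly_add: "fibre_poly c0 c3 c4 c34 + fibre_poly d0 d3 d4 d34 = fibre_poly (c0 + d0) (c3 + d3) (c4 + d4) (c34 + d34)"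
  by (auto simp: fibre_poly_def fun_eq_iff)

lemma koszul_34 [simp]: "koszul_sign {3} {4} = 1" "koszul_sign {4} {3} = -1"
proof -
  show "koszul_sign {3} {4} = 1"
    by (rule koszul_sign_1) simp
  have "{i \<in> {3}. i < 4} = {3 :: nat}" by auto
  then show "koszul_sign {4} {3} = -1"
    unfolding koszul_sign_singleton by simp
qed

lemma Pow_34: "Pow {3, 4 :: nat} = {{}, {3}, {4}, {3, 4}}"
  by (auto simp: Pow_def subset_34)

lemma Pow_single: "Pow {n :: nat} = {{}, {n}}"
  by (auto simp: Pow_def)

lemma diff_34: "{3, 4} - {3} = {4 :: nat}" "{3, 4} - {4} = {3 :: nat}"
  by auto

lemma fibre_poly_smult: "fibre_poly c0 c3 c4 c34 \<odot> fibre_poly d0 d3 d4 d34 =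
  fibre_poly (c0 * d0) (c0 * d3 + c3 * d0) (c0 * d4 + c4 * d0) (c0 * d34 + c34 * d0 + c3 * d4 - c4 * d3)"
proof (intro ext)
  fix S x
  let ?c = "fibre_poly c0 c3 c4 c34" and ?d = "fibre_poly d0 d3 d4 d34"
  show "(?c \<odot> ?d) S x =
    fibre_poly (c0 * d0) (c0 * d3 + c3 * d0) (c0 * d4 + c4 * d0) (c0 * d34 + c34 * d0 + c3 * d4 - c4 * d3) S x"
  proof (cases "S \<subseteq> {3, 4}")
    case True
    then show ?thesis
      unfolding subset_34
      by (elim disjE) (simp_all add: smult_apply Pow_34 Pow_single diff_34 fibre_poly_apply)
  next
    case False
    have "?c T x * ?d (S - T) x = 0" for T
    proof (cases "T \<subseteq> {3, 4}")
      case True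
      with False have "\<not> S - T \<subseteq> {3, 4}" by blast
      then show ?thesis by (simp add: fibre_poly_outside)
    qed (simp add: fibre_poly_outside)
    then have "(\<Sum>T\<in>Pow S. koszul_sign T (S - T) * (?c T x * ?d (S - T) x)) = 0"
      by (intro sum.neutral ballI) (simp only: mult_zero_right)
    then show ?thesis
      by (simp add: smult_apply fibre_poly_outside[OF False] mult.assoc)
  qed
qed

lemma odd_partial_fibre_poly: "odd_partial 3 (fibre_poly c0 c3 c4 c34) = fibre_poly c3 0 c34 0"
  "odd_partial 4 (fibre_poly c0 c3 c4 c34) = fibre_poly c4 (- c34) 0 0"
proof -
  have ins3: "insert 3 S \<noteq> {4}" "insert 3 S = {3} \<longleftrightarrow> S = {}" "insert 3 S = {3, 4} \<longleftrightarrow> S = {4}"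
    if "3 \<notin> S" for S :: "nat set"
    using that insert_ident[of 3 S "{}"] insert_ident[of 3 S "{4}"] by auto
  have ins4: "insert 4 S \<noteq> {3}" "insert 4 S = {4} \<longleftrightarrow> S = {}" "insert 4 S = {3, 4} \<longleftrightarrow> S = {3}"
    if "4 \<notin> S" for S :: "nat set"
    using that insert_ident[of 4 S "{}"] insert_ident[of 4 S "{3}"] by (auto simp: insert_commute)
  have 3: "{i. i = 4 \<and> i < 3} = ({} :: nat set)" and 4: "{i. i = 3 \<and> i < 4} = {3 :: nat}" by auto
  show "odd_partial 3 (fibre_poly c0 c3 c4 c34) = fibre_poly c3 0 c34 0"
  proof (intro ext)
    fix S x
    show "odd_partial 3 (fibre_poly c0 c3 c4 c34) S x = fibre_poly c3 0 c34 0 S x"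
      by (cases "3 \<in> S") (auto simp: odd_partial_def fibre_poly_def ins3 3)
  qed
  show "odd_partial 4 (fibre_poly c0 c3 c4 c34) = fibre_poly c4 (- c34) 0 0"
  proof (intro ext)
    fix S x
    show "odd_partial 4 (fibre_poly c0 c3 c4 c34) S x = fibre_poly c4 (- c34) 0 0 S x"
      by (cases "4 \<in> S") (auto simp: odd_partial_def fibre_poly_def ins4 4)
  qed
qed

lemma W_param_fibre_poly:
  "W_param a E1 E1 = fibre_poly 1 0 0 0" "W_param a E4 E4 = fibre_poly 0 0 0 1" "W_param a E2 E2 = fibre_poly 1 0 0 (a - 1)"
  "W_param a E3 E3 = fibre_poly 0 0 0 a" "W_param a E1 E4 = fibre_poly 0 1 0 0" "W_param a E4 E1 = fibre_poly 0 0 1 0"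
  "W_param a E2 E3 = fibre_poly 0 a 0 0" "W_param a E3 E2 = fibre_poly 0 0 1 0"
  "W_param a E1 E2 = fibre_poly 0 0 0 0" "W_param a E1 E3 = fibre_poly 0 0 0 0" "W_param a E2 E1 = fibre_poly 0 0 0 0"
  "W_param a E2 E4 = fibre_poly 0 0 0 0" "W_param a E3 E1 = fibre_poly 0 0 0 0" "W_param a E3 E4 = fibre_poly 0 0 0 0"
  "W_param a E4 E2 = fibre_poly 0 0 0 0" "W_param a E4 E3 = fibre_poly 0 0 0 0"
  unfolding W_param_def W_point.simps fibre_poly_eq fibre_poly_smult fibre_poly_add by simp_all

lemma superfunctions_5_cases:
  assumes "S \<subseteq> {..<5::nat}"
  obtains S0 S1 where "S0 \<subseteq> {..<3}" "S1 \<in> {{}, {3}, {4}, {3, 4}}" "S = S0 \<union> S1"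
proof
  show "S \<inter> {..<3} \<subseteq> {..<3}" by simp
  have "S \<inter> {3, 4} \<subseteq> {3, 4}" by simp
  then show "S \<inter> {3, 4} \<in> {{}, {3}, {4}, {3, 4}}"
    unfolding subset_34 by simp
  have "x \<in> {..<3} \<or> x \<in> {3, 4}" if "x \<in> S" for x
    using assms that by (auto simp: subset_iff)
  then show "S = S \<inter> {..<3} \<union> S \<inter> {3, 4}" by blast
qed

text \<open>A superfunction with five odd generators is a polynomial in \<nu> and \<theta> over the
  superfunctions of M. The slices \<open>S0 \<union> S1\<close> with
  \<open>S1 \<subseteq> {3, 4}\<close> are its coefficients.\<close>

lemma superfunctions_5_eqI:
  assumes "f \<in> superfunctions 5" "g \<in> superfunctions 5"
    and "\<And>S0 x. S0 \<subseteq> {..<3} \<Longrightarrow> f S0 x = g S0 x \<and> f (S0 \<union> {3}) x = g (S0 \<union> {3}) x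
      \<and> f (S0 \<union> {4}) x = g (S0 \<union> {4}) x \<and> f (S0 \<union> {3, 4}) x = g (S0 \<union> {3, 4}) x"
  shows "f = g"
proof (intro ext)
  fix S x
  show "f S x = g S x"
  proof (cases "S \<subseteq> {..<5}")
    case True
    then obtain S0 S1 where "S0 \<subseteq> {..<3}" "S1 \<in> {{}, {3}, {4}, {3, 4}}" "S = S0 \<union> S1"
      by (rule superfunctions_5_cases)
    with assms(3)[of S0 x] show ?thesis by auto
  next
    case False
    with assms(1,2) show ?thesis by (simp add: superfunctionsD(2))
  qed
qed

text \<open>The second factor lives on subsets of \<open>{3, 4}\<close>, so the first must take all
  of \<open>S0\<close>. Generators 0, 1, 2 precede 3 and 4, hence \<open>S0\<close> contributes no
  sign.\<close>

lemma smult_fibre_poly_slice: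
  assumes S0: "S0 \<subseteq> {..<3}" and S1: "S1 \<subseteq> {3, 4}"
  shows "(f \<odot> fibre_poly c0 c3 c4 c34) (S0 \<union> S1) x =
    (\<Sum>T\<in>Pow S1. koszul_sign T (S1 - T) * f (S0 \<union> T) x * fibre_poly c0 c3 c4 c34 (S1 - T) x)"
proof -
  let ?w = "fibre_poly c0 c3 c4 c34"
  have fin: "finite S0" "finite S1" using S0 S1 finite_subset by blast+
  have disj: "S0 \<inter> S1 = {}" using S0 S1 by force
  have "(f \<odot> ?w) (S0 \<union> S1) x =
      (\<Sum>T\<in>(\<union>) S0 ` Pow S1. koszul_sign T (S0 \<union> S1 - T) * f T x * ?w (S0 \<union> S1 - T) x)"
    unfolding smult_apply
  proof (rule sum.mono_neutral_right)
    show "\<forall>T\<in>Pow (S0 \<union> S1) - (\<union>) S0 ` Pow S1.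
        koszul_sign T (S0 \<union> S1 - T) * f T x * ?w (S0 \<union> S1 - T) x = 0"
    proof
      fix T assume T: "T \<in> Pow (S0 \<union> S1) - (\<union>) S0 ` Pow S1"
      have "\<not> S0 \<subseteq> T"
      proof
        assume "S0 \<subseteq> T"
        then have "T = S0 \<union> (T \<inter> S1)" using T by blast
        then show False using T by blast
      qed
      then obtain n where "n \<in> S0 - T" by blast
      then have "\<not> S0 \<union> S1 - T \<subseteq> {3, 4}" using S0 by force
      then show "koszul_sign T (S0 \<union> S1 - T) * f T x * ?w (S0 \<union> S1 - T) x = 0"
        by (simp add: fibre_poly_outside)
    qed
  qed (use fin in auto)
  also have "\<dots> = (\<Sum>T\<in>Pow S1. koszul_sign (S0 \<union> T) (S0 \<union> S1 - (S0 \<union> T)) * f (S0 \<union> T) x * ?w (S0 \<union> S1 - (S0 \<union> T)) x)"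
    by (subst sum.reindex) (use disj in \<open>auto simp: inj_on_def\<close>)
  also have "\<dots> = (\<Sum>T\<in>Pow S1. koszul_sign T (S1 - T) * f (S0 \<union> T) x * ?w (S1 - T) x)"
  proof (rule sum.cong)
    fix T assume T: "T \<in> Pow S1"
    have 1: "S0 \<union> S1 - (S0 \<union> T) = S1 - T" using disj by blast
    have "koszul_sign S0 (S1 - T) = 1"
      by (rule koszul_sign_1) (use S0 S1 in force)
    moreover have "koszul_sign (S0 \<union> T) (S1 - T) = koszul_sign S0 (S1 - T) * koszul_sign T (S1 - T)"
      using fin T disj finite_subset[of T S1] by (intro koszul_sign_union_left) auto
    ultimately show "koszul_sign (S0 \<union> T) (S0 \<union> S1 - (S0 \<union> T)) * f (S0 \<union> T) x * ?w (S0 \<union> S1 - (S0 \<union> T)) x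
        = koszul_sign T (S1 - T) * f (S0 \<union> T) x * ?w (S1 - T) x"
      by (simp add: 1)
  qed simp
  finally show ?thesis .
qed

lemma smult_fibre_poly:
  assumes "S0 \<subseteq> {..<3}"
  shows "(f \<odot> fibre_poly c0 c3 c4 c34) S0 x = f S0 x * c0"
    and "(f \<odot> fibre_poly c0 c3 c4 c34) (S0 \<union> {3}) x = f S0 x * c3 + f (S0 \<union> {3}) x * c0"
    and "(f \<odot> fibre_poly c0 c3 c4 c34) (S0 \<union> {4}) x = f S0 x * c4 + f (S0 \<union> {4}) x * c0"
    and "(f \<odot> fibre_poly c0 c3 c4 c34) (S0 \<union> {3, 4}) x
      = f S0 x * c34 + f (S0 \<union> {3}) x * c4 - f (S0 \<union> {4}) x * c3 + f (S0 \<union> {3, 4}) x * c0"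
proof -
  note s = smult_fibre_poly_slice[OF assms, of _ f c0 c3 c4 c34 x]
  show "(f \<odot> fibre_poly c0 c3 c4 c34) S0 x = f S0 x * c0"
    using s[of "{}"] by (simp add: fibre_poly_apply)
  show "(f \<odot> fibre_poly c0 c3 c4 c34) (S0 \<union> {3}) x = f S0 x * c3 + f (S0 \<union> {3}) x * c0"
    using s[of "{3}"] unfolding Pow_single by (simp add: fibre_poly_apply)
  show "(f \<odot> fibre_poly c0 c3 c4 c34) (S0 \<union> {4}) x = f S0 x * c4 + f (S0 \<union> {4}) x * c0"
    using s[of "{4}"] unfolding Pow_single by (simp add: fibre_poly_apply)
  show "(f \<odot> fibre_poly c0 c3 c4 c34) (S0 \<union> {3, 4}) x
      = f S0 x * c34 + f (S0 \<union> {3}) x * c4 - f (S0 \<union> {4}) x * c3 + f (S0 \<union> {3, 4}) x * c0"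
    using s[of "{3, 4}"] unfolding Pow_34 by (simp add: fibre_poly_apply diff_34)
qed

lemma superfunctions_3_slice:
  assumes "f \<in> superfunctions 3"
  shows "f (S0 \<union> {3}) x = 0" "f (S0 \<union> {4}) x = 0" "f (S0 \<union> {3, 4}) x = 0"
  using superfunctionsD(2)[OF assms] by auto

text \<open>Here \<open>B j k\<close> is the coefficient of the \<open>k\<close>-th frame field in
  the image of the \<open>j\<close>-th. Eleven linear equations on 16 entries leave five dimensions,
  those of \<open>\<gg>\<^sub>0\<close>: the last one is the condition on diagonal maps to respect
  [e_1, e_3] = [e_2, e_4], and the two before it leave one parameter each for the odd maps \<psi>^+
  and \<psi>^-, with the ratio s_3 / s_2 = a.\<close>

definition cone_compat :: "complex \<Rightarrow> (mix \<Rightarrow> mix \<Rightarrow> sfun) \<Rightarrow> bool" where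
  "cone_compat a B \<longleftrightarrow> B E1 E2 = 0 \<and> B E1 E3 = 0 \<and> B E2 E1 = 0 \<and> B E2 E4 = 0 \<and>
     B E3 E1 = 0 \<and> B E3 E4 = 0 \<and> B E4 E2 = 0 \<and> B E4 E3 = 0 \<and>
     B E1 E4 = B E2 E3 \<and> B E3 E2 = scl a (B E4 E1) \<and> B E1 E1 + B E3 E3 = B E2 E2 + B E4 E4"

text \<open>\<open>y \<mapsto> y B - B y\<close> up to Koszul signs, the action on \<open>End \<D>\<close> of the fibrewise linear map \<open>B\<close>.\<close>

definition fibre_action :: "(mix \<Rightarrow> mix \<Rightarrow> sfun) \<Rightarrow> (mix \<Rightarrow> mix \<Rightarrow> sfun) \<Rightarrow> mix \<Rightarrow> mix \<Rightarrow> sfun" where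
  "fibre_action B y i j = (\<Sum>k\<in>neg1. B j k \<odot> y i k
     - scl ((-1) ^ ((par k + par j) * (par i + par k))) (B k i \<odot> y k j))"

lemma sum_neg1: "(\<Sum>k\<in>neg1. f k) = f E1 + (f E2 + (f E3 + f E4))"
  by (simp add: neg1_def)

lemma cone_compat_imp_tangent:
  assumes B: "\<And>i j. B i j \<in> superfunctions 3" and compat: "cone_compat a B"
  shows "\<exists>f\<in>superfunctions 5. \<exists>g\<in>superfunctions 5. \<exists>h\<in>superfunctions 5. \<forall>i\<in>neg1. \<forall>j\<in>neg1.
    fibre_action B (W_param a) i j = f \<odot> W_param a i j
      + g \<odot> odd_partial 3 (W_param a i j) + h \<odot> odd_partial 4 (W_param a i j)"
proof -
  note B5 [simp] = superfunctions_mono[OF B, of 5, simplified]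
  \<comment> \<open>At the entries (1,1), (1,4) and (4,1) the parametrized point equals 1, \<nu> and
    \<theta>. The tangency equations there determine \<open>f\<close>, then \<open>g\<close> and
    \<open>h\<close>.\<close>
  define f where "f = B E2 E3 \<odot> fibre_poly 0 1 0 0 + B E4 E1 \<odot> fibre_poly 0 0 1 0"
  define g where "g = B E4 E1 + (B E3 E3 - B E2 E2) \<odot> fibre_poly 0 1 0 0"
  define h where "h = - B E2 E3 + (B E2 E2 - B E3 E3) \<odot> fibre_poly 0 0 1 0"
  have mem [simp]: "f \<in> superfunctions 5" "g \<in> superfunctions 5" "h \<in> superfunctions 5"
    by (simp_all add: f_def g_def h_def)
  have z: "B E1 E2 = 0" "B E1 E3 = 0" "B E2 E1 = 0" "B E2 E4 = 0" "B E3 E1 = 0" "B E3 E4 = 0" "B E4 E2 = 0"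
    "B E4 E3 = 0" "B E1 E4 = B E2 E3" "B E3 E2 = scl a (B E4 E1)"
    using compat by (simp_all only: cone_compat_def)
  have tr: "B E4 E4 S x = B E1 E1 S x + B E3 E3 S x - B E2 E2 S x" for S x
  proof -
    have "(B E1 E1 + B E3 E3) S x = (B E2 E2 + B E4 E4) S x"
      using compat by (simp only: cone_compat_def)
    then show ?thesis by (simp add: algebra_simps)
  qed
  have [simp]: "f S0 x = 0" "f (S0 \<union> {3}) x = B E2 E3 S0 x" "f (S0 \<union> {4}) x = B E4 E1 S0 x" "f (S0 \<union> {3, 4}) x = 0"
    "g S0 x = B E4 E1 S0 x" "g (S0 \<union> {3}) x = B E3 E3 S0 x - B E2 E2 S0 x" "g (S0 \<union> {4}) x = 0" "g (S0 \<union> {3, 4}) x = 0"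
    "h S0 x = - B E2 E3 S0 x" "h (S0 \<union> {3}) x = 0" "h (S0 \<union> {4}) x = B E2 E2 S0 x - B E3 E3 S0 x" "h (S0 \<union> {3, 4}) x = 0"
    if "S0 \<subseteq> {..<3}" for S0 x
    using that B by (simp_all add: f_def g_def h_def smult_fibre_poly superfunctions_3_slice del: Un_insert_right)
  have "fibre_action B (W_param a) i j = f \<odot> W_param a i j
      + g \<odot> odd_partial 3 (W_param a i j) + h \<odot> odd_partial 4 (W_param a i j)"
    if "i \<in> neg1" "j \<in> neg1" for i j
    using that unfolding neg1_def insert_iff empty_iff
    by (elim disjE FalseE; hypsubst; intro superfunctions_5_eqI;
        simp add: fibre_action_def sum_neg1 W_param_fibre_poly odd_partial_fibre_poly smult_fibre_poly z
          superfunctions_3_slice[OF B] scl_apply tr algebra_simps del: Un_insert_right)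
  then show ?thesis
    using mem by blast
qed

text \<open>Each condition is a single coefficient in \<nu>, \<theta> of a single matrix entry of
  the tangency equation; \<open>f\<close>, \<open>g\<close>, \<open>h\<close> are eliminated by
  comparing entries of the two blocks.\<close>

lemma tangent_imp_cone_compat:
  assumes B: "\<And>i j. B i j \<in> superfunctions 3" and a: "a \<noteq> 0" "a \<noteq> 1"
    and eq: "\<And>i j. i \<in> neg1 \<Longrightarrow> j \<in> neg1 \<Longrightarrow> fibre_action B (W_param a) i j = f \<odot> W_param a i j
      + g \<odot> odd_partial 3 (W_param a i j) + h \<odot> odd_partial 4 (W_param a i j)"
  shows "cone_compat a B"
proof -
  have eqI: "F = G" if "F \<in> superfunctions 3" "G \<in> superfunctions 3"
    "\<And>S x. S \<subseteq> {..<3} \<Longrightarrow> F S x = G S x" for F G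
    using superfunctionsD(2)[OF that(1)] superfunctionsD(2)[OF that(2)] that(3)
    by (intro ext) (metis zero_fun_apply)
  define n where "n S x = (B E1 E2 S x = 0 \<and> B E1 E3 S x = 0 \<and> B E2 E1 S x = 0 \<and> B E2 E4 S x = 0 \<and>
     B E3 E1 S x = 0 \<and> B E3 E4 S x = 0 \<and> B E4 E2 S x = 0 \<and> B E4 E3 S x = 0 \<and>
     B E1 E4 S x = B E2 E3 S x \<and> B E3 E2 S x = a * B E4 E1 S x \<and>
     B E1 E1 S x + B E3 E3 S x = B E2 E2 S x + B E4 E4 S x)" for S x
  have "n S x" if S: "S \<subseteq> {..<3}" for S x
  proof -
    note simps = fibre_action_def sum_neg1 W_param_fibre_poly odd_partial_fibre_poly smult_fibre_poly[OF S] superfunctions_3_slice[OF B] scl_apply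
    have E: "fibre_action B (W_param a) i j S' x = (f \<odot> W_param a i j
      + g \<odot> odd_partial 3 (W_param a i j) + h \<odot> odd_partial 4 (W_param a i j)) S' x"
      if "i \<in> neg1" "j \<in> neg1" for i j S'
      by (simp only: eq[OF that])
    have f0: "f S x = 0"
      using E[of E1 E1 S] by (simp add: simps del: Un_insert_right)
    have b24: "B E2 E4 S x = 0"
      using E[of E1 E2 "S \<union> {3}"] by (simp add: simps del: Un_insert_right)
    have b31: "B E3 E1 S x = 0"
      using E[of E1 E3 S] by (simp add: simps del: Un_insert_right)
    have b34: "B E3 E4 S x = a * B E2 E1 S x"
      using E[of E1 E3 "S \<union> {3}"] by (simp add: simps mult.commute del: Un_insert_right)
    have b13: "B E1 E3 S x = 0"
      using E[of E3 E1 S] by (simp add: simps del: Un_insert_right)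
    have b42: "B E4 E2 S x = 0"
      using E[of E2 E4 S] by (simp add: simps del: Un_insert_right)
    have b43: "a * B E4 E3 S x = B E1 E2 S x"
      using E[of E2 E4 "S \<union> {3}"] by (simp add: simps mult.commute del: Un_insert_right)
    have b12: "B E1 E2 S x = B E4 E3 S x"
      using E[of E3 E1 "S \<union> {4}"] by (simp add: simps del: Un_insert_right)
    have b21: "B E2 E1 S x = B E3 E4 S x"
      using E[of E4 E2 "S \<union> {4}"] by (simp add: simps del: Un_insert_right)
    have g0: "g S x = B E4 E1 S x"
      using E[of E1 E4 S] by (simp add: simps del: Un_insert_right)
    have g3: "B E4 E4 S x - B E1 E1 S x = g (S \<union> {3}) x"
      using E[of E1 E4 "S \<union> {3}"] by (simp add: simps f0 del: Un_insert_right)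
    have h0: "h S x = - B E1 E4 S x"
      using E[of E4 E1 S] by (simp add: simps del: Un_insert_right)
    have b32: "a * g S x = B E3 E2 S x"
      using E[of E2 E3 S] by (simp add: simps mult.commute del: Un_insert_right)
    have g3': "B E3 E3 S x - B E2 E2 S x = g (S \<union> {3}) x"
      using E[of E2 E3 "S \<union> {3}"] a by (simp add: simps f0 del: Un_insert_right flip: left_diff_distrib)
    have h0': "h S x = - B E2 E3 S x"
      using E[of E3 E2 S] by (simp add: simps del: Un_insert_right)
    \<comment> \<open>\<open>B E1 E2\<close> equals both \<open>B E4 E3\<close> and \<open>a\<close>
      times it, so both vanish for a \<noteq> 1. The same happens to \<open>B E2 E1\<close> and
      \<open>B E3 E4\<close>.\<close>
    have "B E4 E3 S x = 0"
      using b43 b12 a by simp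
    moreover have "B E2 E1 S x = 0"
      using b34 b21 a by simp
    ultimately show ?thesis
      unfolding n_def using b24 b31 b34 b13 b42 b12 b32 g0 h0 h0' g3 g3' by (simp add: algebra_simps)
  qed
  then show ?thesis
    unfolding cone_compat_def n_def using B
    by (intro conjI eqI) (simp_all add: scl_apply)
qed

section \<open>Preservation of the superdistribution\<close>

definition basis_coeffs :: "mix \<Rightarrow> vfield" where
  "basis_coeffs j i = sconst (if i = j then 1 else 0)"

lemma basis_coeffs_smult: "f \<in> superfunctions q \<Longrightarrow> basis_coeffs j i \<odot> f = (if i = j then f else 0)"
  "f \<in> superfunctions q \<Longrightarrow> f \<odot> basis_coeffs j i = (if i = j then f else 0)"
  by (simp_all add: basis_coeffs_def sconst_smult[where q = q] smult_sconst[where q = q])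

lemma basis_coeffs_vfields: "basis_coeffs j \<in> vfields q"
  by (simp add: vfields_def basis_coeffs_def)

lemma vhomog_basis_coeffs: "vhomog (par j) (basis_coeffs j)"
  by (auto simp: vhomog_def basis_coeffs_def)

lemma frame_basis_coeffs: "frame s1 (basis_coeffs j) = left_inv s1 j"
  by (rule ext) (simp add: frame_apply basis_coeffs_smult[where q = 3])

lemma par_01: "par j \<in> {0, 1}"
  by (cases j) simp_all

lemma vbracket_left_inv:
  assumes \<Phi>: "\<Phi> \<in> vfields r" and r: "3 \<le> r" and p: "vhomog p \<Phi>" "p \<in> {0, 1}"
  shows "vbracket (frame s1 \<Phi>) (left_inv s1 j) = frame s1 (\<lambda>k.
    (\<Sum>i\<in>UNIV. scl (m_const s1 i j k) (\<Phi> i)) - scl ((-1) ^ (p * par j)) (Lop s1 j (\<Phi> k)))"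
proof -
  note S [simp] = vfieldsD[OF \<Phi>]
  have "(\<Sum>i\<in>UNIV. \<Phi> i \<odot> Lop s1 i (basis_coeffs j k)) - scl ((-1) ^ (p * par j)) (\<Sum>i\<in>UNIV. basis_coeffs j i \<odot> Lop s1 i (\<Phi> k))
    + (\<Sum>i\<in>UNIV. \<Sum>j'\<in>UNIV. scl (m_const s1 i j' k) (\<Phi> i \<odot> tau (par i) (basis_coeffs j j')))
    = (\<Sum>i\<in>UNIV. scl (m_const s1 i j k) (\<Phi> i)) - scl ((-1) ^ (p * par j)) (Lop s1 j (\<Phi> k))" for k
  proof -
    have "(\<Sum>i\<in>UNIV. \<Phi> i \<odot> Lop s1 i (basis_coeffs j k)) = 0"
      by (simp add: basis_coeffs_def)
    moreover have "(\<Sum>i\<in>UNIV. basis_coeffs j i \<odot> Lop s1 i (\<Phi> k)) = Lop s1 j (\<Phi> k)"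
      using r by (simp add: basis_coeffs_smult[where q = r])
    moreover have "scl (m_const s1 i j' k) (\<Phi> i \<odot> tau (par i) (basis_coeffs j j'))
        = (if j' = j then scl (m_const s1 i j k) (\<Phi> i) else 0)" for i j'
      by (simp add: basis_coeffs_def smult_sconst[where q = r])
    ultimately show ?thesis by simp
  qed
  then show ?thesis
    using vbracket_frame[OF \<Phi> basis_coeffs_vfields r p vhomog_basis_coeffs par_01, of s1 j]
    unfolding frame_basis_coeffs by (simp only:)
qed

lemma D_sections_eq: "D_sections s1 q = frame s1 ` {c \<in> vfields q. c E5 = 0 \<and> c E6 = 0}"
proof -
  have *: "frame s1 c = (\<Sum>i\<in>neg1. c i \<cdot>\<^sub>v left_inv s1 i)" if "c E5 = 0" "c E6 = 0" for c
    by (intro ext) (simp add: frame_apply sum_apply UNIV_mix neg1_def fmult_def that)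
  show ?thesis
  proof (intro equalityI subsetI)
    fix Y assume "Y \<in> D_sections s1 q"
    then obtain c where c: "\<And>i. c i \<in> superfunctions q" "Y = (\<Sum>i\<in>neg1. c i \<cdot>\<^sub>v left_inv s1 i)"
      by (auto simp: D_sections_def)
    let ?c = "\<lambda>i. if i \<in> neg1 then c i else 0"
    have "Y = frame s1 ?c"
      unfolding c(2) by (subst *) (auto intro!: sum.cong)
    moreover have "?c \<in> {c \<in> vfields q. c E5 = 0 \<and> c E6 = 0}"
      using c(1) by (simp add: vfields_def)
    ultimately show "Y \<in> frame s1 ` {c \<in> vfields q. c E5 = 0 \<and> c E6 = 0}"
      by blast
  next
    fix Y assume "Y \<in> frame s1 ` {c \<in> vfields q. c E5 = 0 \<and> c E6 = 0}"
    then show "Y \<in> D_sections s1 q"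
      unfolding D_sections_def using * by (auto simp: vfields_def)
  qed
qed

lemma frame_add: "frame s1 (X + Y) = frame s1 X + frame s1 Y"
  by (rule ext) (simp add: frame_apply smult_add_left sum.distrib)

lemma m_const_neg1: "k \<in> neg1 \<Longrightarrow> m_const s1 i j k = 0"
  by (auto simp: m_const_def neg1_def)

text \<open>The right side says that [X, L_j] has no component along the centre. Testing on the
  frame suffices: bracketing X with c L_j adds only the derivative of c along L_j, which stays in
  \<D>, and, up to sign, c times [X, L_j] modulo \<D>. As c need not be homogeneous, its parity
  components are treated separately.\<close>

lemma preserves_D_iff:
  assumes \<Phi>: "\<Phi> \<in> vfields 3" and p: "vhomog p \<Phi>" "p \<in> {0, 1}"
  shows "preserves_D s1 (frame s1 \<Phi>) \<longleftrightarrow> (\<forall>j\<in>neg1. \<forall>k. k \<notin> neg1 \<longrightarrow>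
    scl ((-1) ^ (p * par j)) (Lop s1 j (\<Phi> k)) = (\<Sum>i\<in>UNIV. scl (m_const s1 i j k) (\<Phi> i)))" (is "_ \<longleftrightarrow> ?R")
proof
  note S [simp] = vfieldsD[OF \<Phi>]
  assume D: "preserves_D s1 (frame s1 \<Phi>)"
  show ?R
  proof (intro ballI allI impI)
    fix j k :: mix assume j: "j \<in> neg1" and k: "k \<notin> neg1"
    let ?Z = "\<lambda>k. (\<Sum>i\<in>UNIV. scl (m_const s1 i j k) (\<Phi> i)) - scl ((-1) ^ (p * par j)) (Lop s1 j (\<Phi> k))"
    have "basis_coeffs j E5 = 0" "basis_coeffs j E6 = 0"
      using j by (auto simp: basis_coeffs_def)
    then have "left_inv s1 j \<in> D_sections s1 3"
      unfolding D_sections_eq using basis_coeffs_vfields[of j 3] frame_basis_coeffs[of s1 j]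
      by (intro image_eqI[where x = "basis_coeffs j"]) auto
    then have "vbracket (frame s1 \<Phi>) (left_inv s1 j) \<in> D_sections s1 3"
      using D by (simp add: preserves_D_def)
    then have "frame s1 ?Z \<in> D_sections s1 3"
      by (simp only: vbracket_left_inv[OF \<Phi> order_refl p])
    then obtain c where c: "c \<in> vfields 3" "c E5 = 0" "c E6 = 0" "frame s1 ?Z = frame s1 c"
      unfolding D_sections_eq by blast
    have "?Z = c"
      by (rule frame_inj[OF _ c(1) c(4)]) (rule vfieldsI, simp)
    then have "?Z k = c k" by (rule fun_cong)
    moreover have "c k = 0"
      using c(2,3) k by (cases k) auto
    ultimately have "?Z k = 0" by (rule trans)
    then show "scl ((-1) ^ (p * par j)) (Lop s1 j (\<Phi> k)) = (\<Sum>i\<in>UNIV. scl (m_const s1 i j k) (\<Phi> i))"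
      unfolding right_minus_eq by (rule sym)
  qed
next
  note S [simp] = vfieldsD[OF \<Phi>]
  assume R: ?R
  show "preserves_D s1 (frame s1 \<Phi>)"
    unfolding preserves_D_def
  proof
    fix Y assume "Y \<in> D_sections s1 3"
    then obtain c where c: "c \<in> vfields 3" "c E5 = 0" "c E6 = 0" and Y: "Y = frame s1 c"
      unfolding D_sections_eq by blast
    note C [simp] = vfieldsD[OF c(1)]
    define Z where "Z q k = (\<Sum>i\<in>UNIV. \<Phi> i \<odot> Lop s1 i (vpart q c k))
      - scl ((-1) ^ (p * q)) (\<Sum>i\<in>UNIV. vpart q c i \<odot> Lop s1 i (\<Phi> k))
      + (\<Sum>i\<in>UNIV. \<Sum>j\<in>UNIV. scl (m_const s1 i j k) (\<Phi> i \<odot> tau (par i) (vpart q c j)))" for q k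
    have br: "vbracket (frame s1 \<Phi>) (frame s1 (vpart q c)) = frame s1 (Z q)" if "q \<in> {0, 1}" for q
      unfolding Z_def by (rule vbracket_frame[OF \<Phi> vpart_vfields[OF c(1)] order_refl p vhomog_vpart that])
    have Z0: "Z q k = 0" if k: "k \<notin> neg1" for q k
    proof -
      have c0: "vpart q c i = 0" if "i \<notin> neg1" for i
        using that c by (cases i) (auto simp: vpart_def fun_eq_iff)
      have "scl ((-1) ^ (p * q)) (vpart q c j \<odot> Lop s1 j (\<Phi> k)) =
          (\<Sum>i\<in>UNIV. scl (m_const s1 i j k) (\<Phi> i \<odot> tau (par i) (vpart q c j)))" for j
      proof (cases "j \<in> neg1")
        case True
        have h: "homog (q + par j) (vpart q c j)"
          by (rule vhomogD[OF vhomog_vpart])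
        have hL: "homog (p + par k + par j) (Lop s1 j (\<Phi> k))"
          by (rule homog_Lop[OF vhomogD[OF p(1)] S(1)])
        have 1: "vpart q c j \<odot> Lop s1 j (\<Phi> k) = scl ((-1) ^ ((q + par j) * (p + par k + par j))) (Lop s1 j (\<Phi> k) \<odot> vpart q c j)"
          using smult_homog_commute[OF h, of "Lop s1 j (\<Phi> k)"] by (simp add: tau_homog[OF hL])
        have R': "scl ((-1) ^ (p * par j)) (Lop s1 j (\<Phi> k)) = (\<Sum>i\<in>UNIV. scl (m_const s1 i j k) (\<Phi> i))"
          using R True k by blast
        have 2: "Lop s1 j (\<Phi> k) = scl ((-1) ^ (p * par j)) (\<Sum>i\<in>UNIV. scl (m_const s1 i j k) (\<Phi> i))"
          unfolding R'[symmetric] by (simp flip: power_add mult_2)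
        have "scl ((-1) ^ (p * q)) (vpart q c j \<odot> Lop s1 j (\<Phi> k)) =
          (\<Sum>i\<in>UNIV. scl ((-1) ^ (p * q) * ((-1) ^ ((q + par j) * (p + par k + par j)) * ((-1) ^ (p * par j) * m_const s1 i j k)))
            (\<Phi> i \<odot> vpart q c j))"
          unfolding 1 unfolding 2 by (simp add: scl_sum_right smult_sum_left mult.assoc)
        also have "\<dots> = (\<Sum>i\<in>UNIV. scl (m_const s1 i j k) (\<Phi> i \<odot> tau (par i) (vpart q c j)))"
        proof (rule sum.cong)
          fix i
          have "(-1) ^ (p * q) * ((-1) ^ ((q + par j) * (p + par k + par j)) * ((-1) ^ (p * par j) * m_const s1 i j k))
            = m_const s1 i j k * (-1) ^ (par i * (q + par j))"
            using m_const_parity[of s1 i j k] by (cases "m_const s1 i j k = 0") (auto simp: minus_one_power_iff)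
          then show "scl ((-1) ^ (p * q) * ((-1) ^ ((q + par j) * (p + par k + par j)) * ((-1) ^ (p * par j) * m_const s1 i j k)))
            (\<Phi> i \<odot> vpart q c j) = scl (m_const s1 i j k) (\<Phi> i \<odot> tau (par i) (vpart q c j))"
            unfolding tau_homog[OF h] smult_scl scl_simps by (simp only:)
        qed simp
        finally show ?thesis .
      qed (simp add: c0)
      then have "scl ((-1) ^ (p * q)) (\<Sum>j\<in>UNIV. vpart q c j \<odot> Lop s1 j (\<Phi> k))
        = (\<Sum>i\<in>UNIV. \<Sum>j\<in>UNIV. scl (m_const s1 i j k) (\<Phi> i \<odot> tau (par i) (vpart q c j)))"
        unfolding scl_sum_right by (subst sum.swap) simp
      moreover have "(\<Sum>i\<in>UNIV. \<Phi> i \<odot> Lop s1 i (vpart q c k)) = 0"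
        by (simp add: c0[OF k])
      ultimately show ?thesis
        by (simp add: Z_def)
    qed
    have Zm: "Z q \<in> vfields 3" for q
      unfolding Z_def by (rule vfieldsI) simp
    have Xf: "frame s1 \<Phi> \<in> vfields 3" and Yf: "Y \<in> vfields 3"
      using frame_vfields[OF order_refl] \<Phi> c(1) by (auto simp: Y)
    have hX: "vhomog p (frame s1 \<Phi>)"
      by (rule vhomog_frame[OF p(1)])
    have partY: "vpart q Y = frame s1 (vpart q c)" if "q \<in> {0, 1}" for q
    proof -
      have "Y = frame s1 (vpart 0 c) + frame s1 (vpart 1 c)"
        unfolding Y by (simp only: vpart_sum flip: frame_add)
      then have "vpart q Y = vpart q (frame s1 (vpart 0 c)) + vpart q (frame s1 (vpart 1 c))"
        by (simp only: vpart_add)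
      then show ?thesis
        using that by (auto simp: vpart_vhomog[OF vhomog_frame[OF vhomog_vpart]])
    qed
    have "vbracket (frame s1 \<Phi>) Y = frame s1 (Z 0) + frame s1 (Z 1)"
    proof -
      have zero: "vbracket 0 V = 0" for V
      proof -
        have "vpart q 0 = 0" for q
          by (auto simp: vpart_def fun_eq_iff)
        then show ?thesis
          by (intro ext[where ?'a = mix]) (simp add: vbracket_def)
      qed
      have "vbracket (frame s1 \<Phi>) Y = (\<Sum>q\<in>{0, 1}. vbracket (frame s1 \<Phi>) (vpart q Y))"
        unfolding vbracket_vpart_expand[OF Xf Yf order_refl]
        using p(2) by (auto simp: vpart_vhomog[OF hX] zero)
      then show ?thesis
        using br partY by simp
    qed
    also have "\<dots> = frame s1 (Z 0 + Z 1)"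
      by (rule frame_add[symmetric])
    also have "\<dots> \<in> D_sections s1 3"
      unfolding D_sections_eq
    proof (intro imageI CollectI conjI)
      show "Z 0 + Z 1 \<in> vfields 3"
        by (rule vfieldsI) (simp only: plus_fun_apply superfunctions_add vfieldsD[OF Zm])
    qed (simp_all only: plus_fun_apply Z0 neg1_simps add_0 not_False_eq_True)
    finally show "vbracket (frame s1 \<Phi>) Y \<in> D_sections s1 3" .
  qed
qed

section \<open>The natural lift along the cone\<close>

lemma partial_fibre_poly: "partial k (fibre_poly c0 c3 c4 c34) = 0"
proof -
  have "odd_partial n (fibre_poly c0 c3 c4 c34) = 0" if "n < 3" for n
  proof -
    have "fibre_poly c0 c3 c4 c34 (insert n S) = 0" for S
      by (rule fibre_poly_outside) (use that in auto)
    then show ?thesis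
      by (simp add: odd_partial_def fun_eq_iff)
  qed
  moreover have "even_partial i (fibre_poly c0 c3 c4 c34) = 0" for i
    by (simp add: fun_eq_iff even_partial_eq_pderiv3 fibre_poly_def)
  ultimately show ?thesis
    by (cases k) simp_all
qed

lemma W_param_superfunctions: "i \<in> neg1 \<Longrightarrow> j \<in> neg1 \<Longrightarrow> W_param a i j \<in> superfunctions 5"
  unfolding neg1_def by (elim insertE emptyE; simp add: W_param_fibre_poly)

lemma partial_W_param: "i \<in> neg1 \<Longrightarrow> j \<in> neg1 \<Longrightarrow> partial k (W_param a i j) = 0"
  unfolding neg1_def by (elim insertE emptyE; simp add: W_param_fibre_poly partial_fibre_poly)

lemma homog_fibre_poly: "homog 0 (fibre_poly c0 0 0 c34)" "homog (Suc 0) (fibre_poly 0 c3 c4 0)" "homog 2 (fibre_poly c0 0 0 c34)"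
  by (auto simp: homog_def fibre_poly_def fun_eq_iff)

lemma homog_W_param: "i \<in> neg1 \<Longrightarrow> j \<in> neg1 \<Longrightarrow> homog (par i + par j) (W_param a i j)"
  unfolding neg1_def by (elim insertE emptyE; simp add: W_param_fibre_poly homog_fibre_poly numeral_2_eq_2[symmetric])

lemma Lop_W_param: "i \<in> neg1 \<Longrightarrow> j \<in> neg1 \<Longrightarrow> Lop s1 k (W_param a i j) = 0"
  by (simp add: Lop_def vapply_def partial_W_param)

lemma end_apply_neg1:
  assumes "Y \<in> vfields 5" "i \<in> neg1"
  shows "end_apply s1 (W_param a) Y i = (\<Sum>j\<in>neg1. Y j \<odot> W_param a i j)"
proof -
  have "(\<Sum>i'\<in>neg1. W_param a i' j \<odot> left_inv s1 i' i) = W_param a i j" if j: "j \<in> neg1" for j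
  proof -
    have "(\<Sum>i'\<in>neg1. W_param a i' j \<odot> left_inv s1 i' i) = (\<Sum>i'\<in>neg1. if i' = i then W_param a i j else 0)"
      using assms j by (intro sum.cong) (auto simp: left_inv_neg1 smult_sconst[where q = 5] W_param_superfunctions)
    then show ?thesis
      using assms(2) by (simp add: neg1_def)
  qed
  then show ?thesis
    by (simp add: end_apply_def sum_apply fmult_def)
qed

lemma end_apply_left_inv:
  assumes j: "j \<in> neg1"
  shows "end_apply s1 (W_param a) (left_inv s1 j) = frame s1 (\<lambda>i. if i \<in> neg1 then W_param a i j else 0)"
proof
  fix k
  let ?V = "\<lambda>j k. \<Sum>i\<in>neg1. W_param a i j \<odot> left_inv s1 i k"
  have "end_apply s1 (W_param a) (left_inv s1 j) k = (\<Sum>j'\<in>neg1. left_inv s1 j j' \<odot> ?V j' k)"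
    by (simp add: end_apply_def sum_apply fmult_def)
  also have "\<dots> = (\<Sum>j'\<in>neg1. if j' = j then ?V j k else 0)"
  proof (rule sum.cong)
    fix j' assume j': "j' \<in> neg1"
    have "?V j' k \<in> superfunctions 5"
      using j' by (simp add: W_param_superfunctions)
    then show "left_inv s1 j j' \<odot> ?V j' k = (if j' = j then ?V j k else 0)"
      by (simp add: left_inv_neg1[OF j'] sconst_smult[where q = 5])
  qed simp
  also have "\<dots> = ?V j k"
    using j by (simp add: neg1_def)
  also have "\<dots> = frame s1 (\<lambda>i. if i \<in> neg1 then W_param a i j else 0) k"
    by (simp add: frame_apply UNIV_mix sum_neg1 add.assoc)
  finally show "end_apply s1 (W_param a) (left_inv s1 j) k = frame s1 (\<lambda>i. if i \<in> neg1 then W_param a i j else 0) k" .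
qed

text \<open>The matrix of \<open>Y \<mapsto> [X, Y]\<close> on the frame of \<open>\<D>\<close>, for \<open>X = \<Sum>\<^sub>i \<Phi> i L\<^sub>i\<close> of parity \<open>p\<close>.\<close>

definition ad_matrix :: "complex \<Rightarrow> nat \<Rightarrow> vfield \<Rightarrow> mix \<Rightarrow> mix \<Rightarrow> sfun" where
  "ad_matrix s1 p \<Phi> j k = - scl ((-1) ^ (p * par j)) (Lop s1 j (\<Phi> k))"

text \<open>The parametrized point has constant coefficients along M in the left-invariant frame, so
  X differentiates none of them, and the structure constants of \<mm> contribute only along the
  centre. What remains is the commutator with the matrix of [X, -] on the frame; reordering factors
  produces the Koszul signs.\<close>

lemma lift_vertical_eq:
  assumes \<Phi>: "\<Phi> \<in> vfields 3" and p: "vhomog p \<Phi>" "p \<in> {0, 1}" and i: "i \<in> neg1" and j: "j \<in> neg1"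
  shows "lift_vertical s1 (frame s1 \<Phi>) (W_param a) i j = fibre_action (ad_matrix s1 p \<Phi>) (W_param a) i j"
proof -
  note S [simp] = vfieldsD[OF \<Phi>]
  note S5 [simp] = superfunctions_mono[OF S, of 5, simplified]
  have \<Phi>5: "\<Phi> \<in> vfields 5" by (simp add: vfields_def)
  define y where "y = (\<lambda>i. if i \<in> neg1 then W_param a i j else 0)"
  have yv: "y \<in> vfields 5" and yh: "vhomog (par j) y"
    using j homog_W_param[of _ j a] by (auto simp: y_def vfields_def vhomog_def W_param_superfunctions add.commute)
  have "vbracket (frame s1 \<Phi>) (frame s1 y) i = - scl ((-1) ^ (p * par j)) (\<Sum>k\<in>neg1. W_param a k j \<odot> Lop s1 k (\<Phi> i))"
  proof -
    let ?Z = "\<lambda>k. (\<Sum>i\<in>UNIV. \<Phi> i \<odot> Lop s1 i (y k)) - scl ((-1) ^ (p * par j)) (\<Sum>i\<in>UNIV. y i \<odot> Lop s1 i (\<Phi> k))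
      + (\<Sum>i\<in>UNIV. \<Sum>j\<in>UNIV. scl (m_const s1 i j k) (\<Phi> i \<odot> tau (par i) (y j)))"
    have "?Z \<in> vfields 5"
      by (rule vfieldsI) (simp add: vfieldsD[OF yv])
    then have "frame s1 ?Z i = ?Z i"
      by (rule frame_neg1[OF _ i])
    moreover have "vbracket (frame s1 \<Phi>) (frame s1 y) = frame s1 ?Z"
      by (rule vbracket_frame[OF \<Phi>5 yv _ p yh par_01]) simp
    ultimately have "vbracket (frame s1 \<Phi>) (frame s1 y) i = ?Z i"
      by (simp only:)
    also have "\<dots> = - scl ((-1) ^ (p * par j)) (\<Sum>i'\<in>UNIV. y i' \<odot> Lop s1 i' (\<Phi> i))"
      using i j by (simp add: m_const_neg1 y_def Lop_W_param)
    also have "(\<Sum>i'\<in>UNIV. y i' \<odot> Lop s1 i' (\<Phi> i)) = (\<Sum>k\<in>neg1. W_param a k j \<odot> Lop s1 k (\<Phi> i))"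
      by (simp add: UNIV_mix sum_neg1 y_def add.assoc)
    finally show ?thesis .
  qed
  moreover have "end_apply s1 (W_param a) (vbracket (frame s1 \<Phi>) (left_inv s1 j)) i
    = (\<Sum>k\<in>neg1. ad_matrix s1 p \<Phi> j k \<odot> W_param a i k)"
  proof -
    let ?Z = "\<lambda>k. (\<Sum>i\<in>UNIV. scl (m_const s1 i j k) (\<Phi> i)) - scl ((-1) ^ (p * par j)) (Lop s1 j (\<Phi> k))"
    have Z: "?Z \<in> vfields 5" by (rule vfieldsI) simp
    have br: "vbracket (frame s1 \<Phi>) (left_inv s1 j) = frame s1 ?Z"
      by (rule vbracket_left_inv[OF \<Phi>5 _ p]) simp
    have "end_apply s1 (W_param a) (vbracket (frame s1 \<Phi>) (left_inv s1 j)) i = (\<Sum>k\<in>neg1. frame s1 ?Z k \<odot> W_param a i k)"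
      unfolding br by (rule end_apply_neg1[OF frame_vfields[OF _ Z] i]) simp
    also have "\<dots> = (\<Sum>k\<in>neg1. ad_matrix s1 p \<Phi> j k \<odot> W_param a i k)"
      by (rule sum.cong) (simp_all add: frame_neg1[OF Z] m_const_neg1 ad_matrix_def)
    finally show ?thesis .
  qed
  ultimately have "lift_vertical s1 (frame s1 \<Phi>) (W_param a) i j =
    scl ((-1) ^ (p * par j)) (\<Sum>k\<in>neg1. W_param a k j \<odot> Lop s1 k (\<Phi> i))
    + (\<Sum>k\<in>neg1. ad_matrix s1 p \<Phi> j k \<odot> W_param a i k)"
    unfolding lift_vertical_def end_apply_left_inv[OF j] y_def[symmetric] by simp
  also have "scl ((-1) ^ (p * par j)) (\<Sum>k\<in>neg1. W_param a k j \<odot> Lop s1 k (\<Phi> i))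
    = (\<Sum>k\<in>neg1. - scl ((-1) ^ ((par k + par j) * (par i + par k))) (ad_matrix s1 p \<Phi> k i \<odot> W_param a k j))"
    unfolding scl_sum_right
  proof (rule sum.cong)
    fix k assume k: "k \<in> neg1"
    have hL: "homog (p + par i + par k) (Lop s1 k (\<Phi> i))"
      by (rule homog_Lop[OF vhomogD[OF p(1)] S])
    have "W_param a k j \<odot> Lop s1 k (\<Phi> i) = scl ((-1) ^ ((par k + par j) * (p + par i + par k))) (Lop s1 k (\<Phi> i) \<odot> W_param a k j)"
      using smult_homog_commute[OF homog_W_param[OF k j, of a], of "Lop s1 k (\<Phi> i)"] by (simp add: tau_homog[OF hL])
    moreover have "(-1 :: complex) ^ (p * par j) * (-1) ^ ((par k + par j) * (p + par i + par k))
      = (-1) ^ ((par k + par j) * (par i + par k)) * (-1) ^ (p * par k)"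
      unfolding power_add[symmetric] by (rule minus_one_power_cong) auto
    ultimately show "scl ((-1) ^ (p * par j)) (W_param a k j \<odot> Lop s1 k (\<Phi> i))
      = - scl ((-1) ^ ((par k + par j) * (par i + par k))) (ad_matrix s1 p \<Phi> k i \<odot> W_param a k j)"
      by (simp add: ad_matrix_def)
  qed simp
  finally show ?thesis
    unfolding fibre_action_def sum_subtractf sum_negf uminus_add_conv_diff .
qed

section \<open>From symmetries to flat sections and back, for homogeneous fields\<close>

lemma lift_tangent_iff:
  assumes a: "a \<noteq> 0" "a \<noteq> 1" and \<Phi>: "\<Phi> \<in> vfields 3" and p: "vhomog p \<Phi>" "p \<in> {0, 1}"
  shows "lift_tangent_to_W a s1 (frame s1 \<Phi>) \<longleftrightarrow> cone_compat a (ad_matrix s1 p \<Phi>)"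
proof -
  have B: "ad_matrix s1 p \<Phi> i j \<in> superfunctions 3" for i j
    by (simp add: ad_matrix_def vfieldsD[OF \<Phi>])
  show ?thesis
  proof
    assume "lift_tangent_to_W a s1 (frame s1 \<Phi>)"
    then obtain f g h where "\<forall>i\<in>neg1. \<forall>j\<in>neg1. lift_vertical s1 (frame s1 \<Phi>) (W_param a) i j =
            f \<odot> W_param a i j + g \<odot> odd_partial 3 (W_param a i j) + h \<odot> odd_partial 4 (W_param a i j)"
      unfolding lift_tangent_to_W_def by blast
    then show "cone_compat a (ad_matrix s1 p \<Phi>)"
      by (intro tangent_imp_cone_compat[OF B a, where f = f and g = g and h = h]) (simp only: lift_vertical_eq[OF \<Phi> p, symmetric])
  next
    assume "cone_compat a (ad_matrix s1 p \<Phi>)"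
    from cone_compat_imp_tangent[OF B this]
    show "lift_tangent_to_W a s1 (frame s1 \<Phi>)"
      unfolding lift_tangent_to_W_def using lift_vertical_eq[OF \<Phi> p, of _ _ s1 a] by simp
  qed
qed

text \<open>The flatness equations for the components along e_5 and e_6 give preservation of \<D>.
  Those along e_1, ..., e_4 express the derivatives of the coefficients by components of degree 0,
  and these satisfy the linear equations of the cone. Homogeneity turns \<open>tau\<close> into a
  scalar sign.\<close>

lemma flat_imp_symmetry:
  assumes flat: "flat a \<Phi>" and p: "\<And>l. homog (p + gpar l) (\<Phi> l)" "p \<in> {0, 1}" and a: "a \<noteq> 0" "a \<noteq> 1"
    and s1: "s1 = - 1 - a"
  shows "preserves_D s1 (frame s1 (\<Phi> \<circ> idx))" "lift_tangent_to_W a s1 (frame s1 (\<Phi> \<circ> idx))"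
proof -
  have v: "\<Phi> \<circ> idx \<in> vfields 3"
    by (simp add: vfields_def flat_superfunctions[OF flat])
  have idx_par: "gpar (idx i) = par i" for i
    by (cases i) (simp_all add: gpar_def)
  have h: "vhomog p (\<Phi> \<circ> idx)"
    using p(1)[of "idx _"] by (simp add: vhomog_def idx_par)
  note F = flat_Lop[OF flat, folded s1]
  have T: "tau (Suc 0) (\<Phi> l) = scl ((-1) ^ (p + gpar l)) (\<Phi> l)" for l
    by (simp add: tau_homog[OF p(1)])
  show "preserves_D s1 (frame s1 (\<Phi> \<circ> idx))"
    unfolding preserves_D_iff[OF v h p(2)]
  proof (intro ballI allI impI)
    fix j k :: mix assume "j \<in> neg1" "k \<notin> neg1"
    then have "j = E1 \<or> j = E2 \<or> j = E3 \<or> j = E4" and "k = E5 \<or> k = E6"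
      by (simp add: neg1_def) (use \<open>k \<notin> neg1\<close> in \<open>cases k; simp\<close>)
    then show "scl ((-1) ^ (p * par j)) (Lop s1 j ((\<Phi> \<circ> idx) k)) = (\<Sum>i\<in>UNIV. scl (m_const s1 i j k) ((\<Phi> \<circ> idx) i))"
      using p(2) by (elim disjE) (auto simp: F sum_gix T UNIV_mix m_const_def gpar_def)
  qed
  show "lift_tangent_to_W a s1 (frame s1 (\<Phi> \<circ> idx))"
    unfolding lift_tangent_iff[OF a v h p(2)] cone_compat_def ad_matrix_def
    using p(2) by (elim insertE emptyE) (simp_all add: F sum_gix T gpar_def fun_eq_iff scl_apply algebra_simps)
qed

text \<open>For a homogeneous field the scalar signs in \<open>preserves_D_iff\<close> and
  \<open>ad_matrix\<close> can be rewritten as \<open>tau\<close>, which puts the two symmetry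
  conditions into the form of the hypotheses of \<open>prolongation\<close>.\<close>

lemma symmetry_imp_flat:
  assumes X: "X \<in> vfields 3" and p: "vhomog p X" "p \<in> {0, 1}" and a: "a \<noteq> 0" "a \<noteq> 1" and s1: "s1 = - 1 - a"
    and D: "preserves_D s1 X" and T: "lift_tangent_to_W a s1 X"
  obtains \<Phi> where "flat a \<Phi>" "X = frame s1 (\<Phi> \<circ> idx)"
proof -
  define F where "F = unframe s1 X"
  have FX: "frame s1 F = X"
    unfolding F_def by (rule frame_unframe[OF order_refl X])
  have v: "F \<in> vfields 3" and h: "vhomog p F"
    unfolding F_def by (rule unframe_vfields[OF order_refl X], rule vhomog_unframe[OF p(1)])
  note S = vfieldsD[OF v]
  have D': "scl ((-1) ^ (p * par j)) (Lop s1 j (F k)) = (\<Sum>i\<in>UNIV. scl (m_const s1 i j k) (F i))"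
    if "j \<in> neg1" "k \<notin> neg1" for j k
    using D[folded FX] preserves_D_iff[OF v h p(2)] that by blast
  have D'': "Lop s1 j (F k) = scl ((-1) ^ (p * par j)) (\<Sum>i\<in>UNIV. scl (m_const s1 i j k) (F i))"
    if "j \<in> neg1" "k \<notin> neg1" for j k
    unfolding D'[OF that, symmetric] by (simp flip: power_add mult_2)
  have C: "cone_compat a (ad_matrix s1 p F)"
    using T[folded FX] lift_tangent_iff[OF a v h p(2)] by blast
  have sgn: "scl ((-1) ^ n) f = 0 \<longleftrightarrow> f = 0" "scl (- 1) f = 0 \<longleftrightarrow> f = 0" for n f
    by (simp_all add: scl_eq_0_iff)
  have \<sigma>: "tau (Suc 0) (F i) = scl ((-1) ^ (p + par i)) (F i)" for i
    by (simp add: tau_homog[OF vhomogD[OF h]])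
  have \<sigma>L: "tau (Suc 0) (Lop s1 j (F i)) = scl ((-1) ^ (p + par i + par j)) (Lop s1 j (F i))" for i j
    using tau_homog[OF homog_Lop[OF vhomogD[OF h] S]] by simp
  have C0: "Lop s1 E1 (F E2) = 0" "Lop s1 E1 (F E3) = 0" "Lop s1 E2 (F E1) = 0" "Lop s1 E2 (F E4) = 0"
      "Lop s1 E3 (F E1) = 0" "Lop s1 E3 (F E4) = 0" "Lop s1 E4 (F E2) = 0" "Lop s1 E4 (F E3) = 0"
    using C by (simp_all add: cone_compat_def ad_matrix_def sgn)
  have Ce: "Lop s1 E1 (F E4) = Lop s1 E2 (F E3)"
    and Co: "Lop s1 E3 (F E2) = scl a (Lop s1 E4 (F E1))"
    and Ct: "Lop s1 E1 (F E1) + tau (Suc 0) (Lop s1 E3 (F E3)) = Lop s1 E2 (F E2) + tau (Suc 0) (Lop s1 E4 (F E4))"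
  proof -
    have Ce: "ad_matrix s1 p F E1 E4 = ad_matrix s1 p F E2 E3"
      and Co: "ad_matrix s1 p F E3 E2 = scl a (ad_matrix s1 p F E4 E1)"
      and Ct: "ad_matrix s1 p F E1 E1 + ad_matrix s1 p F E3 E3 = ad_matrix s1 p F E2 E2 + ad_matrix s1 p F E4 E4"
      using C by (simp_all only: cone_compat_def)
    show "Lop s1 E1 (F E4) = Lop s1 E2 (F E3)"
      using Ce by (simp add: ad_matrix_def)
    have "- scl ((-1) ^ p) (Lop s1 E3 (F E2)) = - scl ((-1) ^ p) (scl a (Lop s1 E4 (F E1)))"
      using Co by (simp add: ad_matrix_def mult.commute)
    then show "Lop s1 E3 (F E2) = scl a (Lop s1 E4 (F E1))"
      by (simp add: fun_eq_iff scl_apply)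
    show "Lop s1 E1 (F E1) + tau (Suc 0) (Lop s1 E3 (F E3)) = Lop s1 E2 (F E2) + tau (Suc 0) (Lop s1 E4 (F E4))"
      using Ct unfolding ad_matrix_def \<sigma>L by (simp add: fun_eq_iff scl_apply algebra_simps)
  qed
  obtain \<Phi> where \<Phi>: "flat a \<Phi>" "\<And>i. \<Phi> (idx i) = F i"
  proof (rule prolongation[of F, OF S a(1) s1])
    show "Lop s1 E1 (F E5) = 0" "Lop s1 E2 (F E5) = 0" "Lop s1 E1 (F E6) = - F E3" "Lop s1 E2 (F E6) = - F E4"
      by (simp_all add: D'' UNIV_mix m_const_def)
    show "Lop s1 E3 (F E5) = - scl s1 (tau (Suc 0) (F E4))" "Lop s1 E4 (F E5) = - scl s1 (tau (Suc 0) (F E3))"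
      "Lop s1 E3 (F E6) = tau (Suc 0) (F E1)" "Lop s1 E4 (F E6) = tau (Suc 0) (F E2)"
      by (simp_all add: D'' UNIV_mix m_const_def \<sigma> mult.commute)
  qed (use C0 Ce Co Ct in blast)+
  have "X = frame s1 (\<Phi> \<circ> idx)"
    unfolding FX[symmetric] using \<Phi>(2) by (simp add: comp_def)
  with \<Phi>(1) show thesis by (rule that)
qed


section \<open>Explicit flat sections\<close>

lemma holomorphic3_uminus: "holomorphic3 f \<Longrightarrow> holomorphic3 (\<lambda>x. - f x)"
  using holomorphic3_cmult[of f "-1"] by simp

lemma holomorphic3_diff: "holomorphic3 f \<Longrightarrow> holomorphic3 g \<Longrightarrow> holomorphic3 (\<lambda>x. f x - g x)"
  using holomorphic3_add[of f "\<lambda>x. - g x"] holomorphic3_uminus by simp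

lemma holomorphic3_divide: "holomorphic3 f \<Longrightarrow> holomorphic3 (\<lambda>x. f x / c)"
  using holomorphic3_cmult[of f "inverse c"] by (simp add: divide_inverse mult.commute)

lemmas holomorphic3_poly = holomorphic3_add holomorphic3_mult holomorphic3_uminus holomorphic3_diff holomorphic3_divide

lemma pderiv3_uminus: "holomorphic3 f \<Longrightarrow> pderiv3 i (\<lambda>x. - f x) x = - pderiv3 i f x"
  using pderiv3_cmult[of f i "-1" x] by simp

lemma pderiv3_diff: "holomorphic3 f \<Longrightarrow> holomorphic3 g \<Longrightarrow>
    pderiv3 i (\<lambda>x. f x - g x) x = pderiv3 i f x - pderiv3 i g x"
  using pderiv3_add[of f "\<lambda>x. - g x" i x] holomorphic3_uminus[of g] pderiv3_uminus[of g i x] by simp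

lemma pderiv3_divide: "holomorphic3 f \<Longrightarrow> pderiv3 i (\<lambda>x. f x / c) x = pderiv3 i f x / c"
  using pderiv3_cmult[of f i "inverse c" x] by (simp add: divide_inverse mult.commute)

lemmas pderiv3_poly = pderiv3_add pderiv3_mult pderiv3_uminus pderiv3_diff pderiv3_divide holomorphic3_poly

text \<open>The superfunction with coefficients \<open>f0, \<dots>, f7\<close> along
  \<open>1, \<theta>\<^sub>0, \<theta>\<^sub>1, \<theta>\<^sub>2, \<theta>\<^sub>0\<theta>\<^sub>1, \<theta>\<^sub>0\<theta>\<^sub>2, \<theta>\<^sub>1\<theta>\<^sub>2, \<theta>\<^sub>0\<theta>\<^sub>1\<theta>\<^sub>2\<close>.\<close>

definition gr :: "(complex^3 \<Rightarrow> complex) \<Rightarrow> (complex^3 \<Rightarrow> complex) \<Rightarrow> (complex^3 \<Rightarrow> complex) \<Rightarrow> (complex^3 \<Rightarrow> complex)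
    \<Rightarrow> (complex^3 \<Rightarrow> complex) \<Rightarrow> (complex^3 \<Rightarrow> complex) \<Rightarrow> (complex^3 \<Rightarrow> complex) \<Rightarrow> (complex^3 \<Rightarrow> complex) \<Rightarrow> sfun" where
  "gr f0 f1 f2 f3 f4 f5 f6 f7 = (\<lambda>S. if S = {} then f0 else if S = {0} then f1 else if S = {1} then f2
     else if S = {2} then f3 else if S = {0, 1} then f4 else if S = {0, 2} then f5 else if S = {1, 2} then f6
     else if S = {0, 1, 2} then f7 else 0)"

lemma subset_3: "S \<subseteq> {..<3} \<longleftrightarrow> S = {} \<or> S = {0} \<or> S = {1} \<or> S = {2} \<or> S = {0, 1} \<or> S = {0, 2} \<or> S = {1, 2} \<or> S = {0, 1, 2 :: nat}"
proof
  assume "S \<subseteq> {..<3}"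
  then have S: "n = 0 \<or> n = 1 \<or> n = 2" if "n \<in> S" for n
    using that by force
  have "S = S \<inter> {0} \<union> S \<inter> {1} \<union> S \<inter> {2}"
    using S by blast
  moreover have "S \<inter> {n} = {} \<or> S \<inter> {n} = {n}" for n by blast
  ultimately obtain A B C where "S = A \<union> B \<union> C" "A = {} \<or> A = {0}" "B = {} \<or> B = {1}" "C = {} \<or> C = {2}"
    by blast
  then show "S = {} \<or> S = {0} \<or> S = {1} \<or> S = {2} \<or> S = {0, 1} \<or> S = {0, 2} \<or> S = {1, 2} \<or> S = {0, 1, 2}"
    by (elim disjE; hypsubst; simp only: Un_empty_left Un_empty_right Un_insert_left simp_thms)
qed auto

lemma set_neq_3: "{0 :: nat} \<noteq> {1}" "{0 :: nat} \<noteq> {2}" "{1 :: nat} \<noteq> {0}" "{1 :: nat} \<noteq> {2}" "{2 :: nat} \<noteq> {0}" "{2 :: nat} \<noteq> {1}"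
  "{0, 1} \<noteq> {0 :: nat}" "{0, 1} \<noteq> {1 :: nat}" "{0, 1} \<noteq> {2 :: nat}"
  "{0, 2} \<noteq> {0 :: nat}" "{0, 2} \<noteq> {1 :: nat}" "{0, 2} \<noteq> {2 :: nat}" "{0, 2} \<noteq> {0, 1 :: nat}"
  "{1, 2} \<noteq> {0 :: nat}" "{1, 2} \<noteq> {1 :: nat}" "{1, 2} \<noteq> {2 :: nat}" "{1, 2} \<noteq> {0, 1 :: nat}" "{1, 2} \<noteq> {0, 2 :: nat}"
  "{0, 1, 2} \<noteq> {0 :: nat}" "{0, 1, 2} \<noteq> {1 :: nat}" "{0, 1, 2} \<noteq> {2 :: nat}" "{0, 1, 2} \<noteq> {0, 1 :: nat}"
  "{0, 1, 2} \<noteq> {0, 2 :: nat}" "{0, 1, 2} \<noteq> {1, 2 :: nat}"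
  by (rule notI, drule equalityD1, simp)+

lemma gr_apply: "gr f0 f1 f2 f3 f4 f5 f6 f7 {} = f0" "gr f0 f1 f2 f3 f4 f5 f6 f7 {0} = f1" "gr f0 f1 f2 f3 f4 f5 f6 f7 {1} = f2" "gr f0 f1 f2 f3 f4 f5 f6 f7 {2} = f3"
  "gr f0 f1 f2 f3 f4 f5 f6 f7 {0, 1} = f4" "gr f0 f1 f2 f3 f4 f5 f6 f7 {0, 2} = f5" "gr f0 f1 f2 f3 f4 f5 f6 f7 {1, 2} = f6" "gr f0 f1 f2 f3 f4 f5 f6 f7 {0, 1, 2} = f7"
  unfolding gr_def by (simp_all only: set_neq_3 insert_not_empty if_True if_False refl)

lemma gr_outside: "\<not> S \<subseteq> {..<3} \<Longrightarrow> gr f0 f1 f2 f3 f4 f5 f6 f7 S = 0"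
  unfolding subset_3 gr_def by simp

lemma eq_grI:
  assumes "\<And>S. \<not> S \<subseteq> {..<3} \<Longrightarrow> f S = 0"
    and "f {} = f0" "f {0} = f1" "f {1} = f2" "f {2} = f3" "f {0, 1} = f4" "f {0, 2} = f5" "f {1, 2} = f6" "f {0, 1, 2} = f7"
  shows "f = gr f0 f1 f2 f3 f4 f5 f6 f7"
proof
  fix S
  show "f S = gr f0 f1 f2 f3 f4 f5 f6 f7 S"
  proof (cases "S \<subseteq> {..<3}")
    case True
    then show ?thesis
      unfolding subset_3 using assms(2-) by (elim disjE) (simp_all only: gr_apply)
  qed (simp add: assms(1) gr_outside)
qed

lemma gr_superfunctions:
  assumes "holomorphic3 f0" "holomorphic3 f1" "holomorphic3 f2" "holomorphic3 f3" "holomorphic3 f4" "holomorphic3 f5"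
    "holomorphic3 f6" "holomorphic3 f7"
  shows "gr f0 f1 f2 f3 f4 f5 f6 f7 \<in> superfunctions 3"
proof (rule superfunctionsI)
  fix S
  show "holomorphic3 (gr f0 f1 f2 f3 f4 f5 f6 f7 S)"
  proof (cases "S \<subseteq> {..<3}")
    case True
    then show ?thesis
      unfolding subset_3 using assms by (elim disjE) (simp_all only: gr_apply)
  qed (simp add: gr_outside)
qed (rule gr_outside)

lemma gr_eqI:
  "(\<And>x. f0 x = g0 x) \<Longrightarrow> (\<And>x. f1 x = g1 x) \<Longrightarrow> (\<And>x. f2 x = g2 x) \<Longrightarrow> (\<And>x. f3 x = g3 x) \<Longrightarrow>
   (\<And>x. f4 x = g4 x) \<Longrightarrow> (\<And>x. f5 x = g5 x) \<Longrightarrow> (\<And>x. f6 x = g6 x) \<Longrightarrow> (\<And>x. f7 x = g7 x) \<Longrightarrow>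
   gr f0 f1 f2 f3 f4 f5 f6 f7 = gr g0 g1 g2 g3 g4 g5 g6 g7"
  by (metis ext)

lemma gr_add: "gr f0 f1 f2 f3 f4 f5 f6 f7 + gr g0 g1 g2 g3 g4 g5 g6 g7 =
    gr (\<lambda>x. f0 x + g0 x) (\<lambda>x. f1 x + g1 x) (\<lambda>x. f2 x + g2 x) (\<lambda>x. f3 x + g3 x)
      (\<lambda>x. f4 x + g4 x) (\<lambda>x. f5 x + g5 x) (\<lambda>x. f6 x + g6 x) (\<lambda>x. f7 x + g7 x)"
  by (rule eq_grI) (simp_all only: plus_fun_apply gr_outside gr_apply add_0 not_False_eq_True, simp_all add: fun_eq_iff)

lemma gr_diff: "gr f0 f1 f2 f3 f4 f5 f6 f7 - gr g0 g1 g2 g3 g4 g5 g6 g7 =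
    gr (\<lambda>x. f0 x - g0 x) (\<lambda>x. f1 x - g1 x) (\<lambda>x. f2 x - g2 x) (\<lambda>x. f3 x - g3 x)
      (\<lambda>x. f4 x - g4 x) (\<lambda>x. f5 x - g5 x) (\<lambda>x. f6 x - g6 x) (\<lambda>x. f7 x - g7 x)"
  by (rule eq_grI) (simp_all only: minus_apply gr_outside gr_apply diff_zero not_False_eq_True, simp_all add: fun_eq_iff)

lemma gr_scl: "scl c (gr f0 f1 f2 f3 f4 f5 f6 f7) =
    gr (\<lambda>x. c * f0 x) (\<lambda>x. c * f1 x) (\<lambda>x. c * f2 x) (\<lambda>x. c * f3 x)
      (\<lambda>x. c * f4 x) (\<lambda>x. c * f5 x) (\<lambda>x. c * f6 x) (\<lambda>x. c * f7 x)"
  by (rule eq_grI) (simp_all only: scl_def gr_outside gr_apply not_False_eq_True, simp_all add: fun_eq_iff)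

lemma gr_uminus: "- gr f0 f1 f2 f3 f4 f5 f6 f7 = gr (\<lambda>x. - f0 x) (\<lambda>x. - f1 x) (\<lambda>x. - f2 x) (\<lambda>x. - f3 x)
      (\<lambda>x. - f4 x) (\<lambda>x. - f5 x) (\<lambda>x. - f6 x) (\<lambda>x. - f7 x)"
  by (rule eq_grI) (simp_all only: uminus_apply gr_outside gr_apply minus_zero not_False_eq_True, simp_all add: fun_eq_iff)

lemma gr_tau: "tau (Suc 0) (gr f0 f1 f2 f3 f4 f5 f6 f7) = gr f0 (\<lambda>x. - f1 x) (\<lambda>x. - f2 x) (\<lambda>x. - f3 x) f4 f5 f6 (\<lambda>x. - f7 x)"
  by (rule eq_grI) (simp_all only: tau_def gr_outside gr_apply not_False_eq_True, simp_all add: fun_eq_iff)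

lemma gr_zero: "(0 :: sfun) = gr (\<lambda>x. 0) (\<lambda>x. 0) (\<lambda>x. 0) (\<lambda>x. 0) (\<lambda>x. 0) (\<lambda>x. 0) (\<lambda>x. 0) (\<lambda>x. 0)"
  by (rule eq_grI) (simp_all add: fun_eq_iff)

lemma gr_even_partial: "even_partial i (gr f0 f1 f2 f3 f4 f5 f6 f7) = gr (pderiv3 i f0) (pderiv3 i f1) (pderiv3 i f2) (pderiv3 i f3)
    (pderiv3 i f4) (pderiv3 i f5) (pderiv3 i f6) (pderiv3 i f7)"
  by (rule eq_grI) (simp_all only: even_partial_eq_pderiv3 gr_outside gr_apply not_False_eq_True, simp add: fun_eq_iff zero_fun_def)

lemma gr_even_coord: "even_coord i \<odot> gr f0 f1 f2 f3 f4 f5 f6 f7 = gr (\<lambda>x. x $ i * f0 x) (\<lambda>x. x $ i * f1 x) (\<lambda>x. x $ i * f2 x) (\<lambda>x. x $ i * f3 x)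
    (\<lambda>x. x $ i * f4 x) (\<lambda>x. x $ i * f5 x) (\<lambda>x. x $ i * f6 x) (\<lambda>x. x $ i * f7 x)"
proof -
  have *: "(even_coord i \<odot> g) S x = x $ i * g S x" if "finite S" for g S x
  proof -
    have "(even_coord i \<odot> g) S x = (\<Sum>T\<in>Pow S. if T = {} then x $ i * g S x else 0)"
      unfolding smult_apply by (rule sum.cong) (auto simp: even_coord_def)
    then show ?thesis using that by simp
  qed
  show ?thesis
  proof (rule eq_grI)
    show "(even_coord i \<odot> gr f0 f1 f2 f3 f4 f5 f6 f7) S = 0" if "\<not> S \<subseteq> {..<3}" for S
      using gr_outside[OF that] by (cases "finite S") (simp_all add: * smult_infinite fun_eq_iff)
  qed (rule ext, simp only: * gr_apply finite.intros)+
qed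

lemma odd_coord_smult:
  assumes "finite S"
  shows "(odd_coord n \<odot> g) S x = (if n \<in> S then koszul_sign {n} (S - {n}) * g (S - {n}) x else 0)"
proof -
  have "(odd_coord n \<odot> g) S x = (\<Sum>T\<in>Pow S. if T = {n} then koszul_sign {n} (S - {n}) * g (S - {n}) x else 0)"
    unfolding smult_apply by (rule sum.cong) (auto simp: odd_coord_def)
  then show ?thesis using assms by simp
qed

lemma koszul_3: "koszul_sign {1} {0} = -1" "koszul_sign {2} {0} = -1" "koszul_sign {2} {1} = -1"
  "koszul_sign {0} {1} = 1" "koszul_sign {0} {2} = 1" "koszul_sign {1} {2} = 1"
  "koszul_sign {0} {1, 2} = 1" "koszul_sign {1} {0, 2} = -1" "koszul_sign {2} {0, 1} = 1"
  by (simp_all add: koszul_sign_eq_prod)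

lemma diff_3: "{n :: nat} - {n} = {}" "{0, 1} - {0 :: nat} = {1}" "{0, 1} - {1 :: nat} = {0}" "{0, 2} - {0 :: nat} = {2}"
  "{1, 2} - {1 :: nat} = {2}"
  "{0, 1, 2} - {0 :: nat} = {1, 2}" "{0, 1, 2} - {1 :: nat} = {0, 2}"
  by auto

lemma mem_3: "0 \<in> {0 :: nat}" "0 \<notin> {1 :: nat}" "0 \<notin> {2 :: nat}" "1 \<notin> {0 :: nat}" "1 \<in> {1 :: nat}" "1 \<notin> {2 :: nat}"
  "2 \<notin> {0 :: nat}" "2 \<notin> {1 :: nat}" "2 \<in> {2 :: nat}"
  "0 \<in> {0, 1 :: nat}" "0 \<in> {0, 2 :: nat}" "0 \<notin> {1, 2 :: nat}" "1 \<in> {0, 1 :: nat}" "1 \<notin> {0, 2 :: nat}" "1 \<in> {1, 2 :: nat}"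
  "2 \<notin> {0, 1 :: nat}" "2 \<in> {0, 2 :: nat}" "2 \<in> {1, 2 :: nat}"
  "0 \<in> {0, 1, 2 :: nat}" "1 \<in> {0, 1, 2 :: nat}" "2 \<in> {0, 1, 2 :: nat}" "n \<notin> {}"
  by auto

lemma insert_3: "insert 1 {0} = {0, 1 :: nat}" "insert 2 {0} = {0, 2 :: nat}" "insert 2 {1} = {1, 2 :: nat}"
  "insert 1 {0, 2} = {0, 1, 2 :: nat}" "insert 2 {0, 1} = {0, 1, 2 :: nat}"
  by auto

lemma gr_odd_coord:
  "odd_coord 0 \<odot> gr f0 f1 f2 f3 f4 f5 f6 f7 = gr (\<lambda>x. 0) f0 (\<lambda>x. 0) (\<lambda>x. 0) f2 f3 (\<lambda>x. 0) f6"
  "odd_coord 1 \<odot> gr f0 f1 f2 f3 f4 f5 f6 f7 = gr (\<lambda>x. 0) (\<lambda>x. 0) f0 (\<lambda>x. 0) (\<lambda>x. - f1 x) (\<lambda>x. 0) f3 (\<lambda>x. - f5 x)"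
proof -
  have out: "(odd_coord n \<odot> gr f0 f1 f2 f3 f4 f5 f6 f7) S = 0" if S: "\<not> S \<subseteq> {..<3}" and n: "n < 3" for n S
  proof (cases "finite S")
    case True
    have "gr f0 f1 f2 f3 f4 f5 f6 f7 (S - {n}) = 0"
      by (rule gr_outside) (use S n in auto)
    with True show ?thesis by (simp add: odd_coord_smult fun_eq_iff)
  qed (rule smult_infinite)
  show "odd_coord 0 \<odot> gr f0 f1 f2 f3 f4 f5 f6 f7 = gr (\<lambda>x. 0) f0 (\<lambda>x. 0) (\<lambda>x. 0) f2 f3 (\<lambda>x. 0) f6"
    by (rule eq_grI) (rule out, assumption, simp,
        (rule ext, simp only: odd_coord_smult finite.intros diff_3 gr_apply koszul_3 koszul_sign_empty mem_3 if_True if_False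
          simp_thms mult_1)+)
  show "odd_coord 1 \<odot> gr f0 f1 f2 f3 f4 f5 f6 f7 = gr (\<lambda>x. 0) (\<lambda>x. 0) f0 (\<lambda>x. 0) (\<lambda>x. - f1 x) (\<lambda>x. 0) f3 (\<lambda>x. - f5 x)"
    by (rule eq_grI) (rule out, assumption, simp,
        (rule ext, simp only: odd_coord_smult finite.intros diff_3 gr_apply koszul_3 koszul_sign_empty mem_3 if_True if_False
          simp_thms mult_1 mult_minus1)+)
qed

lemma gr_odd_partial:
  "odd_partial 0 (gr f0 f1 f2 f3 f4 f5 f6 f7) = gr f1 (\<lambda>x. 0) f4 f5 (\<lambda>x. 0) (\<lambda>x. 0) f7 (\<lambda>x. 0)"
  "odd_partial 1 (gr f0 f1 f2 f3 f4 f5 f6 f7) = gr f2 (\<lambda>x. - f4 x) (\<lambda>x. 0) f6 (\<lambda>x. 0) (\<lambda>x. - f7 x) (\<lambda>x. 0) (\<lambda>x. 0)"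
  "odd_partial 2 (gr f0 f1 f2 f3 f4 f5 f6 f7) = gr f3 (\<lambda>x. - f5 x) (\<lambda>x. - f6 x) (\<lambda>x. 0) f7 (\<lambda>x. 0) (\<lambda>x. 0) (\<lambda>x. 0)"
proof -
  have out: "odd_partial n (gr f0 f1 f2 f3 f4 f5 f6 f7) S = 0" if S: "\<not> S \<subseteq> {..<3}" for n S
  proof -
    have "gr f0 f1 f2 f3 f4 f5 f6 f7 (insert n S) = 0"
      by (rule gr_outside) (use S in auto)
    then show ?thesis by (simp add: odd_partial_def fun_eq_iff)
  qed
  show "odd_partial 0 (gr f0 f1 f2 f3 f4 f5 f6 f7) = gr f1 (\<lambda>x. 0) f4 f5 (\<lambda>x. 0) (\<lambda>x. 0) f7 (\<lambda>x. 0)"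
    by (rule eq_grI) (rule out, assumption,
        (rule ext, simp only: odd_partial_koszul insert_3 gr_apply koszul_3 koszul_sign_empty mem_3 if_True if_False
          simp_thms mult_1 mult_minus1)+)
  show "odd_partial 1 (gr f0 f1 f2 f3 f4 f5 f6 f7) = gr f2 (\<lambda>x. - f4 x) (\<lambda>x. 0) f6 (\<lambda>x. 0) (\<lambda>x. - f7 x) (\<lambda>x. 0) (\<lambda>x. 0)"
    by (rule eq_grI) (rule out, assumption,
        (rule ext, simp only: odd_partial_koszul insert_3 gr_apply koszul_3 koszul_sign_empty mem_3 if_True if_False
          simp_thms mult_1 mult_minus1)+)
  show "odd_partial 2 (gr f0 f1 f2 f3 f4 f5 f6 f7) = gr f3 (\<lambda>x. - f5 x) (\<lambda>x. - f6 x) (\<lambda>x. 0) f7 (\<lambda>x. 0) (\<lambda>x. 0) (\<lambda>x. 0)"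
    by (rule eq_grI) (rule out, assumption,
        (rule ext, simp only: odd_partial_koszul insert_3 gr_apply koszul_3 koszul_sign_empty mem_3 if_True if_False
          simp_thms mult_1 mult_minus1)+)
qed

lemma Lop_explicit:
  assumes f: "f \<in> superfunctions 3"
  shows "Lop s1 E1 f = even_partial 1 f + scl (- 1 / 2) (odd_coord 0 \<odot> odd_partial 2 f)"
    and "Lop s1 E2 f = even_partial 2 f + scl (- 1 / 2) (odd_coord 1 \<odot> odd_partial 2 f)"
    and "Lop s1 E3 f = odd_partial 0 f + scl (1 / 2) (even_coord 1 \<odot> odd_partial 2 f)
      + scl (s1 / 2) (odd_coord 1 \<odot> even_partial 3 f)"
    and "Lop s1 E4 f = odd_partial 1 f + scl (1 / 2) (even_coord 2 \<odot> odd_partial 2 f)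
      + scl (s1 / 2) (odd_coord 0 \<odot> even_partial 3 f)"
  using f by (simp_all add: Lop_def vapply_def UNIV_mix left_inv_eq m_const_def sconst_smult[where q = 3] algebra_simps)

text \<open>The components of \<open>exp (- ad U) u\<close> for \<open>U = \<Sum>\<^sub>j u\<^sup>j e\<^sub>j\<close>.\<close>

definition flat_section :: "complex \<Rightarrow> (gix \<Rightarrow> complex) \<Rightarrow> gix \<Rightarrow> sfun" where
  "flat_section a u = (
    let X1 = u (Inl (1, BX)); H1 = u (Inl (1, BH)); Y1 = u (Inl (1, BY));
        X2 = u (Inl (2, BX)); H2 = u (Inl (2, BH)); Y2 = u (Inl (2, BY));
        X3 = u (Inl (3, BX)); H3 = u (Inl (3, BH)); Y3 = u (Inl (3, BY));
        xxx = u (Inr (Vx, Vx, Vx)); xxy = u (Inr (Vx, Vx, Vy)); xyx = u (Inr (Vx, Vy, Vx)); xyy = u (Inr (Vx, Vy, Vy));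
        yxx = u (Inr (Vy, Vx, Vx)); yxy = u (Inr (Vy, Vx, Vy)); yyx = u (Inr (Vy, Vy, Vx)); yyy = u (Inr (Vy, Vy, Vy))
    in (\<lambda>k. case k of
      Inl (i, b) \<Rightarrow> if i = 1 then (case b of
        BX \<Rightarrow> gr (\<lambda>x. X1)
        (\<lambda>x. 0)
        (\<lambda>x. 0)
        (\<lambda>x. 0)
        (\<lambda>x. 0)
        (\<lambda>x. 0)
        (\<lambda>x. 0)
        (\<lambda>x. 0)
        | BH \<Rightarrow> gr (\<lambda>x. H1 + X1 * x $ 3)
        (\<lambda>x. (1 + a) * xyx / 2 - (1 + a) * xxx * x $ 1 / 4)
        (\<lambda>x. (1 + a) * xxy / 2 - (1 + a) * xxx * x $ 2 / 4)
        (\<lambda>x. - (1 + a) * xxx / 2)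
        (\<lambda>x. 0)
        (\<lambda>x. 0)
        (\<lambda>x. 0)
        (\<lambda>x. 0)
        | BY \<Rightarrow> gr (\<lambda>x. Y1 - 2 * H1 * x $ 3 - X1 * x $ 3 * x $ 3)
        (\<lambda>x. (1 + a) * yyx - (1 + a) * yxx * x $ 1 / 2 - (1 + a) * xyx * x $ 3 + (1 + a) * xxx * x $ 1 * x $ 3 / 2)
        (\<lambda>x. (1 + a) * yxy - (1 + a) * yxx * x $ 2 / 2 - (1 + a) * xxy * x $ 3 + (1 + a) * xxx * x $ 2 * x $ 3 / 2)
        (\<lambda>x. - (1 + a) * yxx + (1 + a) * xxx * x $ 3)
        (\<lambda>x. (1 + a) * H2 - (1 + a) * H3 + (1 + a) * X2 * x $ 1 / 2 - (1 + a) * X3 * x $ 2 / 2)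
        (\<lambda>x. - (1 + a) * X3)
        (\<lambda>x. - (1 + a) * X2)
        (\<lambda>x. (1 - a * a) * xxx / 2))
      else if i = 2 then (case b of
        BX \<Rightarrow> gr (\<lambda>x. X2)
        (\<lambda>x. - xxx)
        (\<lambda>x. 0)
        (\<lambda>x. 0)
        (\<lambda>x. 0)
        (\<lambda>x. 0)
        (\<lambda>x. 0)
        (\<lambda>x. 0)
        | BH \<Rightarrow> gr (\<lambda>x. H2 + X2 * x $ 1)
        (\<lambda>x. xyx / 2 - 3 * xxx * x $ 1 / 4)
        (\<lambda>x. - xxy / 2 + xxx * x $ 2 / 4)
        (\<lambda>x. xxx / 2)
        (\<lambda>x. - X1 / 2)
        (\<lambda>x. 0)
        (\<lambda>x. 0)
        (\<lambda>x. 0)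
        | BY \<Rightarrow> gr (\<lambda>x. Y2 - 2 * H2 * x $ 1 - X2 * x $ 1 * x $ 1)
        (\<lambda>x. - xyx * x $ 1 / 2 + xxx * x $ 1 * x $ 1 / 2)
        (\<lambda>x. - xyy + xxy * x $ 1 + xyx * x $ 2 / 2 - xxx * x $ 1 * x $ 2 / 2)
        (\<lambda>x. xyx - xxx * x $ 1)
        (\<lambda>x. X1 * x $ 1 / 2)
        (\<lambda>x. 0)
        (\<lambda>x. X1)
        (\<lambda>x. 0))
      else (case b of
        BX \<Rightarrow> gr (\<lambda>x. X3)
        (\<lambda>x. 0)
        (\<lambda>x. - a * xxx)
        (\<lambda>x. 0)
        (\<lambda>x. 0)
        (\<lambda>x. 0)
        (\<lambda>x. 0)
        (\<lambda>x. 0)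
        | BH \<Rightarrow> gr (\<lambda>x. H3 + X3 * x $ 2)
        (\<lambda>x. - a * xyx / 2 + a * xxx * x $ 1 / 4)
        (\<lambda>x. a * xxy / 2 - 3 * a * xxx * x $ 2 / 4)
        (\<lambda>x. a * xxx / 2)
        (\<lambda>x. a * X1 / 2)
        (\<lambda>x. 0)
        (\<lambda>x. 0)
        (\<lambda>x. 0)
        | BY \<Rightarrow> gr (\<lambda>x. Y3 - 2 * H3 * x $ 2 - X3 * x $ 2 * x $ 2)
        (\<lambda>x. - a * xyy + a * xyx * x $ 2 + a * xxy * x $ 1 / 2 - a * xxx * x $ 1 * x $ 2 / 2)
        (\<lambda>x. - a * xxy * x $ 2 / 2 + a * xxx * x $ 2 * x $ 2 / 2)
        (\<lambda>x. a * xxy - a * xxx * x $ 2)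
        (\<lambda>x. - a * X1 * x $ 2 / 2)
        (\<lambda>x. a * X1)
        (\<lambda>x. 0)
        (\<lambda>x. 0))
    | Inr (Vx, Vx, Vx) \<Rightarrow> gr (\<lambda>x. xxx)
        (\<lambda>x. 0)
        (\<lambda>x. 0)
        (\<lambda>x. 0)
        (\<lambda>x. 0)
        (\<lambda>x. 0)
        (\<lambda>x. 0)
        (\<lambda>x. 0)
    | Inr (Vx, Vx, Vy) \<Rightarrow> gr (\<lambda>x. xxy - xxx * x $ 2)
        (\<lambda>x. X1)
        (\<lambda>x. 0)
        (\<lambda>x. 0)
        (\<lambda>x. 0)
        (\<lambda>x. 0)
        (\<lambda>x. 0)
        (\<lambda>x. 0)
    | Inr (Vx, Vy, Vx) \<Rightarrow> gr (\<lambda>x. xyx - xxx * x $ 1)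
        (\<lambda>x. 0)
        (\<lambda>x. X1)
        (\<lambda>x. 0)
        (\<lambda>x. 0)
        (\<lambda>x. 0)
        (\<lambda>x. 0)
        (\<lambda>x. 0)
    | Inr (Vx, Vy, Vy) \<Rightarrow> gr (\<lambda>x. xyy - xxy * x $ 1 - xyx * x $ 2 + xxx * x $ 1 * x $ 2)
        (\<lambda>x. - X1 * x $ 1 / 2)
        (\<lambda>x. - X1 * x $ 2 / 2)
        (\<lambda>x. X1)
        (\<lambda>x. 0)
        (\<lambda>x. 0)
        (\<lambda>x. 0)
        (\<lambda>x. 0)
    | Inr (Vy, Vx, Vx) \<Rightarrow> gr (\<lambda>x. yxx - xxx * x $ 3)
        (\<lambda>x. X3)
        (\<lambda>x. X2)
        (\<lambda>x. 0)
        (\<lambda>x. (- 1 + a) * xxx / 2)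
        (\<lambda>x. 0)
        (\<lambda>x. 0)
        (\<lambda>x. 0)
    | Inr (Vy, Vx, Vy) \<Rightarrow> gr (\<lambda>x. yxy - yxx * x $ 2 - xxy * x $ 3 + xxx * x $ 2 * x $ 3)
        (\<lambda>x. - H1 + H2 - H3 - X3 * x $ 2 - X1 * x $ 3 + X2 * x $ 1 / 2)
        (\<lambda>x. - X2 * x $ 2 / 2)
        (\<lambda>x. X2)
        (\<lambda>x. (1 + a) * xxy / 2 - a * xxx * x $ 2 / 2)
        (\<lambda>x. - xxx)
        (\<lambda>x. 0)
        (\<lambda>x. 0)
    | Inr (Vy, Vy, Vx) \<Rightarrow> gr (\<lambda>x. yyx - yxx * x $ 1 - xyx * x $ 3 + xxx * x $ 1 * x $ 3)
        (\<lambda>x. - X3 * x $ 1 / 2)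
        (\<lambda>x. - H1 - H2 + H3 - X2 * x $ 1 - X1 * x $ 3 + X3 * x $ 2 / 2)
        (\<lambda>x. X3)
        (\<lambda>x. - (1 + a) * xyx / 2 + xxx * x $ 1 / 2)
        (\<lambda>x. 0)
        (\<lambda>x. - a * xxx)
        (\<lambda>x. 0)
    | Inr (Vy, Vy, Vy) \<Rightarrow> gr (\<lambda>x. yyy - yxy * x $ 1 - yyx * x $ 2 - xyy * x $ 3 + yxx * x $ 1 * x $ 2 + xxy * x $ 1 * x $ 3 + xyx * x $ 2 * x $ 3 - xxx * x $ 1 * x $ 2 * x $ 3)
        (\<lambda>x. Y2 + H1 * x $ 1 / 2 - 3 * H2 * x $ 1 / 2 + H3 * x $ 1 / 2 + X3 * x $ 1 * x $ 2 / 2 + X1 * x $ 1 * x $ 3 / 2 - X2 * x $ 1 * x $ 1 / 2)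
        (\<lambda>x. Y3 + H1 * x $ 2 / 2 + H2 * x $ 2 / 2 - 3 * H3 * x $ 2 / 2 + X2 * x $ 1 * x $ 2 / 2 + X1 * x $ 2 * x $ 3 / 2 - X3 * x $ 2 * x $ 2 / 2)
        (\<lambda>x. - H1 - H2 - H3 - X2 * x $ 1 - X3 * x $ 2 - X1 * x $ 3)
        (\<lambda>x. (1 - a) * xyy / 2 - xxy * x $ 1 / 2 + a * xyx * x $ 2 / 2)
        (\<lambda>x. - xyx + xxx * x $ 1)
        (\<lambda>x. - a * xxy + a * xxx * x $ 2)
        (\<lambda>x. (1 - a) * X1 / 2)))"

lemmas gr_simps = gr_add gr_diff gr_scl gr_uminus gr_tau gr_even_partial gr_even_coord
  gr_odd_coord[unfolded One_nat_def] gr_odd_partial[unfolded One_nat_def]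

lemma superfunctions_flat_section: "flat_section a u l \<in> superfunctions 3"
proof -
  have "\<forall>l. flat_section a u l \<in> superfunctions 3"
    unfolding all_gix flat_section_def Let_def by (simp add: gr_superfunctions holomorphic3_poly)
  then show ?thesis by blast
qed

lemma flat_section_0: "flat_section a u l {} 0 = u l"
proof -
  have "\<forall>l. flat_section a u l {} 0 = u l"
    unfolding all_gix flat_section_def Let_def by (simp add: gr_apply)
  then show ?thesis by blast
qed

text \<open>As \<open>ad U\<close> is nilpotent, the exponential is polynomial, and the equations
  can be checked directly: both sides are normalized to \<open>gr\<close> and their eight polynomial
  coefficients compared. A side that is 0 is first rewritten by \<open>gr_zero\<close>.\<close>

lemma flat_flat_section: "flat a (flat_section a u)"
proof -
  have L1: "\<forall>l. Lop (- 1 - a) E1 (flat_section a u l)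
      = - (\<Sum>k\<in>UNIV. scl (gamma_const (- 1 - a) 1 a (idx E1) k l) (flat_section a u k))"
    unfolding all_gix sum_gix flat_section_def Let_def
    by (simp add: gr_simps Lop_explicit gr_superfunctions holomorphic3_poly)
      (intro conjI; (subst gr_zero)?; rule gr_eqI; simp add: pderiv3_poly field_simps)
  have L2: "\<forall>l. Lop (- 1 - a) E2 (flat_section a u l)
      = - (\<Sum>k\<in>UNIV. scl (gamma_const (- 1 - a) 1 a (idx E2) k l) (flat_section a u k))"
    unfolding all_gix sum_gix flat_section_def Let_def
    by (simp add: gr_simps Lop_explicit gr_superfunctions holomorphic3_poly)
      (intro conjI; (subst gr_zero)?; rule gr_eqI; simp add: pderiv3_poly field_simps)
  have L3: "\<forall>l. Lop (- 1 - a) E3 (flat_section a u l)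
      = - (\<Sum>k\<in>UNIV. scl (gamma_const (- 1 - a) 1 a (idx E3) k l) (tau (Suc 0) (flat_section a u k)))"
    unfolding all_gix sum_gix flat_section_def Let_def
    by (simp add: gr_simps Lop_explicit gr_superfunctions holomorphic3_poly)
      (intro conjI; (subst gr_zero)?; rule gr_eqI; simp add: pderiv3_poly field_simps)
  have L4: "\<forall>l. Lop (- 1 - a) E4 (flat_section a u l)
      = - (\<Sum>k\<in>UNIV. scl (gamma_const (- 1 - a) 1 a (idx E4) k l) (tau (Suc 0) (flat_section a u k)))"
    unfolding all_gix sum_gix flat_section_def Let_def
    by (simp add: gr_simps Lop_explicit gr_superfunctions holomorphic3_poly)
      (intro conjI; (subst gr_zero)?; rule gr_eqI; simp add: pderiv3_poly field_simps)
  show ?thesis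
    unfolding flat_def neg1_def using L1 L2 L3 L4 superfunctions_flat_section by (simp del: idx.simps)
qed


section \<open>The bracket of flat sections\<close>

lemma jacobi:
  assumes "i \<in> neg1" "s1 = - s2 - s3"
  shows "(\<Sum>m\<in>UNIV. gamma_const s1 s2 s3 (idx i) m r * gamma_const s1 s2 s3 k l m)
    = (\<Sum>m\<in>UNIV. gamma_const s1 s2 s3 (idx i) k m * gamma_const s1 s2 s3 m l r)
    + (-1) ^ (par i * gpar k) * (\<Sum>m\<in>UNIV. gamma_const s1 s2 s3 (idx i) l m * gamma_const s1 s2 s3 k m r)"
  using assms(1) jacobi_E1[rule_format, of s1 s2 s3 r k l] jacobi_E2[rule_format, of s1 s2 s3 r k l]
    jacobi_E3[OF assms(2), rule_format, of r k l] jacobi_E4[OF assms(2), rule_format, of r k l]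
  unfolding neg1_def by (elim insertE emptyE; simp)

lemma gamma_const_parity: "gamma_const s1 s2 s3 k l m \<noteq> 0 \<Longrightarrow> even (gpar k + gpar l + gpar m)"
  by (induct s1 s2 s3 k l m rule: gamma_const.induct) (auto simp: gpar_def)

lemma phi_commute: "phi v w d = phi w v d"
  by (cases v; cases w; cases d) simp_all

lemma eta_swap: "eta v w = - eta w v"
  by (cases v; cases w) simp_all

lemma sl2_const_swap: "sl2_const b c d = - sl2_const c b d"
  by (cases b; cases c; cases d) simp_all

lemma gamma_const_swap:
  "gamma_const s1 s2 s3 l k m = - ((-1) ^ (gpar k * gpar l) * gamma_const s1 s2 s3 k l m)"
proof -
  have "eta v w * eta v' w' = eta w v * eta w' v'" for v w v' w'
    using eta_swap[of v w] eta_swap[of v' w'] by simp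
  note eta2 = this
  show ?thesis
  proof (cases k rule: gix_cases; cases l rule: gix_cases; cases m rule: gix_cases)
    fix i b j c h d
    assume "k = Inl (i, b)" "l = Inl (j, c)" "m = Inl (h, d)"
    then show ?thesis
      using sl2_const_swap[of b c d] by (auto simp: gpar_def)
  next
    fix v1 v2 v3 w1 w2 w3 i d
    assume "k = Inr (v1, v2, v3)" "l = Inr (w1, w2, w3)" "m = Inl (i, d)"
    then show ?thesis
      using phi_commute eta2 by (auto simp: gpar_def mult.assoc)
  qed (simp_all add: gpar_def)
qed

lemma gamma_const_idx: "gamma_const s1 s2 s3 (idx i) (idx j) (idx k) = m_const s1 i j k"
  by (cases i; cases j; cases k) (simp_all add: m_const_def)

lemma range_idx: "range idx = {Inl (2, BY), Inl (3, BY), Inr (Vy, Vx, Vy), Inr (Vy, Vy, Vx), Inl (1, BY), Inr (Vy, Vy, Vy)}"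
  by (simp add: UNIV_mix insert_commute)

lemma inj_idx: "inj idx"
proof (rule injI)
  fix i j assume "idx i = idx j" then show "i = j"
    by (cases i; cases j) simp_all
qed

lemma gpar_idx [simp]: "gpar (idx i) = par i"
  by (cases i) (simp_all add: gpar_def)

text \<open>Basis elements outside \<open>range idx\<close> have nonnegative degree, and the bracket
  adds degrees, so it has no component in \<mm>.\<close>

lemma gamma_const_nonneg:
  assumes "m \<notin> range idx" "n \<notin> range idx"
  shows "gamma_const s1 s2 s3 m n (idx k) = 0"
proof -
  have "\<forall>m n. m \<in> range idx \<or> n \<in> range idx \<or> gamma_const s1 s2 s3 m n (idx k) = 0"
    unfolding range_idx by (cases k) (simp_all add: all_gix)
  then show ?thesis using assms by blast
qed

lemma scl_cancel: "scl c f = scl c g \<longleftrightarrow> c = 0 \<or> f = g"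
  by (auto simp: scl_def fun_eq_iff)

lemma Lop_Lop_flat:
  assumes flat: "flat a \<Phi>" and i: "i \<in> neg1" and j: "j \<in> neg1" and s1: "s1 = - 1 - a"
  shows "Lop s1 i (Lop s1 j (\<Phi> l)) = (\<Sum>n\<in>UNIV. scl ((-1) ^ (par i * par j) *
    (\<Sum>k\<in>UNIV. gamma_const s1 1 a (idx j) k l * gamma_const s1 1 a (idx i) n k)) (tau (par i + par j) (\<Phi> n)))"
proof -
  note S [simp] = flat_superfunctions[OF flat]
  note F = flat_Lop[OF flat, folded s1]
  have "Lop s1 i (Lop s1 j (\<Phi> l)) = - (\<Sum>k\<in>UNIV. scl (gamma_const s1 1 a (idx j) k l) (Lop s1 i (tau (par j) (\<Phi> k))))"
    unfolding F[OF j] by (simp add: Lop_uminus[where q = 3] Lop_sum[where q = 3] Lop_scl[where q = 3])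
  also have "\<dots> = (\<Sum>k\<in>UNIV. \<Sum>n\<in>UNIV. scl ((-1) ^ (par i * par j) *
      (gamma_const s1 1 a (idx j) k l * gamma_const s1 1 a (idx i) n k)) (tau (par i + par j) (\<Phi> n)))"
    by (simp add: Lop_tau[where q = 3] F[OF i] tau_sum tau_tau scl_sum_right sum_negf mult.commute mult.left_commute add.commute)
  also have "\<dots> = (\<Sum>n\<in>UNIV. \<Sum>k\<in>UNIV. scl ((-1) ^ (par i * par j) *
      (gamma_const s1 1 a (idx j) k l * gamma_const s1 1 a (idx i) n k)) (tau (par i + par j) (\<Phi> n)))"
    by (rule sum.swap)
  finally show ?thesis
    by (simp only: scl_sum_left sum_distrib_left)
qed

text \<open>For e_6 = [e_1, e_3] and s_1 e_5 = [e_3, e_4] the equation follows from those of the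
  generators: the commutator of the L_i is \<open>Lop_commutator\<close>, and the commutator of the
  maps ad e_i is given by the Jacobi identity.\<close>

lemma flat_Lop_all:
  assumes flat: "flat a \<Phi>" and a: "a \<noteq> -1" and s1: "s1 = - 1 - a"
  shows "Lop s1 i (\<Phi> l) = - (\<Sum>k\<in>UNIV. scl (gamma_const s1 1 a (idx i) k l) (tau (par i) (\<Phi> k)))"
proof -
  note S [simp] = flat_superfunctions[OF flat]
  have s1': "s1 = - 1 - a" "s1 \<noteq> 0"
    using s1 a by (auto simp: algebra_simps)
  have comm: "(\<Sum>k\<in>UNIV. scl (m_const s1 i j k) (Lop s1 k (\<Phi> l))) =
      - (\<Sum>n\<in>UNIV. scl (\<Sum>m\<in>UNIV. gamma_const s1 1 a (idx i) (idx j) m * gamma_const s1 1 a m n l) (tau (par i + par j) (\<Phi> n)))"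
    if i: "i \<in> neg1" and j: "j \<in> neg1" for i j
  proof -
    let ?A = "\<lambda>n. \<Sum>k\<in>UNIV. gamma_const s1 1 a (idx j) k l * gamma_const s1 1 a (idx i) n k"
    let ?B = "\<lambda>n. \<Sum>k\<in>UNIV. gamma_const s1 1 a (idx i) k l * gamma_const s1 1 a (idx j) n k"
    let ?C = "\<lambda>n. \<Sum>m\<in>UNIV. gamma_const s1 1 a (idx i) (idx j) m * gamma_const s1 1 a m n l"
    have J: "(-1) ^ (par i * par j) * ?A n - (-1) ^ (par i * par j) * ((-1) ^ (par j * par i) * ?B n) = - ?C n" for n
    proof -
      have "?B n = ?C n + (-1) ^ (par i * par j) * ?A n"
        using jacobi[OF i s1'(1), of l "idx j" n] by (simp add: mult.commute)
      then show ?thesis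
        by (simp add: mult.commute[of "par j"] minus_one_power_iff algebra_simps)
    qed
    have "(\<Sum>k\<in>UNIV. scl (m_const s1 i j k) (Lop s1 k (\<Phi> l))) =
        Lop s1 i (Lop s1 j (\<Phi> l)) - scl ((-1) ^ (par i * par j)) (Lop s1 j (Lop s1 i (\<Phi> l)))"
      by (rule Lop_commutator[OF S order_refl, symmetric])
    also have "\<dots> = (\<Sum>n\<in>UNIV. scl ((-1) ^ (par i * par j) * ?A n - (-1) ^ (par i * par j) * ((-1) ^ (par j * par i) * ?B n))
        (tau (par i + par j) (\<Phi> n)))"
      unfolding Lop_Lop_flat[OF flat i j s1] Lop_Lop_flat[OF flat j i s1]
      by (simp add: scl_sum_right scl_diff_left sum_subtractf add.commute)
    also have "\<dots> = - (\<Sum>n\<in>UNIV. scl (?C n) (tau (par i + par j) (\<Phi> n)))"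
      unfolding J by (simp add: sum_negf)
    finally show ?thesis .
  qed
  show ?thesis
  proof (cases "i \<in> neg1")
    case True
    then show ?thesis unfolding s1 by (rule flat_Lop[OF flat])
  next
    case False
    then have "i = E5 \<or> i = E6" by (cases i) simp_all
    then show ?thesis
    proof
      assume i: "i = E6"
      have C: "(\<Sum>m\<in>UNIV. gamma_const s1 1 a (idx E1) (idx E3) m * gamma_const s1 1 a m n l)
          = gamma_const s1 1 a (idx E6) n l" for n
        unfolding sum_gix by simp
      show ?thesis
        using comm[of E1 E3] unfolding C i by (simp add: UNIV_mix m_const_def del: idx.simps)
    next
      assume i: "i = E5"
      have C: "(\<Sum>m\<in>UNIV. gamma_const s1 1 a (idx E3) (idx E4) m * gamma_const s1 1 a m n l)
          = s1 * gamma_const s1 1 a (idx E5) n l" for n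
        unfolding sum_gix by simp
      have T: "tau (par E3 + par E4) (\<Phi> n) = \<Phi> n" for n
        using tau_cong[of "par E3 + par E4" 0 "\<Phi> n"] by simp
      have "scl s1 (Lop s1 E5 (\<Phi> l)) = scl s1 (- (\<Sum>n\<in>UNIV. scl (gamma_const s1 1 a (idx E5) n l) (\<Phi> n)))"
        using comm[of E3 E4] unfolding C T by (simp add: UNIV_mix m_const_def scl_sum_right del: idx.simps)
      then show ?thesis
        using s1'(2) unfolding i scl_cancel by simp
    qed
  qed
qed

text \<open>The bracket of \<gg>-valued superfunctions, extended from \<gg>;
  \<open>tau (gpar k)\<close> is the sign of moving the basis element \<open>k\<close> past the
  coefficient of \<Psi>.\<close>

definition flat_bracket :: "complex \<Rightarrow> (gix \<Rightarrow> sfun) \<Rightarrow> (gix \<Rightarrow> sfun) \<Rightarrow> gix \<Rightarrow> sfun" where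
  "flat_bracket a \<Phi> \<Psi> l = (\<Sum>k\<in>UNIV. \<Sum>m\<in>UNIV. scl (gamma_const (- 1 - a) 1 a k m l) (\<Phi> k \<odot> tau (gpar k) (\<Psi> m)))"

text \<open>L_i is a derivation by the Leibniz rule, and ad e_i is one by the Jacobi identity; so
  the two sides of the flatness equation agree on brackets as soon as they agree on both
  arguments.\<close>

lemma flat_flat_bracket:
  assumes \<Phi>: "flat a \<Phi>" and \<Psi>: "flat a \<Psi>"
  shows "flat a (flat_bracket a \<Phi> \<Psi>)"
proof -
  note S [simp] = flat_superfunctions[OF \<Phi>] flat_superfunctions[OF \<Psi>]
  define g where "g = gamma_const (- 1 - a) 1 a"
  define s1 where "s1 = - 1 - a"
  have "Lop s1 i (flat_bracket a \<Phi> \<Psi> r) = - (\<Sum>m\<in>UNIV. scl (g (idx i) m r) (tau (par i) (flat_bracket a \<Phi> \<Psi> m)))"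
    if i: "i \<in> neg1" for i r
  proof -
    note F = flat_Lop[OF \<Phi> i, folded g_def s1_def] flat_Lop[OF \<Psi> i, folded g_def s1_def]
    \<comment> \<open>Structure constants vanish unless parities match, so the signs in both Leibniz
      terms can be normalized to the same products \<open>P\<close>, to which \<open>jacobi\<close>
      then applies.\<close>
    define P where "P k n = tau (par i) (\<Phi> k) \<odot> tau (par i + gpar k) (\<Psi> n)" for k n
    have 1: "scl (g k m r) (Lop s1 i (\<Phi> k) \<odot> tau (gpar k) (\<Psi> m)) = - (\<Sum>n\<in>UNIV. scl (g (idx i) n k * g k m r) (P n m))" for k m
    proof -
      have "scl (g (idx i) n k) (tau (par i) (\<Phi> n) \<odot> tau (gpar k) (\<Psi> m)) = scl (g (idx i) n k) (P n m)" for n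
      proof (cases "g (idx i) n k = 0")
        case False
        then have "even (gpar k + (par i + gpar n))"
          using gamma_const_parity[of "- 1 - a" 1 a "idx i" n k] by (simp add: g_def ac_simps)
        then show ?thesis
          unfolding P_def by (simp only: tau_cong)
      qed simp
      then have "scl (g k m r) (scl (g (idx i) n k) (tau (par i) (\<Phi> n) \<odot> tau (gpar k) (\<Psi> m)))
          = scl (g (idx i) n k * g k m r) (P n m)" for n
        by (simp only: scl_simps mult.commute)
      then show ?thesis
        unfolding F(1) by (simp add: smult_sum_left scl_sum_right mult.commute)
    qed
    have 2: "scl (g k m r) (tau (par i) (\<Phi> k) \<odot> Lop s1 i (tau (gpar k) (\<Psi> m)))
        = - (\<Sum>n\<in>UNIV. scl ((-1) ^ (par i * gpar k) * (g (idx i) n m * g k m r)) (P k n))" for k m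
      by (simp add: Lop_tau[where q = 3] F(2) P_def tau_sum tau_tau smult_sum_right scl_sum_right mult_ac add.commute)
    have "Lop s1 i (flat_bracket a \<Phi> \<Psi> r) = (\<Sum>k\<in>UNIV. \<Sum>m\<in>UNIV.
        scl (g k m r) (Lop s1 i (\<Phi> k) \<odot> tau (gpar k) (\<Psi> m)) + scl (g k m r) (tau (par i) (\<Phi> k) \<odot> Lop s1 i (tau (gpar k) (\<Psi> m))))"
      unfolding flat_bracket_def g_def[symmetric]
      by (simp add: Lop_sum[where q = 3] Lop_scl[where q = 3] Lop_smult[where q = 3] scl_add_right)
    also have "\<dots> = - ((\<Sum>k\<in>UNIV. \<Sum>m\<in>UNIV. \<Sum>n\<in>UNIV. scl (g (idx i) n k * g k m r) (P n m))
        + (\<Sum>k\<in>UNIV. \<Sum>m\<in>UNIV. \<Sum>n\<in>UNIV. scl ((-1) ^ (par i * gpar k) * (g (idx i) n m * g k m r)) (P k n)))"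
      unfolding 1 2 sum.distrib sum_negf by (simp only: minus_add_distrib)
    also have "(\<Sum>k\<in>UNIV. \<Sum>m\<in>UNIV. \<Sum>n\<in>UNIV. scl (g (idx i) n k * g k m r) (P n m))
        = (\<Sum>k\<in>UNIV. \<Sum>n\<in>UNIV. scl (\<Sum>m\<in>UNIV. g (idx i) k m * g m n r) (P k n))"
    proof -
      have "(\<Sum>k\<in>UNIV. \<Sum>m\<in>UNIV. \<Sum>n\<in>UNIV. scl (g (idx i) n k * g k m r) (P n m))
        = (\<Sum>k\<in>UNIV. \<Sum>n\<in>UNIV. \<Sum>m\<in>UNIV. scl (g (idx i) n k * g k m r) (P n m))"
        by (rule sum.cong[OF refl], rule sum.swap)
      also have "\<dots> = (\<Sum>n\<in>UNIV. \<Sum>k\<in>UNIV. \<Sum>m\<in>UNIV. scl (g (idx i) n k * g k m r) (P n m))"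
        by (rule sum.swap)
      also have "\<dots> = (\<Sum>n\<in>UNIV. \<Sum>m\<in>UNIV. \<Sum>k\<in>UNIV. scl (g (idx i) n k * g k m r) (P n m))"
        by (rule sum.cong[OF refl], rule sum.swap)
      finally show ?thesis by (simp only: scl_sum_left)
    qed
    also have "(\<Sum>k\<in>UNIV. \<Sum>m\<in>UNIV. \<Sum>n\<in>UNIV. scl ((-1) ^ (par i * gpar k) * (g (idx i) n m * g k m r)) (P k n))
        = (\<Sum>k\<in>UNIV. \<Sum>n\<in>UNIV. scl ((-1) ^ (par i * gpar k) * (\<Sum>m\<in>UNIV. g (idx i) n m * g k m r)) (P k n))"
      unfolding sum_distrib_left scl_sum_left by (rule sum.cong[OF refl], rule sum.swap)
    also have "(\<Sum>k\<in>UNIV. \<Sum>n\<in>UNIV. scl (\<Sum>m\<in>UNIV. g (idx i) k m * g m n r) (P k n))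
        + (\<Sum>k\<in>UNIV. \<Sum>n\<in>UNIV. scl ((-1) ^ (par i * gpar k) * (\<Sum>m\<in>UNIV. g (idx i) n m * g k m r)) (P k n))
        = (\<Sum>k\<in>UNIV. \<Sum>n\<in>UNIV. scl (\<Sum>m\<in>UNIV. g (idx i) m r * g k n m) (P k n))"
      unfolding sum.distrib[symmetric] scl_add_left[symmetric] g_def
      by (subst jacobi[OF i]) simp_all
    also have "\<dots> = (\<Sum>k\<in>UNIV. \<Sum>n\<in>UNIV. \<Sum>m\<in>UNIV. scl (g (idx i) m r) (scl (g k n m) (P k n)))"
      by (simp add: scl_sum_left)
    also have "\<dots> = (\<Sum>k\<in>UNIV. \<Sum>m\<in>UNIV. \<Sum>n\<in>UNIV. scl (g (idx i) m r) (scl (g k n m) (P k n)))"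
      by (rule sum.cong[OF refl], rule sum.swap)
    also have "\<dots> = (\<Sum>m\<in>UNIV. \<Sum>k\<in>UNIV. \<Sum>n\<in>UNIV. scl (g (idx i) m r) (scl (g k n m) (P k n)))"
      by (rule sum.swap)
    also have "\<dots> = (\<Sum>m\<in>UNIV. scl (g (idx i) m r) (tau (par i) (flat_bracket a \<Phi> \<Psi> m)))"
      unfolding flat_bracket_def g_def[symmetric]
      by (simp only: tau_sum tau_scl tau_smult tau_tau P_def scl_sum_right)
    finally show ?thesis .
  qed
  then show ?thesis
    unfolding flat_def g_def s1_def by (auto simp: flat_bracket_def simp del: idx.simps)
qed


text \<open>Since \<open>L\<^sub>i \<Psi> = - [e\<^sub>i, \<Psi>]\<close>, the derivatives in \<open>[X, Y]\<close> turn into brackets of components: writing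
  \<open>\<Phi>\<^sub>-\<close> for the part in \<open>\<mm>\<close>, one gets \<open>- [\<Phi>\<^sub>-, \<Psi>] - [\<Phi>, \<Psi>\<^sub>-] + [\<Phi>\<^sub>-, \<Psi>\<^sub>-]\<close>, whose part in \<open>\<mm>\<close> is that of \<open>- [\<Phi>, \<Psi>]\<close>.\<close>

lemma vbracket_flat_homog:
  assumes \<Phi>: "flat a \<Phi>" and \<Psi>: "flat a \<Psi>" and a: "a \<noteq> -1" and s1: "s1 = - 1 - a"
    and p: "\<And>l. homog (p + gpar l) (\<Phi> l)" "p \<in> {0, 1}" and q: "\<And>l. homog (q + gpar l) (\<Psi> l)" "q \<in> {0, 1}"
  shows "vbracket (frame s1 (\<Phi> \<circ> idx)) (frame s1 (\<Psi> \<circ> idx)) = frame s1 ((\<lambda>l. - flat_bracket a \<Phi> \<Psi> l) \<circ> idx)"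
proof -
  note S [simp] = flat_superfunctions[OF \<Phi>] flat_superfunctions[OF \<Psi>]
  define g where "g = gamma_const s1 1 a"
  have v: "\<Phi> \<circ> idx \<in> vfields 3" "\<Psi> \<circ> idx \<in> vfields 3"
    by (simp_all add: vfields_def)
  have h: "vhomog p (\<Phi> \<circ> idx)" "vhomog q (\<Psi> \<circ> idx)"
    using p(1)[of "idx _"] q(1)[of "idx _"] by (simp_all add: vhomog_def)
  have reindex: "(\<Sum>i\<in>UNIV. f (idx i)) = (\<Sum>m\<in>range idx. f m)" for f :: "gix \<Rightarrow> sfun"
    by (simp add: sum.reindex[OF inj_idx])
  have "(\<Sum>i\<in>UNIV. (\<Phi> \<circ> idx) i \<odot> Lop s1 i ((\<Psi> \<circ> idx) k)) - scl ((-1) ^ (p * q)) (\<Sum>i\<in>UNIV. (\<Psi> \<circ> idx) i \<odot> Lop s1 i ((\<Phi> \<circ> idx) k))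
    + (\<Sum>i\<in>UNIV. \<Sum>j\<in>UNIV. scl (m_const s1 i j k) ((\<Phi> \<circ> idx) i \<odot> tau (par i) ((\<Psi> \<circ> idx) j)))
    = ((\<lambda>l. - flat_bracket a \<Phi> \<Psi> l) \<circ> idx) k" for k
  proof -
    \<comment> \<open>\<open>c m n\<close> is the contribution of the pair \<open>m\<close>,
      \<open>n\<close> to the component of the bracket along e_k. The derivative terms sum it with a
      minus sign over pairs with \<open>m \<in> ?I\<close> and over pairs with
      \<open>n \<in> ?I\<close>, the last term with a plus sign over pairs with both. By
      inclusion-exclusion only pairs with neither are missing, and these contribute 0.\<close>
    define c where "c m n = scl (g m n (idx k)) (\<Phi> m \<odot> tau (gpar m) (\<Psi> n))" for m n
    let ?I = "range idx" and ?N = "UNIV - range idx"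
    have c_eq: "\<Psi> n \<odot> tau (gpar n) (\<Phi> m) = scl ((-1) ^ (p * q + gpar m * gpar n)) (\<Phi> m \<odot> tau (gpar m) (\<Psi> n))" for m n
    proof -
      have "\<Psi> n \<odot> tau (gpar n) (\<Phi> m) = tau (q + gpar n) (tau (gpar n) (\<Phi> m)) \<odot> \<Psi> n"
        by (rule smult_homog_commute[OF q(1)])
      also have "\<dots> = scl ((-1) ^ ((q + gpar n + gpar n) * (p + gpar m))) (\<Phi> m \<odot> \<Psi> n)"
        by (simp add: tau_homog[OF p(1)] distrib_right add_ac flip: power_add)
      also have "\<Phi> m \<odot> \<Psi> n = scl ((-1) ^ (gpar m * (q + gpar n))) (\<Phi> m \<odot> tau (gpar m) (\<Psi> n))"
        by (simp add: tau_homog[OF q(1)] flip: power_add mult_2)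
      also have "scl ((-1) ^ ((q + gpar n + gpar n) * (p + gpar m))) (scl ((-1) ^ (gpar m * (q + gpar n))) f)
          = scl ((-1) ^ (p * q + gpar m * gpar n)) f" for f
        unfolding scl_simps power_add[symmetric]
        by (rule arg_cong[where f = "\<lambda>c. scl c f"], rule minus_one_power_cong) auto
      finally show ?thesis .
    qed
    have T1: "(\<Sum>i\<in>UNIV. \<Phi> (idx i) \<odot> Lop s1 i (\<Psi> (idx k))) = - (\<Sum>m\<in>?I. \<Sum>n\<in>UNIV. c m n)"
    proof -
      have "\<Phi> (idx i) \<odot> Lop s1 i (\<Psi> (idx k)) = - (\<Sum>n\<in>UNIV. c (idx i) n)" for i
        by (simp add: flat_Lop_all[OF \<Psi> a s1] c_def g_def smult_sum_right)
      then show ?thesis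
        using reindex[of "\<lambda>m. \<Sum>n\<in>UNIV. c m n"] by (simp add: sum_negf)
    qed
    have T2: "scl ((-1) ^ (p * q)) (\<Sum>i\<in>UNIV. \<Psi> (idx i) \<odot> Lop s1 i (\<Phi> (idx k))) = (\<Sum>m\<in>UNIV. \<Sum>n\<in>?I. c m n)"
    proof -
      have "scl ((-1) ^ (p * q)) (\<Psi> (idx i) \<odot> Lop s1 i (\<Phi> (idx k))) = (\<Sum>m\<in>UNIV. c m (idx i))" for i
      proof -
        have "scl ((-1) ^ (p * q)) (scl (g (idx i) m (idx k)) (\<Psi> (idx i) \<odot> tau (gpar (idx i)) (\<Phi> m))) = - c m (idx i)" for m
        proof -
          have "(-1) ^ (p * q) * (- ((-1) ^ (gpar m * gpar (idx i)) * d) * (-1) ^ (p * q + gpar m * gpar (idx i))) = - d" for d :: complex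
            by (auto simp: minus_one_power_iff)
          then show ?thesis
            unfolding c_eq c_def g_def gamma_const_swap[of s1 1 a "idx i" m "idx k"]
            by (simp only: scl_simps(4) mult.assoc) (simp only: scl_simps(5))
        qed
        then show ?thesis
          by (simp add: flat_Lop_all[OF \<Phi> a s1] g_def smult_sum_right scl_sum_right sum_negf)
      qed
      then have "scl ((-1) ^ (p * q)) (\<Sum>i\<in>UNIV. \<Psi> (idx i) \<odot> Lop s1 i (\<Phi> (idx k))) = (\<Sum>n\<in>?I. \<Sum>m\<in>UNIV. c m n)"
        unfolding scl_sum_right using reindex[of "\<lambda>n. \<Sum>m\<in>UNIV. c m n"] by simp
      then show ?thesis
        by (simp only: sum.swap[of c ?I UNIV] sum.swap[of "\<lambda>m n. c n m" ?I UNIV])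
    qed
    have T3: "(\<Sum>i\<in>UNIV. \<Sum>j\<in>UNIV. scl (m_const s1 i j k) (\<Phi> (idx i) \<odot> tau (par i) (\<Psi> (idx j)))) = (\<Sum>m\<in>?I. \<Sum>n\<in>?I. c m n)"
    proof -
      have "scl (m_const s1 i j k) (\<Phi> (idx i) \<odot> tau (par i) (\<Psi> (idx j))) = c (idx i) (idx j)" for i j
        by (simp add: c_def g_def gamma_const_idx)
      then show ?thesis
        using reindex[of "c (idx _)"] reindex[of "\<lambda>m. \<Sum>n\<in>?I. c m n"] by simp
    qed
    have split: "(\<Sum>n\<in>UNIV. f n) = (\<Sum>n\<in>?N. f n) + (\<Sum>n\<in>?I. f n)" for f :: "gix \<Rightarrow> sfun"
      by (rule sum.subset_diff) simp_all
    have NN: "(\<Sum>m\<in>?N. \<Sum>n\<in>?N. c m n) = 0"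
      by (intro sum.neutral ballI) (simp add: c_def g_def gamma_const_nonneg)
    have NU: "(\<Sum>m\<in>?N. \<Sum>n\<in>UNIV. c m n) = (\<Sum>m\<in>?N. \<Sum>n\<in>?I. c m n)"
      unfolding split[of "c _"] sum.distrib NN by simp
    have "((\<lambda>l. - flat_bracket a \<Phi> \<Psi> l) \<circ> idx) k = - (\<Sum>m\<in>UNIV. \<Sum>n\<in>UNIV. c m n)"
      by (simp add: flat_bracket_def c_def g_def s1)
    also have "\<dots> = - ((\<Sum>m\<in>?N. \<Sum>n\<in>?I. c m n) + (\<Sum>m\<in>?I. \<Sum>n\<in>UNIV. c m n))"
      unfolding split[of "\<lambda>m. \<Sum>n\<in>UNIV. c m n"] NU ..
    finally have R: "((\<lambda>l. - flat_bracket a \<Phi> \<Psi> l) \<circ> idx) k =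
        - ((\<Sum>m\<in>?N. \<Sum>n\<in>?I. c m n) + (\<Sum>m\<in>?I. \<Sum>n\<in>UNIV. c m n))" .
    show ?thesis
      unfolding R unfolding comp_def T1 T2 T3 split[of "\<lambda>m. \<Sum>n\<in>?I. c m n"] by (simp only: algebra_simps) simp
  qed
  then show ?thesis
    unfolding vbracket_frame[OF v(1) v(2) order_refl h(1) p(2) h(2) q(2)] by (simp only:)
qed

section \<open>Linear structure and parity on flat sections\<close>

lemma flat_add:
  assumes "flat a \<Phi>" "flat a \<Psi>"
  shows "flat a (\<Phi> + \<Psi>)"
proof -
  note S [simp] = flat_superfunctions[OF assms(1)] flat_superfunctions[OF assms(2)]
  have "Lop (- 1 - a) i ((\<Phi> + \<Psi>) l) =
      - (\<Sum>k\<in>UNIV. scl (gamma_const (- 1 - a) 1 a (idx i) k l) (tau (par i) ((\<Phi> + \<Psi>) k)))" if i: "i \<in> neg1" for i l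
    unfolding plus_fun_apply[of \<Phi> \<Psi>] Lop_add[OF S(1) S(2)] flat_Lop[OF assms(1) i] flat_Lop[OF assms(2) i]
      tau_add scl_add_right sum.distrib by (simp only: minus_add_distrib)
  then show ?thesis
    unfolding flat_def by (simp only: plus_fun_apply[of \<Phi> \<Psi>] superfunctions_add S) blast
qed

lemma flat_scl:
  assumes "flat a \<Phi>"
  shows "flat a (\<lambda>l. scl c (\<Phi> l))"
proof -
  note S [simp] = flat_superfunctions[OF assms]
  have "Lop (- 1 - a) i (scl c (\<Phi> l)) =
      - (\<Sum>k\<in>UNIV. scl (gamma_const (- 1 - a) 1 a (idx i) k l) (tau (par i) (scl c (\<Phi> k))))" if i: "i \<in> neg1" for i l
    by (simp add: Lop_scl[where q = 3] flat_Lop[OF assms i] scl_sum_right mult.commute)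
  then show ?thesis
    unfolding flat_def by simp
qed

lemma flat_uminus: "flat a \<Phi> \<Longrightarrow> flat a (\<lambda>l. - \<Phi> l)"
  using flat_scl[of a \<Phi> "-1"] by simp

lemma flat_eq_flat_section:
  assumes flat: "flat a \<Phi>" and a: "a \<noteq> -1" and u: "\<And>l. \<Phi> l {} 0 = u l"
  shows "\<Phi> = flat_section a u"
proof -
  have "flat a (\<Phi> + (\<lambda>l. - flat_section a u l))"
    by (intro flat_add flat_uminus flat flat_flat_section)
  then have "\<Phi> + (\<lambda>l. - flat_section a u l) = 0"
    by (rule flat_eq_0[OF _ a]) (simp add: u flat_section_0)
  then have "(\<Phi> + (\<lambda>l. - flat_section a u l)) l = 0" for l
    by (simp only: zero_fun_apply)
  then show ?thesis
    by (intro ext) (simp only: plus_fun_apply[of \<Phi>] add_uminus_conv_diff right_minus_eq)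
qed

definition flat_part :: "nat \<Rightarrow> (gix \<Rightarrow> sfun) \<Rightarrow> gix \<Rightarrow> sfun" where
  "flat_part p \<Phi> l = (\<lambda>S. if even (card S + gpar l + p) then \<Phi> l S else 0)"

lemma homog_flat_part: "homog (p + gpar l) (flat_part p \<Phi> l)"
  by (auto simp: homog_def flat_part_def ac_simps)

lemma flat_part_sum: "flat_part 0 \<Phi> + flat_part 1 \<Phi> = \<Phi>"
  by (auto simp: flat_part_def fun_eq_iff)

text \<open>Writing the parity projection as an average with the parity involution reduces its
  compatibility with flatness to linearity and to the sign rule \<open>Lop_tau\<close>.\<close>

lemma flat_part_eq: "flat_part p \<Phi> l = scl (1 / 2) (\<Phi> l + scl ((-1) ^ (p + gpar l)) (tau (Suc 0) (\<Phi> l)))"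
proof (intro ext)
  fix S x
  show "flat_part p \<Phi> l S x = scl (1 / 2) (\<Phi> l + scl ((-1) ^ (p + gpar l)) (tau (Suc 0) (\<Phi> l))) S x"
    by (auto simp: flat_part_def scl_apply tau_apply minus_one_power_iff)
qed

lemma flat_flat_part:
  assumes flat: "flat a \<Phi>"
  shows "flat a (flat_part p \<Phi>)"
proof -
  note S [simp] = flat_superfunctions[OF flat]
  define \<Theta> where "\<Theta> l = scl ((-1) ^ (p + gpar l)) (tau (Suc 0) (\<Phi> l))" for l
  have "Lop (- 1 - a) i (\<Theta> l) =
      - (\<Sum>k\<in>UNIV. scl (gamma_const (- 1 - a) 1 a (idx i) k l) (tau (par i) (\<Theta> k)))" if i: "i \<in> neg1" for i l
  proof -
    have "Lop (- 1 - a) i (\<Theta> l) = - (\<Sum>k\<in>UNIV. scl ((-1) ^ (p + gpar l + par i) * gamma_const (- 1 - a) 1 a (idx i) k l)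
        (tau (Suc 0) (tau (par i) (\<Phi> k))))"
      by (simp add: \<Theta>_def Lop_scl[where q = 3] Lop_tau[where q = 3] flat_Lop[OF flat i] tau_sum scl_sum_right power_add mult.assoc)
    also have "\<dots> = - (\<Sum>k\<in>UNIV. scl (gamma_const (- 1 - a) 1 a (idx i) k l) (tau (par i) (\<Theta> k)))"
    proof (intro arg_cong[where f = uminus] sum.cong refl)
      fix k
      have "(-1) ^ (p + gpar l + par i) * gamma_const (- 1 - a) 1 a (idx i) k l
          = gamma_const (- 1 - a) 1 a (idx i) k l * (-1) ^ (p + gpar k)"
        using gamma_const_parity[of "- 1 - a" 1 a "idx i" k l]
        by (cases "gamma_const (- 1 - a) 1 a (idx i) k l = 0") (auto simp: minus_one_power_iff)
      then show "scl ((-1) ^ (p + gpar l + par i) * gamma_const (- 1 - a) 1 a (idx i) k l) (tau (Suc 0) (tau (par i) (\<Phi> k)))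
          = scl (gamma_const (- 1 - a) 1 a (idx i) k l) (tau (par i) (\<Theta> k))"
        unfolding \<Theta>_def tau_scl scl_simps tau_tau by (simp only: add.commute)
    qed
    finally show ?thesis .
  qed
  then have "flat a \<Theta>"
    unfolding flat_def by (simp add: \<Theta>_def)
  then have "flat a (\<lambda>l. scl (1 / 2) ((\<Phi> + \<Theta>) l))"
    by (intro flat_scl flat_add flat)
  moreover have "(\<lambda>l. scl (1 / 2) ((\<Phi> + \<Theta>) l)) = flat_part p \<Phi>"
    by (rule ext) (simp only: flat_part_eq plus_fun_apply[of \<Phi> \<Theta>] \<Theta>_def)
  ultimately show ?thesis by simp
qed

lemma vpart_frame_flat:
  assumes "p \<in> {0, 1}"
  shows "vpart p (frame s1 (\<Phi> \<circ> idx)) = frame s1 (flat_part p \<Phi> \<circ> idx)"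
proof -
  have h: "vhomog q (frame s1 (flat_part q \<Phi> \<circ> idx))" for q
    using homog_flat_part[of q "idx _" \<Phi>] by (intro vhomog_frame) (simp add: vhomog_def)
  have "\<Phi> \<circ> idx = (flat_part 0 \<Phi> + flat_part 1 \<Phi>) \<circ> idx"
    by (simp only: flat_part_sum)
  also have "\<dots> = (flat_part 0 \<Phi> \<circ> idx) + (flat_part 1 \<Phi> \<circ> idx)"
    by (rule ext) (simp only: comp_apply plus_fun_apply)
  finally have "frame s1 (\<Phi> \<circ> idx) = frame s1 (flat_part 0 \<Phi> \<circ> idx) + frame s1 (flat_part 1 \<Phi> \<circ> idx)"
    by (simp only: frame_add)
  then have "vpart p (frame s1 (\<Phi> \<circ> idx)) = vpart p (frame s1 (flat_part 0 \<Phi> \<circ> idx)) + vpart p (frame s1 (flat_part 1 \<Phi> \<circ> idx))"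
    by (simp only: vpart_add)
  then show ?thesis
    using assms by (auto simp: vpart_vhomog[OF h])
qed

lemma flat_frame_vfields: "flat a \<Phi> \<Longrightarrow> frame s1 (\<Phi> \<circ> idx) \<in> vfields 3"
  by (rule frame_vfields) (simp_all add: vfields_def flat_superfunctions)

section \<open>All symmetries, their brackets, and the isomorphism\<close>

lemma symmetries_iff_flat:
  assumes a: "a \<noteq> 0" "a \<noteq> 1" and s1: "s1 = - 1 - a"
  shows "X \<in> symmetries a s1 \<longleftrightarrow> (\<exists>\<Phi>. flat a \<Phi> \<and> X = frame s1 (\<Phi> \<circ> idx))"
proof
  assume X: "X \<in> symmetries a s1"
  then have X3: "X \<in> vfields 3"
    by (simp add: symmetries_def)
  have "\<exists>\<Phi>. flat a \<Phi> \<and> vpart p X = frame s1 (\<Phi> \<circ> idx)" if p: "p \<in> {0, 1}" for p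
  proof -
    have "preserves_D s1 (vpart p X)" "lift_tangent_to_W a s1 (vpart p X)"
      using X p unfolding symmetries_def by blast+
    then show ?thesis
      using symmetry_imp_flat[OF vpart_vfields[OF X3] vhomog_vpart p a s1] by metis
  qed
  from this[of 0] this[of 1] obtain \<Phi> \<Psi> where flat: "flat a \<Phi>" "flat a \<Psi>"
    and X01: "vpart 0 X = frame s1 (\<Phi> \<circ> idx)" "vpart 1 X = frame s1 (\<Psi> \<circ> idx)"
    by auto
  have "X = frame s1 (\<Phi> \<circ> idx) + frame s1 (\<Psi> \<circ> idx)"
    using vpart_sum[of X] unfolding X01 by (rule sym)
  also have "\<dots> = frame s1 ((\<Phi> \<circ> idx) + (\<Psi> \<circ> idx))"
    by (simp only: frame_add)
  also have "(\<Phi> \<circ> idx) + (\<Psi> \<circ> idx) = (\<Phi> + \<Psi>) \<circ> idx"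
    by (rule ext) (simp only: comp_apply plus_fun_apply)
  finally show "\<exists>\<Phi>. flat a \<Phi> \<and> X = frame s1 (\<Phi> \<circ> idx)"
    using flat_add[OF flat] by blast
next
  assume "\<exists>\<Phi>. flat a \<Phi> \<and> X = frame s1 (\<Phi> \<circ> idx)"
  then obtain \<Phi> where flat: "flat a \<Phi>" and X: "X = frame s1 (\<Phi> \<circ> idx)" by blast
  have "preserves_D s1 (vpart p X) \<and> lift_tangent_to_W a s1 (vpart p X)" if p: "p \<in> {0, 1}" for p
    unfolding X vpart_frame_flat[OF p]
    using flat_imp_symmetry[OF flat_flat_part[OF flat] homog_flat_part p a s1] by blast
  then show "X \<in> symmetries a s1"
    unfolding symmetries_def using flat_frame_vfields[OF flat] X by blast
qed

lemma flat_bracket_add_left: "flat_bracket a (\<Phi> + \<Phi>') \<Psi> l = flat_bracket a \<Phi> \<Psi> l + flat_bracket a \<Phi>' \<Psi> l"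
  by (simp only: flat_bracket_def plus_fun_apply[of \<Phi> \<Phi>'] smult_add_left scl_add_right sum.distrib)

lemma flat_bracket_add_right: "flat_bracket a \<Phi> (\<Psi> + \<Psi>') l = flat_bracket a \<Phi> \<Psi> l + flat_bracket a \<Phi> \<Psi>' l"
  by (simp only: flat_bracket_def plus_fun_apply[of \<Psi> \<Psi>'] tau_add smult_add_right scl_add_right sum.distrib)

lemma vbracket_flat:
  assumes \<Phi>: "flat a \<Phi>" and \<Psi>: "flat a \<Psi>" and a: "a \<noteq> -1" and s1: "s1 = - 1 - a"
  shows "vbracket (frame s1 (\<Phi> \<circ> idx)) (frame s1 (\<Psi> \<circ> idx)) = frame s1 ((\<lambda>l. - flat_bracket a \<Phi> \<Psi> l) \<circ> idx)"
proof -
  define B where "B p q = (\<lambda>l. - flat_bracket a (flat_part p \<Phi>) (flat_part q \<Psi>) l)" for p q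
  have br: "vbracket (vpart p (frame s1 (\<Phi> \<circ> idx))) (vpart q (frame s1 (\<Psi> \<circ> idx))) = frame s1 (B p q \<circ> idx)"
    if "p \<in> {0, 1}" "q \<in> {0, 1}" for p q
    unfolding vpart_frame_flat[OF that(1)] vpart_frame_flat[OF that(2)] B_def
    by (rule vbracket_flat_homog[OF flat_flat_part[OF \<Phi>] flat_flat_part[OF \<Psi>] a s1 homog_flat_part that(1) homog_flat_part that(2)])
  have "vbracket (frame s1 (\<Phi> \<circ> idx)) (frame s1 (\<Psi> \<circ> idx)) = (\<Sum>p\<in>{0, 1}. \<Sum>q\<in>{0, 1}. frame s1 (B p q \<circ> idx))"
    unfolding vbracket_vpart_expand[OF flat_frame_vfields[OF \<Phi>] flat_frame_vfields[OF \<Psi>] order_refl]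
    by (intro sum.cong refl br)
  also have "\<dots> = frame s1 ((B 0 0 \<circ> idx) + (B 0 1 \<circ> idx) + ((B 1 0 \<circ> idx) + (B 1 1 \<circ> idx)))"
    by (simp add: frame_add)
  also have "(B 0 0 \<circ> idx) + (B 0 1 \<circ> idx) + ((B 1 0 \<circ> idx) + (B 1 1 \<circ> idx)) = (\<lambda>l. - flat_bracket a \<Phi> \<Psi> l) \<circ> idx"
  proof
    fix k
    have "flat_bracket a \<Phi> \<Psi> l = flat_bracket a (flat_part 0 \<Phi> + flat_part 1 \<Phi>) (flat_part 0 \<Psi> + flat_part 1 \<Psi>) l" for l
      by (simp only: flat_part_sum)
    then show "((B 0 0 \<circ> idx) + (B 0 1 \<circ> idx) + ((B 1 0 \<circ> idx) + (B 1 1 \<circ> idx))) k = ((\<lambda>l. - flat_bracket a \<Phi> \<Psi> l) \<circ> idx) k"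
      by (simp only: plus_fun_apply[of _ _ k] comp_apply B_def flat_bracket_add_left flat_bracket_add_right
          minus_add_distrib add_ac)
  qed
  finally show ?thesis .
qed

lemma smult_body: "(f \<odot> g) {} x = f {} x * g {} x"
  by (simp add: smult_apply)

text \<open>On the coefficient at \<open>{}\<close> the involution \<open>tau\<close> is trivial and
  the product is that of numbers. So the values at the origin multiply by the bracket of D(2,1;a)
  without extra signs.\<close>

lemma flat_bracket_body:
  "flat_bracket a \<Phi> \<Psi> l {} x = (\<Sum>k\<in>UNIV. \<Sum>m\<in>UNIV. \<Phi> k {} x * \<Psi> m {} x * gamma_const (- 1 - a) 1 a k m l)"
  by (simp add: flat_bracket_def sum_apply scl_apply smult_body tau_apply mult_ac)

text \<open>The natural map goes from the model to the fields, opposite to the direction in which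
  the isomorphism is asked for. Its inverse is used, and closedness of the algebra of fields is
  transported from the model.\<close>

lemma lie_super_isomorphicI:
  assumes "bij_betw G (lcarrier H) (lcarrier K)" and closed: "lie_super_closed H"
    and add: "\<And>u v. u \<in> lcarrier H \<Longrightarrow> v \<in> lcarrier H \<Longrightarrow> G (u + v) = G u + G v"
    and br: "\<And>u v. u \<in> lcarrier H \<Longrightarrow> v \<in> lcarrier H \<Longrightarrow> G (lbracket H u v) = lbracket K (G u) (G v)"
    and scale: "\<And>u c. u \<in> lcarrier H \<Longrightarrow> G (lscale H c u) = lscale K c (G u)"
    and comp: "\<And>u p. u \<in> lcarrier H \<Longrightarrow> G (lcomponent H p u) = lcomponent K p (G u)"
    and zero: "G 0 = 0"
  shows "lie_super_isomorphic K H"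
proof -
  define F where "F = inv_into (lcarrier H) G"
  have inj: "inj_on G (lcarrier H)" and img: "G ` lcarrier H = lcarrier K"
    using assms(1) by (auto simp: bij_betw_def)
  have FG: "F (G u) = u" if "u \<in> lcarrier H" for u
    unfolding F_def by (rule inv_into_f_f[OF inj that])
  have bijF: "bij_betw F (lcarrier K) (lcarrier H)"
    unfolding F_def by (rule bij_betw_inv_into[OF assms(1)])
  have obt: "\<exists>u \<in> lcarrier H. U = G u" if "U \<in> lcarrier K" for U
    using that img by blast
  have mem: "G u \<in> lcarrier K" if "u \<in> lcarrier H" for u
    using that img by blast
  note cl = closed[unfolded lie_super_closed_def]
  have closedK: "lie_super_closed K"
    unfolding lie_super_closed_def
  proof (intro conjI ballI allI)
    show "0 \<in> lcarrier K"
      using cl mem zero by metis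
    fix U assume "U \<in> lcarrier K"
    then obtain u where u: "u \<in> lcarrier H" "U = G u" using obt by blast
    show "lscale K c U \<in> lcarrier K" "lcomponent K p U \<in> lcarrier K" for c p
      using cl u mem scale comp by metis+
    fix V assume "V \<in> lcarrier K"
    then obtain v where v: "v \<in> lcarrier H" "V = G v" using obt by blast
    show "U + V \<in> lcarrier K" "lbracket K U V \<in> lcarrier K"
      using cl u v mem add br by metis+
  qed
  have "F (U + V) = F U + F V \<and> F (lbracket K U V) = lbracket H (F U) (F V)"
    if "U \<in> lcarrier K" "V \<in> lcarrier K" for U V
  proof -
    obtain u v where "u \<in> lcarrier H" "U = G u" "v \<in> lcarrier H" "V = G v"
      using obt \<open>U \<in> lcarrier K\<close> \<open>V \<in> lcarrier K\<close> by blast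
    then show ?thesis
      using cl by (simp add: FG flip: add br)
  qed
  moreover have "(\<forall>c. F (lscale K c U) = lscale H c (F U)) \<and> (\<forall>p. F (lcomponent K p U) = lcomponent H p (F U))"
    if U: "U \<in> lcarrier K" for U
  proof -
    obtain u where "u \<in> lcarrier H" "U = G u"
      using obt[OF U] by blast
    then show ?thesis
      using cl by (simp add: FG flip: scale comp)
  qed
  ultimately show ?thesis
    unfolding lie_super_isomorphic_def using closed closedK bijF by blast
qed

text \<open>This proceeds against the direction of \<open>flat_eq_0\<close>: each component of
  nonnegative degree occurs in a flatness equation of a component one degree lower, so vanishing
  spreads from \<mm> up to degree 2. Infinitesimally, no nonzero element of nonnegative degree
  centralizes \<mm>. Hence the vector field determines its flat section.\<close>

lemma flat_idx_eq_0:
  assumes flat: "flat a \<Phi>" and a: "a \<noteq> 0" and zero: "\<And>i. \<Phi> (idx i) = 0"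
  shows "\<Phi> = 0"
proof -
  note F = flat_Lop[OF flat]
  have [simp]: "\<Phi> (Inl (2, BY)) = 0" "\<Phi> (Inl (3, BY)) = 0" "\<Phi> (Inl (1, BY)) = 0"
    "\<Phi> (Inr (Vy, Vx, Vy)) = 0" "\<Phi> (Inr (Vy, Vy, Vx)) = 0" "\<Phi> (Inr (Vy, Vy, Vy)) = 0"
    using zero[of E1] zero[of E2] zero[of E5] zero[of E3] zero[of E4] zero[of E6] by simp_all
  have [simp]: "\<Phi> (Inl (2, BH)) = 0" "\<Phi> (Inl (3, BH)) = 0" "\<Phi> (Inr (Vy, Vx, Vx)) = 0" "\<Phi> (Inr (Vx, Vy, Vy)) = 0"
    using F[of E1 "Inl (2, BY)"] F[of E2 "Inl (3, BY)"] F[of E1 "Inr (Vy, Vy, Vx)"] F[of E4 "Inl (2, BY)"]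
    by (simp_all add: sum_gix scl_eq_0_iff)
  \<comment> \<open>The action on e_3 involves all three Cartan components, and the other two are
    already known to be 0.\<close>
  have [simp]: "\<Phi> (Inl (1, BH)) = 0"
    using F[of E3 "Inr (Vy, Vx, Vy)"] by (simp add: sum_gix)
  have [simp]: "\<Phi> (Inl (2, BX)) = 0" "\<Phi> (Inl (3, BX)) = 0" "\<Phi> (Inr (Vx, Vx, Vy)) = 0" "\<Phi> (Inr (Vx, Vy, Vx)) = 0"
    using F[of E1 "Inl (2, BH)"] F[of E2 "Inl (3, BH)"] F[of E1 "Inr (Vx, Vy, Vy)"] F[of E2 "Inr (Vx, Vy, Vy)"]
    by (simp_all add: sum_gix)
  have [simp]: "\<Phi> (Inl (1, BX)) = 0" "\<Phi> (Inr (Vx, Vx, Vx)) = 0"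
    using F[of E3 "Inr (Vx, Vx, Vy)"] F[of E1 "Inr (Vx, Vy, Vx)"] by (simp_all add: sum_gix)
  have "\<forall>l. \<Phi> l = 0"
    unfolding all_gix by simp
  then show ?thesis by (intro ext) simp
qed

theorem theorem4p22:
  fixes a :: complex
  assumes "a \<notin> {0, -1, 1, -2, - 1 / 2}"
  shows "lie_super_isomorphic (symmetry_superalgebra a (- 1 - a)) (D21 a)"
proof -
  have a: "a \<noteq> 0" "a \<noteq> 1" "a \<noteq> -1"
    using assms by auto
  define s1 where "s1 = - 1 - a"
  define G where "G u = frame s1 (flat_section a (\<lambda>k. - u k) \<circ> idx)" for u
  have G_eqI: "G u = frame s1 (\<Phi> \<circ> idx)" if "flat a \<Phi>" "\<And>l. \<Phi> l {} 0 = - u l" for \<Phi> u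
    unfolding G_def using flat_eq_flat_section[OF that(1) a(3), of "\<lambda>k. - u k"] that(2) by simp
  have flat: "flat a (flat_section a u)" for u
    by (rule flat_flat_section)
  have G_mem: "G u \<in> vfields 3" for u
    unfolding G_def by (rule flat_frame_vfields[OF flat])
  have inj: "inj G"
  proof (rule injI)
    fix u v assume eq: "G u = G v"
    let ?\<Phi> = "flat_section a (\<lambda>k. - u k)" and ?\<Psi> = "flat_section a (\<lambda>k. - v k)"
    have "?\<Phi> \<circ> idx = ?\<Psi> \<circ> idx"
      by (rule frame_inj[where q = 3, OF _ _ eq[unfolded G_def]]) (simp_all add: vfields_def superfunctions_flat_section)
    then have idx_eq: "?\<Phi> (idx i) = ?\<Psi> (idx i)" for i
      by (metis comp_apply)
    \<comment> \<open>Equality of the fields only compares the \<mm>-components; passing to the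
      difference makes \<open>flat_idx_eq_0\<close> applicable and extends the equality to the
      values at the origin.\<close>
    have "?\<Phi> + (\<lambda>l. - ?\<Psi> l) = 0"
    proof (rule flat_idx_eq_0[OF flat_add[OF flat flat_uminus[OF flat]] a(1)])
      fix i show "(?\<Phi> + (\<lambda>l. - ?\<Psi> l)) (idx i) = 0"
        unfolding plus_fun_apply[of ?\<Phi>] idx_eq by (rule right_minus)
    qed
    then have "(?\<Phi> + (\<lambda>l. - ?\<Psi> l)) l {} 0 = 0" for l
      by (simp only: zero_fun_apply)
    then have "u l = v l" for l
      by (simp add: flat_section_0)
    then show "u = v" by (rule ext)
  qed
  have range: "range G = symmetries a s1"
  proof (intro equalityI subsetI)
    fix X assume "X \<in> range G"
    then show "X \<in> symmetries a s1"
      unfolding symmetries_iff_flat[OF a(1,2) s1_def] G_def using flat by blast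
  next
    fix X assume "X \<in> symmetries a s1"
    then obtain \<Phi> where \<Phi>: "flat a \<Phi>" "X = frame s1 (\<Phi> \<circ> idx)"
      unfolding symmetries_iff_flat[OF a(1,2) s1_def] by blast
    have "X = G (\<lambda>l. - \<Phi> l {} 0)"
      unfolding \<Phi>(2) by (rule G_eqI[symmetric, OF \<Phi>(1)]) simp
    then show "X \<in> range G" by blast
  qed
  have "lie_super_isomorphic (symmetry_superalgebra a s1) (D21 a)"
  proof (rule lie_super_isomorphicI[where G = G])
    show "bij_betw G (lcarrier (D21 a)) (lcarrier (symmetry_superalgebra a s1))"
      using inj range by (simp add: bij_betw_def D21_def Gamma_def symmetry_superalgebra_def)
    show "lie_super_closed (D21 a)"
      by (simp add: lie_super_closed_def D21_def Gamma_def)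
    show add: "G (u + v) = G u + G v" for u v
    proof -
      have "G (u + v) = frame s1 ((flat_section a (\<lambda>k. - u k) + flat_section a (\<lambda>k. - v k)) \<circ> idx)"
        by (rule G_eqI[OF flat_add[OF flat flat]]) (simp add: flat_section_0)
      also have "(flat_section a (\<lambda>k. - u k) + flat_section a (\<lambda>k. - v k)) \<circ> idx
          = (flat_section a (\<lambda>k. - u k) \<circ> idx) + (flat_section a (\<lambda>k. - v k) \<circ> idx)"
        by (rule ext) (simp only: comp_apply plus_fun_apply)
      finally show ?thesis
        unfolding G_def frame_add .
    qed
    have "G 0 + G 0 = G 0"
      using add[of 0 0] by (simp only: add_0)
    then show "G 0 = 0"
      by (simp only: add_cancel_left_right)
    show "G (lbracket (D21 a) u v) = lbracket (symmetry_superalgebra a s1) (G u) (G v)" for u v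
    proof -
      have "vbracket (G u) (G v)
          = frame s1 ((\<lambda>l. - flat_bracket a (flat_section a (\<lambda>k. - u k)) (flat_section a (\<lambda>k. - v k)) l) \<circ> idx)"
        unfolding G_def by (rule vbracket_flat[OF flat flat a(3) s1_def])
      also have "\<dots> = G (lbracket (D21 a) u v)"
        by (rule G_eqI[symmetric, OF flat_uminus[OF flat_flat_bracket[OF flat flat]]])
          (simp add: flat_bracket_body flat_section_0 D21_def Gamma_def)
      finally show ?thesis
        by (simp add: symmetry_superalgebra_def)
    qed
    show "G (lscale (D21 a) c u) = lscale (symmetry_superalgebra a s1) c (G u)" for u c
    proof -
      have "G (lscale (D21 a) c u) = frame s1 ((\<lambda>l. scl c (flat_section a (\<lambda>k. - u k) l)) \<circ> idx)"
        by (rule G_eqI[OF flat_scl[OF flat]]) (simp add: flat_section_0 D21_def Gamma_def scl_apply)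
      also have "\<dots> = (\<lambda>k. scl c (G u k))"
        by (rule ext) (simp add: G_def frame_apply scl_sum_right)
      also have "\<dots> = lscale (symmetry_superalgebra a s1) c (G u)"
        by (rule ext) (simp add: symmetry_superalgebra_def sconst_smult[OF vfieldsD[OF G_mem]])
      finally show ?thesis .
    qed
    show "G (lcomponent (D21 a) p u) = lcomponent (symmetry_superalgebra a s1) p (G u)" for u p
    proof -
      \<comment> \<open>\<open>lcomponent\<close> accepts every natural number \<open>p\<close> and
        reads it modulo 2; \<open>q\<close> is the representative of \<open>p\<close> in
        \<open>{0, 1}\<close>, for which \<open>vpart_frame_flat\<close> is available.\<close>
      obtain q :: nat where q: "q \<in> {0, 1}" "even (p + q)"
        using that[of 0] that[of 1] by auto
      have "G (lcomponent (D21 a) p u) = frame s1 (flat_part q (flat_section a (\<lambda>k. - u k)) \<circ> idx)"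
        by (rule G_eqI[OF flat_flat_part[OF flat]])
          (use q(2) in \<open>auto simp: flat_part_def flat_section_0 D21_def Gamma_def gpar_def\<close>)
      also have "\<dots> = vpart q (G u)"
        unfolding G_def by (rule vpart_frame_flat[OF q(1), symmetric])
      also have "\<dots> = vpart p (G u)"
        using vpart_cong[OF q(2)] by simp
      finally show ?thesis
        by (simp add: symmetry_superalgebra_def)
    qed
  qed
  then show ?thesis
    by (simp only: s1_def)
qed

end
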